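(* Fix $d\in\mathbb{N}$ and $n\ge d$. Let $P\subset\mathbb{R}^n$ be a polyhedral set with non-empty interior and let $A\in\mathbb{R}^{d\times n}$ be a Gaussian matrix, i.e. a random matrix whose entries are independent standard Gaussian random variables. Then for all $j\in\{0,\dots,d-1\}$ and $k\in\{j,\dots,d-1\}$, $$\mathbb{E}\sum_{F\in\mathcal{F}_j(AP)}\upsilon_k\big(T_F(AP)\big)=\sum_{G\in\mathcal{F}_j(P)}\upsilon_k\big(T_G(P)\big).$$ In the remaining case $j\in\{0,\dots,d-1\}$ and $k=d$, $$\mathbb{E}\sum_{F\in\mathcal{F}_j(AP)}\upsilon_d\big(T_F(AP)\big)=\sum_{G\in\mathcal{F}_j(P)}\sum_{s=0}^{n-d}(-1)^s\upsilon_{d+s}\big(T_G(P)\big).$$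
   Context: $\mathbb{N}=\{1,2,\dots\}$. A polyhedral set is an intersection of finitely many closed half-spaces (whose boundaries need not pass through the origin); polyhedral cones (positive hulls of finitely many vectors) are special cases. $\mathcal{F}_j(P)$ is the set of $j$-dimensional faces of a polyhedral set $P$ ($P$ itself being a face). The tangent cone of $P\subset\mathbb{R}^N$ at a face $F$ is $T_F(P)=\{v\in\mathbb{R}^N: f_0+\varepsilon v\in P\text{ for some }\varepsilon>0\}$, where $f_0$ is any point of the relative interior of $F$; the normal cone is the polar cone $N_F(P)=\{w:\langle w,u\rangle\le 0\ \text{for all } u\in T_F(P)\}$. The solid angle of a polyhedral cone $C$ is $\alpha(C)=\mathbb{P}[Z\in C]$ with $Z$ uniformly distributed on the unit sphere of the linear hull of $C$; $\alpha(C)=1$ if $C$ is a linear subspace (including $C=\{0\}$). The $k$-th conic intrinsic volume of a polyhedral cone $C\subset\mathbb{R}^N$, $k\in\{0,\dots,N\}$, is $\upsilon_k(C)=\sum_{F\in\mathcal{F}_k(C)}\alpha(F)\,\alpha(N_F(C))$. In the statement, $T_F(AP)$ is a cone in $\mathbb{R}^d$ (computed for each realization of $A$) and $T_G(P)$ a cone in $\mathbb{R}^n$. *)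

theory Defs
  imports "HOL-Probability.Probability"
begin

definition faces_of_dim :: "nat \<Rightarrow> 'a::euclidean_space set \<Rightarrow> 'a set set"
  where "faces_of_dim j P = {F. F face_of P \<and> aff_dim F = int j}"

text \<open>For a face \<open>F\<close> of a convex set \<open>P\<close> the choice of the point \<open>f\<close> is irrelevant;
  see \<open>tangent_cone_eq\<close> below.\<close>

definition tangent_cone :: "'a::euclidean_space set \<Rightarrow> 'a set \<Rightarrow> 'a set"
  where "tangent_cone F P = {v. \<exists>f\<in>rel_interior F. \<exists>e>0. f + e *\<^sub>R v \<in> P}"

definition normal_cone :: "'a::euclidean_space set \<Rightarrow> 'a set \<Rightarrow> 'a set"
  where "normal_cone F P = {w. \<forall>u\<in>tangent_cone F P. w \<bullet> u \<le> 0}"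

text \<open>The uniform distribution on the unit sphere of a linear subspace \<open>L\<close> is the unique
  Borel probability measure on that sphere which is invariant under the orthogonal group of
  \<open>L\<close>. It is regarded here as a measure on the ambient space; every orthogonal transformation
  of \<open>L\<close> is the restriction of one of the ambient space that maps \<open>L\<close> onto itself.
  For \<open>L \<noteq> {0}\<close> existence and uniqueness are proved below.\<close>

definition is_sphere_uniform :: "'a::euclidean_space set \<Rightarrow> 'a measure \<Rightarrow> bool"
  where "is_sphere_uniform L \<mu> \<longleftrightarrow>
    prob_space \<mu> \<and> sets \<mu> = sets borel \<and> measure \<mu> (sphere 0 1 \<inter> L) = 1 \<and>
    (\<forall>f. orthogonal_transformation f \<and> f ` L = L \<longrightarrow> distr \<mu> borel f = \<mu>)"

definition sphere_uniform :: "'a::euclidean_space set \<Rightarrow> 'a measure"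
  where "sphere_uniform L = (THE \<mu>. is_sphere_uniform L \<mu>)"

definition solid_angle :: "'a::euclidean_space set \<Rightarrow> real"
  where "solid_angle C = (if subspace C then 1 else measure (sphere_uniform (span C)) C)"

definition conic_intrinsic_volume :: "nat \<Rightarrow> 'a::euclidean_space set \<Rightarrow> real"
  where "conic_intrinsic_volume k C =
    (\<Sum>F\<in>faces_of_dim k C. solid_angle F * solid_angle (normal_cone F C))"

definition gaussian_matrix :: "'w measure \<Rightarrow> ('w \<Rightarrow> real^'n^'d) \<Rightarrow> bool"
  where "gaussian_matrix M A \<longleftrightarrow>
    prob_space.indep_vars M (\<lambda>_. borel) (\<lambda>(i, l) \<omega>. A \<omega> $ i $ l) UNIV \<and>
    (\<forall>i l. distributed M lborel (\<lambda>\<omega>. A \<omega> $ i $ l) std_normal_density)"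

lemma tangent_cone_eq:
  fixes P :: "'a::euclidean_space set"
  assumes P: "convex P" and F: "F face_of P" and f: "f \<in> rel_interior F"
  shows "tangent_cone F P = {v. \<exists>e>0. f + e *\<^sub>R v \<in> P}"
proof -
  have "\<exists>e'>0. f + e' *\<^sub>R v \<in> P" if g: "g \<in> rel_interior F" and e: "e > 0" "g + e *\<^sub>R v \<in> P" for g e v
  proof -
    have cF: "convex F" and FP: "F \<subseteq> P"
      using F by (auto simp: face_of_def)
    have gF: "g \<in> F" using g rel_interior_subset by blast
    obtain t where t: "t > 1" "(1 - t) *\<^sub>R g + t *\<^sub>R f \<in> F"
      using convex_rel_interior_if2[OF cF f] gF
      by (metis hull_inc)
    define h where "h = (1 - t) *\<^sub>R g + t *\<^sub>R f"
    have f_eq: "f = (1 - 1/t) *\<^sub>R g + (1/t) *\<^sub>R h"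
    proof -
      have "(1 - 1/t) *\<^sub>R g + (1/t) *\<^sub>R h = (1 - 1/t + (1/t) * (1 - t)) *\<^sub>R g + ((1/t) * t) *\<^sub>R f"
        by (simp only: h_def scaleR_add_right scaleR_scaleR scaleR_add_left add.assoc)
      also have "1 - 1/t + (1/t) * (1 - t) = 0"
        using t by (simp add: field_simps)
      also have "(1/t) * t = 1"
        using t by simp
      finally show ?thesis by simp
    qed
    have "(1 - 1/t) *\<^sub>R (g + e *\<^sub>R v) + (1/t) *\<^sub>R h \<in> P"
      using e(2) t FP by (intro convexD[OF P, of "g + e *\<^sub>R v" h]) (auto simp: h_def)
    also have "(1 - 1/t) *\<^sub>R (g + e *\<^sub>R v) + (1/t) *\<^sub>R h = f + ((1 - 1/t) * e) *\<^sub>R v"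
    proof -
      have "(1 - 1/t) *\<^sub>R (g + e *\<^sub>R v) + (1/t) *\<^sub>R h
          = ((1 - 1/t) *\<^sub>R g + (1/t) *\<^sub>R h) + ((1 - 1/t) * e) *\<^sub>R v"
        by (simp only: scaleR_add_right scaleR_scaleR ac_simps)
      then show ?thesis by (simp only: f_eq[symmetric])
    qed
    finally show ?thesis
      using t e by (intro exI[of _ "(1 - 1/t) * e"]) simp
  qed
  then show ?thesis
    using f unfolding tangent_cone_def by blast
qed

lemma emeasure_lborel_open_nonzero:
  fixes U :: "'a::euclidean_space set"
  assumes "open U" "U \<noteq> {}"
  shows "emeasure lborel U \<noteq> 0"
proof
  assume "emeasure lborel U = 0"
  then have "U \<in> null_sets lebesgue"
    using assms by (intro null_setsI) (auto simp: emeasure_completion)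
  then show False
    using open_not_negligible[OF assms] by (simp add: negligible_iff_null_sets)
qed

lemma lborel_orthogonal_transformation:
  fixes f :: "'a::euclidean_space \<Rightarrow> 'a"
  assumes f: "orthogonal_transformation f"
  shows "distr lborel borel f = (lborel :: 'a measure)"
proof -
  let ?m = "distr lborel borel f"
  have lin: "linear f" using f by (simp add: orthogonal_transformation_linear)
  have fm [measurable]: "f \<in> borel_measurable borel"
    using lin by (intro borel_measurable_continuous_onI linear_continuous_on) (simp add: linear_conv_bounded_linear)
  have nf: "norm (f x) = norm x" for x
    using f orthogonal_transformation by blast
  have sf: "surj f"
    using f orthogonal_transformation_surj by blast
  have ball: "emeasure ?m (ball 0 1) = emeasure lborel (ball (0::'a) 1)"
    by (subst emeasure_distr) (auto intro!: arg_cong[where f = "emeasure lborel"] simp: nf)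
  have tr: "distr ?m borel (\<lambda>x. x + y) = ?m" for y
  proof -
    obtain z where z: "y = f z" using sf by (metis surjD)
    have "distr ?m borel (\<lambda>x. x + y) = distr lborel borel (\<lambda>x. f (z + x))"
      by (subst distr_distr) (auto simp: o_def z linear_add[OF lin] add.commute)
    also have "\<dots> = distr (distr lborel borel ((+) z)) borel f"
      by (subst distr_distr) (auto simp: o_def)
    also have "\<dots> = ?m" by (simp add: lborel_distr_plus)
    finally show ?thesis .
  qed
  have bounded_fin: "emeasure ?m (ball 0 (real n)) \<noteq> \<infinity>" for n
  proof -
    have "emeasure ?m (ball 0 (real n)) = emeasure lborel (ball (0::'a) (real n))"
      by (subst emeasure_distr) (auto intro!: arg_cong[where f = "emeasure lborel"] simp: nf)
    then show ?thesis using emeasure_lborel_ball_finite[of "0::'a" "real n"] by simp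
  qed
  interpret m: sigma_finite_measure ?m
  proof
    show "\<exists>A. countable A \<and> A \<subseteq> sets ?m \<and> \<Union> A = space ?m \<and> (\<forall>a\<in>A. emeasure ?m a \<noteq> \<infinity>)"
      using bounded_fin
      by (intro exI[of _ "range (\<lambda>n. ball 0 (real n))"]) (auto simp: reals_Archimedean2)
  qed
  interpret p: pair_sigma_finite ?m "lborel :: 'a measure" ..
  have key: "emeasure ?m (ball 0 1) * emeasure lborel B = emeasure ?m B * emeasure lborel (ball (0::'a) 1)"
    if [measurable]: "B \<in> sets borel" for B
  proof -
    let ?A = "ball (0::'a) 1"
    have [measurable]: "?A \<in> sets borel" by simp
    have [measurable_cong]: "sets ?m = sets borel" by simp
    have "emeasure ?m ?A * emeasure lborel B = (\<integral>\<^sup>+x. indicator ?A x \<partial>?m) * emeasure lborel B"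
      by simp
    also have "\<dots> = (\<integral>\<^sup>+x. indicator ?A x * emeasure lborel B \<partial>?m)"
      by (rule nn_integral_multc[symmetric], rule borel_measurable_indicator) simp
    also have "\<dots> = (\<integral>\<^sup>+x. indicator ?A x * emeasure (distr lborel borel ((+) x)) B \<partial>?m)"
      by (simp only: lborel_distr_plus)
    also have "\<dots> = (\<integral>\<^sup>+x. \<integral>\<^sup>+y. indicator ?A x * indicator B (x + y) \<partial>lborel \<partial>?m)"
      by (intro nn_integral_cong, subst nn_integral_cmult)
         (auto simp: emeasure_distr nn_integral_indicator[symmetric] nn_integral_distr
            simp del: nn_integral_indicator)
    also have "\<dots> = (\<integral>\<^sup>+y. \<integral>\<^sup>+x. indicator ?A x * indicator B (x + y) \<partial>?m \<partial>lborel)"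
      by (rule p.Fubini'[symmetric]) measurable
    also have "\<dots> = (\<integral>\<^sup>+y. \<integral>\<^sup>+x. indicator ?A (x - y) * indicator B x \<partial>?m \<partial>lborel)"
    proof (rule nn_integral_cong)
      fix y
      have "(\<integral>\<^sup>+x. indicator ?A (x - y) * indicator B x \<partial>?m)
          = (\<integral>\<^sup>+x. indicator ?A (x - y) * indicator B x \<partial>distr ?m borel (\<lambda>x. x + y))"
        by (simp only: tr)
      also have "\<dots> = (\<integral>\<^sup>+x. indicator ?A x * indicator B (x + y) \<partial>?m)"
        by (subst nn_integral_distr) auto
      finally show "(\<integral>\<^sup>+x. indicator ?A x * indicator B (x + y) \<partial>?m)
          = (\<integral>\<^sup>+x. indicator ?A (x - y) * indicator B x \<partial>?m)" ..
    qed
    also have "\<dots> = (\<integral>\<^sup>+x. \<integral>\<^sup>+y. indicator ?A (x - y) * indicator B x \<partial>lborel \<partial>?m)"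
      by (rule p.Fubini') measurable
    also have "\<dots> = (\<integral>\<^sup>+x. emeasure lborel ?A * indicator B x \<partial>?m)"
    proof (rule nn_integral_cong)
      fix x
      have "(\<integral>\<^sup>+y. indicator ?A (x - y) \<partial>lborel) = (\<integral>\<^sup>+y. indicator (ball x 1) y \<partial>lborel)"
        by (intro nn_integral_cong) (auto simp: indicator_def dist_norm norm_minus_commute)
      also have "\<dots> = emeasure (distr lborel borel ((+) x)) (ball x 1)"
        by (simp add: lborel_distr_plus)
      also have "\<dots> = emeasure lborel ?A"
        by (subst emeasure_distr)
           (auto intro!: arg_cong[where f = "emeasure lborel"] simp: dist_norm)
      finally show "(\<integral>\<^sup>+y. indicator ?A (x - y) * indicator B x \<partial>lborel)
          = emeasure lborel ?A * indicator B x"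
        by (subst nn_integral_multc) auto
    qed
    also have "\<dots> = emeasure ?m B * emeasure lborel ?A"
      by (subst nn_integral_cmult) (auto simp: mult.commute)
    finally show ?thesis .
  qed
  have pos: "emeasure lborel (ball (0::'a) 1) \<noteq> 0"
    by (rule emeasure_lborel_open_nonzero) auto
  show ?thesis
  proof (rule measure_eqI)
    fix B assume "B \<in> sets ?m"
    then have B: "B \<in> sets borel" by simp
    have "emeasure lborel (ball (0::'a) 1) * emeasure ?m B = emeasure lborel (ball (0::'a) 1) * emeasure lborel B"
      using key[OF B] ball by (simp add: mult.commute)
    moreover have "emeasure lborel (ball (0::'a) 1) \<noteq> \<top>"
      using emeasure_lborel_ball_finite[of "0::'a" 1] by simp
    ultimately show "emeasure ?m B = emeasure lborel B"
      using pos by (simp only: ennreal_mult_cancel_left simp_thms)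
  qed simp
qed

lemma ball_measure_const:
  assumes M: "is_sphere_uniform L M" and L: "subspace L"
    and x: "x \<in> sphere 0 1 \<inter> L" and y: "y \<in> sphere 0 1 \<inter> L"
  shows "emeasure M (ball x e) = emeasure M (ball y e)"
proof (cases "x = y")
  case False
  define v where "v = x - y"
  define f where "f z = z - (2 * (z \<bullet> v) / (v \<bullet> v)) *\<^sub>R v" for z
  have v: "v \<noteq> 0" "v \<in> L" using False x y L by (auto simp: v_def subspace_diff)
  have lin: "linear f"
    by (auto simp: f_def linear_iff algebra_simps add_divide_distrib)
  have ff: "f (f z) = z" for z
    using v by (simp add: f_def algebra_simps inner_diff_left)
  have "f z \<bullet> f w = z \<bullet> w" for z w
    using v by (simp add: f_def inner_diff_left inner_diff_right inner_commute field_simps)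
  then have orth: "orthogonal_transformation f"
    using lin by (simp add: orthogonal_transformation_def)
  have sub: "f z \<in> L" if "z \<in> L" for z
    using that v L by (auto simp: f_def intro!: subspace_diff subspace_scale)
  have fL: "f ` L = L"
    using sub ff by (metis image_eqI image_subsetI subsetI subset_antisym)
  have "x \<bullet> x = 1" "y \<bullet> y = 1" using x y by (auto simp: dot_square_norm)
  then have "2 * (x \<bullet> v) = v \<bullet> v"
    by (simp add: v_def inner_diff_left inner_diff_right inner_commute)
  then have fx: "f x = y" using v by (simp add: f_def v_def)
  have df: "dist (f z) (f w) = dist z w" for z w
    using orth by (metis dist_norm linear_diff[OF lin] orthogonal_transformation)
  have fm: "f \<in> borel_measurable borel"
    using lin by (intro borel_measurable_continuous_onI linear_continuous_on) (simp add: linear_conv_bounded_linear)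
  have sM: "sets M = sets borel" and dM: "distr M borel f = M"
    using M orth fL by (auto simp: is_sphere_uniform_def)
  have "emeasure M (ball y e) = emeasure (distr M borel f) (ball y e)" by (simp add: dM)
  also have "\<dots> = emeasure M (f -` ball y e \<inter> space M)"
    using fm sM by (subst emeasure_distr) (auto cong: measurable_cong_sets)
  also have "f -` ball y e \<inter> space M = ball x e"
    using sets_eq_imp_space_eq[OF sM] df[of x] by (auto simp: fx)
  finally show ?thesis ..
qed simp

lemma is_sphere_uniform_le:
  assumes M: "is_sphere_uniform L M" and N: "is_sphere_uniform L N" and L: "subspace L"
    and F: "closed F"
  shows "emeasure M F \<le> emeasure N F"
proof -
  let ?S = "sphere 0 1 \<inter> L"
  interpret M: prob_space M using M by (simp add: is_sphere_uniform_def)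
  interpret N: prob_space N using N by (simp add: is_sphere_uniform_def)
  interpret p: pair_sigma_finite M N ..
  have sets_MN [measurable_cong]: "sets M = sets borel" "sets N = sets borel"
    using M N by (auto simp: is_sphere_uniform_def)
  have clS: "closed ?S" by (intro closed_Int closed_sphere closed_subspace L)
  have [measurable]: "?S \<in> sets borel" "F \<in> sets borel" using clS F by auto
  have SM: "?S \<in> sets M" "?S \<in> sets N" by (simp_all only: sets_MN \<open>?S \<in> sets borel\<close>)
  have M1: "measure M ?S = 1" and N1: "measure N ?S = 1"
    using M N by (auto simp: is_sphere_uniform_def)
  have AM: "AE x in M. x \<in> ?S" using M1 SM(1) by (simp only: M.prob_eq_1)
  have AN: "AE x in N. x \<in> ?S" using N1 SM(2) by (simp only: N.prob_eq_1)
  have "?S \<noteq> {}" using M1 by (metis measure_empty zero_neq_one)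
  then obtain s where s: "s \<in> ?S" by blast
  have [measurable]: "Measurable.pred (borel \<Otimes>\<^sub>M borel) (\<lambda>(x, y). dist x (y::'a) < e)" for e
    by measurable
  define k where "k e x y = (indicator (ball x e) y :: ennreal)" for e and x y :: 'a
  have [measurable]: "(\<lambda>(x, y). k e x y) \<in> borel_measurable (borel \<Otimes>\<^sub>M borel)" for e
    unfolding k_def indicator_def mem_ball by measurable
  have kN: "(\<integral>\<^sup>+y. k e x y \<partial>N) = emeasure N (ball x e)" for x e
    unfolding k_def by (subst nn_integral_indicator) auto
  have kM: "(\<integral>\<^sup>+x. k e x y \<partial>M) = emeasure M (ball y e)" for y e
  proof -
    have "(\<integral>\<^sup>+x. k e x y \<partial>M) = (\<integral>\<^sup>+x. indicator (ball y e) x \<partial>M)"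
      by (intro nn_integral_cong) (auto simp: k_def indicator_def dist_commute)
    then show ?thesis by simp
  qed
  have main: "emeasure M F \<le> emeasure N {y. \<exists>x\<in>F. dist x y < e}" if e: "e > 0" for e
  proof -
    let ?G = "{y. \<exists>x\<in>F. dist x y < e}"
    have "?G = (\<Union>x\<in>F. ball x e)" by auto
    then have [measurable]: "?G \<in> sets borel" by (metis borel_open open_UN open_ball)
    define c where "c = emeasure N (ball s e)"
    define c' where "c' = emeasure M (ball s e)"
    have cN: "emeasure N (ball x e) = c" if "x \<in> ?S" for x
      unfolding c_def by (rule ball_measure_const[OF N L that s])
    have cM: "emeasure M (ball x e) = c'" if "x \<in> ?S" for x
      unfolding c'_def by (rule ball_measure_const[OF M L that s])
    have "c = (\<integral>\<^sup>+x. c \<partial>M)" by (simp add: M.emeasure_space_1)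
    also have "\<dots> = (\<integral>\<^sup>+x. \<integral>\<^sup>+y. k e x y \<partial>N \<partial>M)"
      by (intro nn_integral_cong_AE eventually_mono[OF AM]) (simp add: kN cN)
    also have "\<dots> = (\<integral>\<^sup>+y. \<integral>\<^sup>+x. k e x y \<partial>M \<partial>N)"
      by (rule p.Fubini'[symmetric]) measurable
    also have "\<dots> = (\<integral>\<^sup>+x. c' \<partial>N)"
      by (intro nn_integral_cong_AE eventually_mono[OF AN]) (simp add: kM cM)
    also have "\<dots> = c'" by (simp add: N.emeasure_space_1)
    finally have cc: "c = c'" .
    have c_fin: "c \<noteq> \<top>" by (simp add: c_def)
    have c_pos: "c \<noteq> 0"
    proof
      assume "c = 0"
      have "compact ?S" by (intro compact_Int_closed compact_sphere closed_subspace L)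
      moreover have "?S \<subseteq> (\<Union>x\<in>?S. ball x e)" using e by auto
      ultimately obtain T where T: "T \<subseteq> ?S" "finite T" "?S \<subseteq> (\<Union>x\<in>T. ball x e)"
        by (rule compactE_image[of ?S ?S "\<lambda>x. ball x e", OF _ open_ball])
      have "emeasure N (\<Union>x\<in>T. ball x e) \<le> (\<Sum>x\<in>T. emeasure N (ball x e))"
        using T by (intro emeasure_subadditive_finite) auto
      also have "\<dots> = 0" using T(1) cN \<open>c = 0\<close> by (intro sum.neutral ballI) blast
      finally have "emeasure N (\<Union>x\<in>T. ball x e) \<le> 0" .
      moreover have "emeasure N ?S \<le> emeasure N (\<Union>x\<in>T. ball x e)"
        using T(2) by (intro emeasure_mono[OF T(3)]) auto
      ultimately have "emeasure N ?S = 0" by simp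
      then show False using N1 by (simp add: measure_def)
    qed
    have "emeasure M F * c = (\<integral>\<^sup>+x. indicator F x * c \<partial>M)"
      by (simp add: nn_integral_multc)
    also have "\<dots> = (\<integral>\<^sup>+x. \<integral>\<^sup>+y. indicator F x * k e x y \<partial>N \<partial>M)"
      by (intro nn_integral_cong_AE eventually_mono[OF AM])
        (simp add: nn_integral_cmult kN cN)
    also have "\<dots> = (\<integral>\<^sup>+y. \<integral>\<^sup>+x. indicator F x * k e x y \<partial>M \<partial>N)"
      by (rule p.Fubini'[symmetric]) measurable
    also have "\<dots> \<le> (\<integral>\<^sup>+y. \<integral>\<^sup>+x. indicator ?G y * k e x y \<partial>M \<partial>N)"
      by (intro nn_integral_mono) (auto simp: k_def indicator_def)
    also have "\<dots> = (\<integral>\<^sup>+y. indicator ?G y * c \<partial>N)"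
      by (intro nn_integral_cong_AE eventually_mono[OF AN])
        (simp add: nn_integral_cmult kM cM cc)
    also have "\<dots> = emeasure N ?G * c"
      by (simp add: nn_integral_multc)
    finally show ?thesis
      by (simp only: ennreal_mult_le_mult_iff[OF c_pos c_fin] mult.commute[of _ c])
  qed
  define G where "G n = {y. \<exists>x\<in>F. dist x y < 1 / real (Suc n)}" for n
  have G_UN: "G n = (\<Union>x\<in>F. ball x (1 / real (Suc n)))" for n by (auto simp: G_def)
  have "G n \<in> sets N" for n
    unfolding G_UN sets_MN by (intro borel_open open_UN ballI open_ball)
  then have Gm: "range G \<subseteq> sets N" by blast
  have dec: "decseq G"
    unfolding decseq_def
  proof (intro allI impI)
    fix m n :: nat assume "m \<le> n"
    then have "1 / real (Suc n) \<le> 1 / real (Suc m)" by (simp add: frac_le)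
    then show "G n \<subseteq> G m" unfolding G_def by force
  qed
  have "(\<lambda>n. emeasure N (G n)) \<longlonglongrightarrow> emeasure N (\<Inter>n. G n)"
    by (rule Lim_emeasure_decseq[OF Gm dec]) auto
  moreover have "(\<Inter>n. G n) = F"
  proof
    show "F \<subseteq> (\<Inter>n. G n)" by (auto simp: G_def intro!: bexI)
    show "(\<Inter>n. G n) \<subseteq> F"
    proof
      fix y assume y: "y \<in> (\<Inter>n. G n)"
      have "\<exists>x\<in>F. dist x y < e" if "e > 0" for e
      proof -
        obtain n where "1 / real (Suc n) < e" using nat_approx_posE[OF \<open>e > 0\<close>] by blast
        moreover obtain x where "x \<in> F" "dist x y < 1 / real (Suc n)"
          using y by (auto simp: G_def)
        ultimately show ?thesis by (intro bexI[of _ x]) auto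
      qed
      then show "y \<in> F" using F closed_approachable by blast
    qed
  qed
  ultimately show ?thesis
    using main by (intro LIMSEQ_le_const[where X = "\<lambda>n. emeasure N (G n)"]) (auto simp: G_def)
qed

lemma is_sphere_uniform_unique:
  assumes "is_sphere_uniform L M" "is_sphere_uniform L N" "subspace L"
  shows "M = N"
proof (rule measure_eqI_generator_eq[where E = "Collect closed" and A = "\<lambda>_. UNIV" and \<Omega> = UNIV])
  interpret M: prob_space M using assms by (simp add: is_sphere_uniform_def)
  show "emeasure M UNIV \<noteq> \<infinity>" by simp
  show "emeasure M X = emeasure N X" if "X \<in> Collect closed" for X
    using that assms is_sphere_uniform_le by (metis antisym mem_Collect_eq)
qed (use assms in \<open>auto simp: is_sphere_uniform_def Int_stable_def borel_eq_closed\<close>)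

lemma is_sphere_uniform_exists:
  fixes L :: "'a::euclidean_space set"
  assumes L: "subspace L" "L \<noteq> {0}"
  shows "\<exists>\<mu>. is_sphere_uniform L \<mu>"
proof -
  define p where "p = closest_point L"
  define r where "r x = p x /\<^sub>R norm (p x)" for x
  define U where "U = {x \<in> ball 0 1. p x \<noteq> 0}"
  have cvx: "convex L" and cl: "closed L" and ne: "L \<noteq> {}"
    using L by (auto simp: subspace_imp_convex closed_subspace dest: subspace_0)
  have cont: "continuous_on T p" for T
    unfolding p_def by (rule continuous_on_closest_point[OF cvx cl ne])
  have [measurable]: "p \<in> borel_measurable borel"
    by (intro borel_measurable_continuous_onI cont)
  have [measurable]: "r \<in> borel_measurable borel"
    unfolding r_def by measurable
  have pL: "p x \<in> L" for x
    unfolding p_def by (rule closest_point_in_set[OF cl ne])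
  have openU: "open U"
  proof -
    have "U = ball 0 1 \<inter> p -` (- {0})" by (auto simp: U_def)
    then show ?thesis
      using continuous_open_preimage[OF cont[of "ball 0 1"] open_ball, of "- {0}"] by auto
  qed
  obtain u where u: "u \<in> L" "u \<noteq> 0" using L subspace_0[OF L(1)] by blast
  have "u /\<^sub>R (2 * norm u) \<in> U"
    using u L by (auto simp: U_def p_def closest_point_self subspace_scale)
  then have neU: "U \<noteq> {}" by blast
  have U_pos: "emeasure lborel U \<noteq> 0" by (rule emeasure_lborel_open_nonzero[OF openU neU])
  have "emeasure lborel U \<le> emeasure lborel (ball (0::'a) 1)"
    by (rule emeasure_mono) (auto simp: U_def)
  then have U_fin: "emeasure lborel U \<noteq> \<infinity>"
    using emeasure_lborel_ball_finite[of "0::'a" 1] by auto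
  have [measurable]: "U \<in> sets borel" using openU by simp
  define V where "V = uniform_measure lborel U"
  interpret V: prob_space V
    unfolding V_def by (rule prob_space_uniform_measure[OF U_pos U_fin])
  have [measurable_cong]: "sets V = sets borel" by (simp add: V_def)
  have spV: "space V = UNIV" by (simp add: V_def)
  have mS: "sphere 0 1 \<inter> L \<in> sets borel" using cl by (simp add: closed_Int)
  have mS': "{x \<in> space borel. x \<in> sphere 0 1 \<inter> L} \<in> sets borel"
    by (simp only: space_borel UNIV_I simp_thms Collect_mem_eq mS)
  define \<mu> where "\<mu> = distr V borel r"
  interpret mu: prob_space \<mu> unfolding \<mu>_def by (rule V.prob_space_distr) simp
  have "AE x in V. x \<in> U"
    unfolding V_def by (rule AE_uniform_measureI) auto
  then have "AE x in V. r x \<in> sphere 0 1 \<inter> L"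
    by (rule eventually_mono) (use pL L in \<open>auto simp: r_def U_def subspace_scale\<close>)
  then have "AE x in \<mu>. x \<in> sphere 0 1 \<inter> L"
    unfolding \<mu>_def by (subst AE_distr_iff[OF _ mS']) simp_all
  then have one: "measure \<mu> (sphere 0 1 \<inter> L) = 1"
    using mS mu.prob_eq_1[of "sphere 0 1 \<inter> L"] by (simp add: \<mu>_def)
  have inv: "distr \<mu> borel f = \<mu>" if f: "orthogonal_transformation f" and fL: "f ` L = L" for f
  proof -
    have lin: "linear f" using f by (simp add: orthogonal_transformation_linear)
    have [measurable]: "f \<in> borel_measurable borel"
      using lin by (intro borel_measurable_continuous_onI linear_continuous_on) (simp add: linear_conv_bounded_linear)
    have nf: "norm (f x) = norm x" for x
      using f orthogonal_transformation by blast
    have df: "dist (f z) (f w) = dist z w" for z w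
      by (simp add: dist_norm nf flip: linear_diff[OF lin])
    have pf: "p (f x) = f (p x)" for x
    proof -
      have fp: "f (p x) \<in> L" using imageI[OF pL, of f x] by (simp only: fL)
      have "dist (f x) (f (p x)) \<le> dist (f x) z" if "z \<in> L" for z
      proof -
        have "z \<in> f ` L" using that by (simp only: fL)
        then obtain w where w: "w \<in> L" "z = f w" by (elim imageE)
        show ?thesis
          using closest_point_le[OF cl w(1), of x] by (simp add: w(2) df p_def)
      qed
      then show ?thesis
        using closest_point_unique[OF cvx cl fp] by (metis p_def)
    qed
    have rf: "r (f x) = f (r x)" for x
      by (simp add: r_def pf nf linear_scale[OF lin])
    have f0: "f x = 0 \<longleftrightarrow> x = 0" for x
      by (metis nf norm_eq_zero)
    have Uf: "f -` U = U"
      using nf f0 by (simp add: U_def pf vimage_def)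
    have Vf: "distr V borel f = V"
    proof (rule measure_eqI)
      fix B assume "B \<in> sets (distr V borel f)"
      then have [measurable]: "B \<in> sets borel" by simp
      have "emeasure lborel (U \<inter> f -` B) = emeasure lborel (f -` (U \<inter> B))"
        using Uf by (simp add: vimage_Int)
      also have "\<dots> = emeasure (distr lborel borel f) (U \<inter> B)"
        by (subst emeasure_distr) auto
      also have "\<dots> = emeasure lborel (U \<inter> B)"
        by (simp add: lborel_orthogonal_transformation[OF f])
      finally have eq: "emeasure lborel (U \<inter> f -` B) = emeasure lborel (U \<inter> B)" .
      have "f -` B \<in> sets borel"
        using measurable_sets[of f borel borel B] by simp
      then show "emeasure (distr V borel f) B = emeasure V B"
        by (subst emeasure_distr) (auto simp: spV V_def eq)
    qed (simp add: V_def)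
    have "distr \<mu> borel f = distr V borel (\<lambda>x. f (r x))"
      unfolding \<mu>_def by (subst distr_distr) (auto simp: o_def)
    also have "\<dots> = distr V borel (\<lambda>x. r (f x))" by (simp add: rf)
    also have "\<dots> = distr (distr V borel f) borel r"
      by (subst distr_distr) (auto simp: o_def)
    also have "\<dots> = \<mu>" by (simp add: Vf \<mu>_def)
    finally show ?thesis .
  qed
  have "is_sphere_uniform L \<mu>"
    using one inv mu.prob_space_axioms by (auto simp: is_sphere_uniform_def \<mu>_def)
  then show ?thesis by blast
qed

lemma is_sphere_uniform_sphere_uniform:
  assumes "subspace L" "L \<noteq> {0}"
  shows "is_sphere_uniform L (sphere_uniform L)"
proof -
  obtain \<mu> where \<mu>: "is_sphere_uniform L \<mu>"
    using is_sphere_uniform_exists[OF assms] by blast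
  show ?thesis
    unfolding sphere_uniform_def
    by (rule theI[of _ \<mu>], rule \<mu>, rule is_sphere_uniform_unique[OF _ \<mu> assms(1)])
qed

end

theory Submission
  imports Defs
begin

text \<open>
  Both sides of the identity are sums over pairs \<open>F \<subseteq> H\<close> of faces. The \<open>k\<close>-dimensional faces of
  the tangent cone \<open>T\<^sub>F Q\<close> of a polyhedron are the tangent cones \<open>T\<^sub>F H\<close> of the \<open>k\<close>-dimensional
  faces \<open>H \<supseteq> F\<close>, and the normal cone of \<open>T\<^sub>F Q\<close> at \<open>T\<^sub>F H\<close> is \<open>N\<^sub>H Q\<close>. Hence
  \<open>\<upsilon>\<^sub>k (T\<^sub>F Q)\<close> is the sum of the products \<open>\<alpha> (T\<^sub>F H) \<alpha> (N\<^sub>H Q)\<close>. The two cones span orthogonal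
  complements, so such a product is the probability that a rotation invariant random point
  lies in \<open>T\<^sub>F H + N\<^sub>H Q\<close>. Everything about solid angles is derived from the uniqueness of the
  uniform distribution on a sphere (\<open>measure_proj_in_cones\<close>): if the law of a random point is
  invariant under the rotations that preserve a subspace \<open>L\<close>, then the directions of its
  components in \<open>L\<close> and in \<open>L\<^sup>\<bottom>\<close> are independent and uniform.

  \<^bold>\<open>The case\<close> \<open>k < d\<close>. A face \<open>H\<close> of \<open>P\<close> is mapped to a face of \<open>A P\<close> and can be recovered from it iff
  some functional of the form \<open>A\<^sup>T w\<close> is maximised over \<open>P\<close> exactly on \<open>H\<close>. In that case the
  tangent cone of \<open>A H\<close> at \<open>A F\<close> is \<open>A (T\<^sub>F H)\<close> and the normal cone of \<open>A P\<close> at \<open>A H\<close> consists of the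
  \<open>w\<close> with \<open>A\<^sup>T w \<in> N\<^sub>H P\<close>. So the contribution of the pair to the left-hand side is the probability
  that a rotation invariant random point \<open>y\<close> can be written as \<open>A x + w\<close> with \<open>x \<in> T\<^sub>F H\<close> and
  \<open>A\<^sup>T w \<in> N\<^sub>H P\<close>. If \<open>dim H < d\<close>, then almost surely \<open>A\<close> is injective on the direction space \<open>L\<close> of
  \<open>H\<close>, and \<open>y\<close> is uniquely \<open>A x + w\<close> with \<open>x \<in> L\<close> and \<open>w\<close> orthogonal to \<open>A L\<close>. The random point \<open>x + A\<^sup>T w\<close> has
  the components \<open>x\<close> in \<open>L\<close> and \<open>A\<^sup>T w\<close> in \<open>L\<^sup>\<bottom>\<close>, and a rotation of \<open>A\<close> from the right that
  preserves \<open>L\<close> rotates it. So its law has the required invariance, and the expected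
  contribution of the pair is \<open>\<alpha> (T\<^sub>F H) \<alpha> (N\<^sub>H P)\<close> (\<open>expected_projected_angle\<close>). The identity
  holds term by term.

  \<^bold>\<open>The case\<close> \<open>k = d\<close>. It follows from the other cases and the conic Gauss-Bonnet relation
  (\<open>conic_gauss_bonnet\<close>): the alternating sum of the conic intrinsic volumes of a polyhedral cone
  that is not a subspace vanishes. Applied to the tangent cones of \<open>A P\<close>, it expresses
  \<open>\<upsilon>\<^sub>d\<close> by the \<open>\<upsilon>\<^sub>k\<close> with \<open>k < d\<close>, whose expectations are known; applied to the tangent cones of \<open>P\<close>,
  it turns the resulting alternating sum over \<open>k < d\<close> into the one over \<open>k \<ge> d\<close>.

  \<^bold>\<open>Measurability.\<close> The probability space may fail to be complete, so the integrand has to be a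
  Borel function of the matrix, including the degenerate matrices. For this reason the formula
  for the face sum of \<open>A P\<close> (\<open>sum_conic_intrinsic_volume_linear_image\<close>) is proved for every
  linear map; the sets in it are projections of countable unions of compact sets.
\<close>

section \<open>Normal cones of polyhedra\<close>

definition direction_space :: "'a::euclidean_space set \<Rightarrow> 'a set"
  where "direction_space S = span {x - y | x y. x \<in> S \<and> y \<in> S}"

lemma subspace_direction_space [simp]: "subspace (direction_space S)"
  by (simp add: direction_space_def)

lemma diff_in_direction_space: "x \<in> S \<Longrightarrow> y \<in> S \<Longrightarrow> x - y \<in> direction_space S"
  by (auto simp: direction_space_def intro!: span_base)

lemma direction_space_mono: "S \<subseteq> T \<Longrightarrow> direction_space S \<subseteq> direction_space T"
  unfolding direction_space_def by (rule span_mono) blast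

lemma direction_space_eq:
  assumes f: "f \<in> S"
  shows "direction_space S = span ((\<lambda>x. x - f) ` S)"
proof
  show "span ((\<lambda>x. x - f) ` S) \<subseteq> direction_space S"
    by (rule span_minimal) (use f in \<open>auto intro: diff_in_direction_space\<close>)
  have "x - y \<in> span ((\<lambda>x. x - f) ` S)" if "x \<in> S" "y \<in> S" for x y
  proof -
    have "x - y = (x - f) - (y - f)" by simp
    then show ?thesis using that by (metis (no_types, lifting) imageI span_base span_diff)
  qed
  then show "direction_space S \<subseteq> span ((\<lambda>x. x - f) ` S)"
    unfolding direction_space_def by (intro span_minimal) auto
qed

lemma aff_dim_direction_space:
  assumes "S \<noteq> {}"
  shows "aff_dim S = int (dim (direction_space S))"
proof -
  obtain f where f: "f \<in> S" using assms by blast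
  then have "aff_dim S = int (dim ((\<lambda>x. x - f) ` S))"
    by (intro aff_dim_eq_dim_subtract hull_inc)
  then show ?thesis by (simp add: direction_space_eq[OF f])
qed

lemma direction_space_linear_image:
  assumes "linear A"
  shows "direction_space (A ` S) = A ` direction_space S"
proof -
  have "{x - y | x y. x \<in> A ` S \<and> y \<in> A ` S} = A ` {x - y | x y. x \<in> S \<and> y \<in> S}"
    by (auto simp: image_iff linear_diff[OF assms]) (metis linear_diff[OF assms], blast)
  then show ?thesis
    by (simp add: direction_space_def linear_span_image[OF assms])
qed

lemma affine_hull_direction_space:
  assumes f: "f \<in> S"
  shows "affine hull S = (\<lambda>v. f + v) ` direction_space S"
  using affine_hull_span_gen[OF hull_inc[OF f]] by (simp add: direction_space_eq[OF f] image_def)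

lemma orthogonal_comp_iff: "x \<in> W\<^sup>\<bottom> \<longleftrightarrow> (\<forall>y\<in>W. y \<bullet> x = 0)"
  by (simp add: orthogonal_comp_def orthogonal_def)

lemma orthogonal_to_direction_space_iff:
  "w \<in> (direction_space S)\<^sup>\<bottom> \<longleftrightarrow> (\<forall>x\<in>S. \<forall>y\<in>S. w \<bullet> x = w \<bullet> y)"
proof
  assume w: "w \<in> (direction_space S)\<^sup>\<bottom>"
  show "\<forall>x\<in>S. \<forall>y\<in>S. w \<bullet> x = w \<bullet> y"
  proof (intro ballI)
    fix x y assume "x \<in> S" "y \<in> S"
    then have "(x - y) \<bullet> w = 0" using w diff_in_direction_space orthogonal_comp_iff by blast
    then show "w \<bullet> x = w \<bullet> y" by (simp add: inner_commute[of w] inner_diff_left)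
  qed
next
  assume eq: "\<forall>x\<in>S. \<forall>y\<in>S. w \<bullet> x = w \<bullet> y"
  have "(x - y) \<bullet> w = 0" if "x \<in> S" "y \<in> S" for x y
    using eq[rule_format, OF that] by (metis inner_commute inner_diff_right right_minus_eq)
  then have "{x - y | x y. x \<in> S \<and> y \<in> S} \<subseteq> {v. v \<bullet> w = 0}"
    by blast
  then have "direction_space S \<subseteq> {v. v \<bullet> w = 0}"
    unfolding direction_space_def
    by (rule span_minimal) (simp add: subspace_def inner_left_distrib)
  then show "w \<in> (direction_space S)\<^sup>\<bottom>" by (auto simp: orthogonal_comp_iff)
qed

text \<open>Near \<open>h\<close> only the inequalities that are tight at \<open>h\<close> matter: a sufficiently short step keeps all the
  others. The set \<open>I\<close> consists of the normal vectors of the tight inequalities.\<close>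

lemma polyhedron_active_constraints:
  fixes Q :: "'a::euclidean_space set"
  assumes Q: "polyhedron Q" and h: "h \<in> Q"
  obtains I where "finite I" "0 \<notin> I" "\<And>a q. a \<in> I \<Longrightarrow> q \<in> Q \<Longrightarrow> a \<bullet> q \<le> a \<bullet> h"
    "\<And>v. (\<And>a. a \<in> I \<Longrightarrow> a \<bullet> v \<le> 0) \<Longrightarrow> \<exists>e>0. h + e *\<^sub>R v \<in> Q"
proof -
  obtain F where F: "finite F" "Q = \<Inter>F" "\<forall>H\<in>F. \<exists>a b. a \<noteq> 0 \<and> H = {x. a \<bullet> x \<le> b}"
    using Q unfolding polyhedron_def by blast
  then obtain a b where ab: "\<And>H. H \<in> F \<Longrightarrow> a H \<noteq> 0 \<and> H = {x. a H \<bullet> x \<le> b H}"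
    by metis
  define I where "I = a ` {H \<in> F. a H \<bullet> h = b H}"
  have 1: "c \<bullet> q \<le> c \<bullet> h" if "c \<in> I" "q \<in> Q" for c q
  proof -
    from that(1) obtain H where H: "H \<in> F" "c = a H" "a H \<bullet> h = b H" by (auto simp: I_def)
    have "q \<in> H" using that(2) F(2) H(1) by blast
    then show ?thesis using ab[OF H(1)] H(2,3) by auto
  qed
  have 2: "\<exists>e>0. h + e *\<^sub>R v \<in> Q" if v: "\<And>c. c \<in> I \<Longrightarrow> c \<bullet> v \<le> 0" for v
  proof -
    have "\<exists>e>0. \<forall>t. 0 < t \<and> t \<le> e \<longrightarrow> h + t *\<^sub>R v \<in> H" if H: "H \<in> F" for H
    proof (cases "a H \<bullet> h = b H")
      case True
      then have "a H \<bullet> v \<le> 0" using H by (intro v) (auto simp: I_def)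
      have "h + t *\<^sub>R v \<in> H" if "t > 0" for t
      proof -
        have "t * (a H \<bullet> v) \<le> 0" using \<open>a H \<bullet> v \<le> 0\<close> that by (simp add: mult_nonneg_nonpos)
        then have "a H \<bullet> (h + t *\<^sub>R v) \<le> b H" using True by (simp add: inner_right_distrib)
        then show ?thesis using ab[OF H] by blast
      qed
      then show ?thesis by (intro exI[of _ 1]) auto
    next
      case False
      have "h \<in> H" using h F(2) H by blast
      then have "a H \<bullet> h \<le> b H" using ab[OF H] by auto
      then have lt: "a H \<bullet> h < b H" using False by simp
      define e where "e = (b H - a H \<bullet> h) / (\<bar>a H \<bullet> v\<bar> + 1)"
      have e: "e > 0" using lt by (simp add: e_def)
      have "h + t *\<^sub>R v \<in> H" if t: "0 < t" "t \<le> e" for t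
      proof -
        have "t * (a H \<bullet> v) \<le> t * (\<bar>a H \<bullet> v\<bar> + 1)" using t by (intro mult_left_mono) auto
        also have "\<dots> \<le> e * (\<bar>a H \<bullet> v\<bar> + 1)" using t by (intro mult_right_mono) auto
        also have "\<dots> = b H - a H \<bullet> h" by (simp add: e_def add_nonneg_eq_0_iff)
        finally have "a H \<bullet> (h + t *\<^sub>R v) \<le> b H" by (simp add: inner_right_distrib)
        then show ?thesis using ab[OF H] by blast
      qed
      then show ?thesis using e by blast
    qed
    then obtain e where e: "\<And>H. H \<in> F \<Longrightarrow> e H > 0 \<and> (\<forall>t. 0 < t \<and> t \<le> e H \<longrightarrow> h + t *\<^sub>R v \<in> H)"
      by metis
    define d where "d = Min (insert 1 (e ` F))"
    have "d > 0" using F(1) e unfolding d_def by (subst Min_gr_iff) auto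
    moreover have "d \<le> e H" if "H \<in> F" for H
      using F(1) that unfolding d_def by (intro Min_le) auto
    ultimately have "h + d *\<^sub>R v \<in> Q" using e F(2) by auto
    then show ?thesis using \<open>d > 0\<close> by blast
  qed
  show thesis
    by (rule that[of I]) (use 1 2 F(1) ab in \<open>auto simp: I_def\<close>)
qed

lemma rel_interior_extend:
  fixes H :: "'a::euclidean_space set"
  assumes H: "convex H" and h: "h \<in> rel_interior H" and x: "x \<in> H"
  obtains t where "t > 0" "h + t *\<^sub>R (h - x) \<in> H"
proof -
  obtain e where e: "e > 1" "(1 - e) *\<^sub>R x + e *\<^sub>R h \<in> H"
    using convex_rel_interior_if2[OF H h] hull_inc[OF x] by blast
  have "(1 - e) *\<^sub>R x + e *\<^sub>R h = h + (e - 1) *\<^sub>R (h - x)" by (simp add: algebra_simps)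
  then show thesis using e that[of "e - 1"] by simp
qed

lemma face_nonempty_rel_interior:
  fixes H :: "'a::euclidean_space set"
  assumes "H face_of Q" "H \<noteq> {}"
  obtains h where "h \<in> rel_interior H" "h \<in> H" "h \<in> Q"
proof -
  have "convex H" using assms(1) by (rule face_of_imp_convex)
  then obtain h where "h \<in> rel_interior H" using assms(2) rel_interior_eq_empty by blast
  then show thesis using that rel_interior_subset face_of_imp_subset[OF assms(1)] by blast
qed

text \<open>A functional that attains its maximum over \<open>Q\<close> at a relative interior point of \<open>H\<close> is constant on
  \<open>H\<close>, because a segment in \<open>H\<close> that ends at this point can be prolonged. So the choice of the point
  disappears, and the normal cone is described by linear inequalities alone.\<close>

lemma normal_cone_iff:
  fixes Q :: "'a::euclidean_space set"
  assumes Q: "convex Q" and H: "H face_of Q" and ne: "H \<noteq> {}"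
  shows "w \<in> normal_cone H Q \<longleftrightarrow> (\<forall>q\<in>Q. \<forall>h\<in>H. w \<bullet> q \<le> w \<bullet> h)"
proof
  assume w: "w \<in> normal_cone H Q"
  obtain f where f: "f \<in> rel_interior H" "f \<in> H" "f \<in> Q" by (rule face_nonempty_rel_interior[OF H ne])
  have le: "w \<bullet> q \<le> w \<bullet> f" if "q \<in> Q" for q
  proof -
    have "q - f \<in> tangent_cone H Q"
      unfolding tangent_cone_def using f that
      by (auto intro!: bexI[of _ f] exI[of _ 1])
    then have "w \<bullet> (q - f) \<le> 0" using w unfolding normal_cone_def by blast
    then show ?thesis by (simp add: inner_diff_right)
  qed
  show "\<forall>q\<in>Q. \<forall>h\<in>H. w \<bullet> q \<le> w \<bullet> h"
  proof (intro ballI)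
    fix q h assume q: "q \<in> Q" and h: "h \<in> H"
    obtain t where t: "t > 0" "f + t *\<^sub>R (f - h) \<in> H"
      by (rule rel_interior_extend[OF face_of_imp_convex[OF H] f(1) h])
    then have "w \<bullet> (f + t *\<^sub>R (f - h)) \<le> w \<bullet> f" using le face_of_imp_subset[OF H] by blast
    then have "t * (w \<bullet> (f - h)) \<le> 0" by (simp add: inner_right_distrib)
    then have "w \<bullet> f \<le> w \<bullet> h" using t(1) by (simp add: mult_le_0_iff inner_diff_right)
    then show "w \<bullet> q \<le> w \<bullet> h" using le[OF q] by simp
  qed
next
  assume a: "\<forall>q\<in>Q. \<forall>h\<in>H. w \<bullet> q \<le> w \<bullet> h"
  show "w \<in> normal_cone H Q"
    unfolding normal_cone_def tangent_cone_def
  proof clarify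
    fix u f e assume f: "f \<in> rel_interior H" and e: "(e::real) > 0" and q: "f + e *\<^sub>R u \<in> Q"
    have "f \<in> H" using f rel_interior_subset by blast
    then have "w \<bullet> (f + e *\<^sub>R u) \<le> w \<bullet> f" using a q by blast
    then show "w \<bullet> u \<le> 0" using e by (simp add: inner_right_distrib mult_le_0_iff)
  qed
qed

text \<open>The functionals whose set of maximisers over \<open>Q\<close> is \<open>H\<close>. For a nonempty face of a polyhedron this is the
  relative interior of the normal cone; it behaves better than the latter under linear maps, because
  it is empty when no functional exposes \<open>H\<close>.\<close>

definition exposing_functionals :: "'a::euclidean_space set \<Rightarrow> 'a set \<Rightarrow> 'a set"
  where "exposing_functionals H Q = {w. H = {h \<in> Q. \<forall>q\<in>Q. w \<bullet> q \<le> w \<bullet> h}}"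

lemma closed_convex_cone_normal_cone:
  fixes Q :: "'a::euclidean_space set"
  assumes "convex Q" "H face_of Q" "H \<noteq> {}"
  shows "closed (normal_cone H Q)" "convex (normal_cone H Q)" "0 \<in> normal_cone H Q"
    "c \<ge> 0 \<Longrightarrow> w \<in> normal_cone H Q \<Longrightarrow> c *\<^sub>R w \<in> normal_cone H Q"
    "w \<in> normal_cone H Q \<Longrightarrow> w' \<in> normal_cone H Q \<Longrightarrow> w + w' \<in> normal_cone H Q"
proof -
  have eq: "normal_cone H Q = (\<Inter>u\<in>tangent_cone H Q. {w. u \<bullet> w \<le> 0})"
    by (auto simp: normal_cone_def inner_commute)
  show "closed (normal_cone H Q)" "convex (normal_cone H Q)"
    unfolding eq by (auto intro!: closed_INT closed_halfspace_le convex_INT convex_halfspace_le)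
  show "0 \<in> normal_cone H Q" by (simp add: normal_cone_def)
  show "c \<ge> 0 \<Longrightarrow> w \<in> normal_cone H Q \<Longrightarrow> c *\<^sub>R w \<in> normal_cone H Q"
    by (auto simp: normal_cone_def mult_nonneg_nonpos)
  show "w \<in> normal_cone H Q \<Longrightarrow> w' \<in> normal_cone H Q \<Longrightarrow> w + w' \<in> normal_cone H Q"
    by (auto simp: normal_cone_def inner_left_distrib add_nonpos_nonpos)
qed

text \<open>Normal vectors are constant on \<open>H\<close>, which gives one inclusion. For the other one, a vector \<open>v\<close> that is
  orthogonal to the normal cone is orthogonal to all constraints that are active at a relative interior
  point \<open>f\<close> of \<open>H\<close>. Then \<open>f\<close> can be moved inside \<open>Q\<close> both along \<open>v\<close> and along \<open>-v\<close>, and since \<open>H\<close> is a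
  face, both moves stay in \<open>H\<close>.\<close>

lemma span_normal_cone:
  fixes Q :: "'a::euclidean_space set"
  assumes Q: "polyhedron Q" and H: "H face_of Q" and ne: "H \<noteq> {}"
  shows "span (normal_cone H Q) = (direction_space H)\<^sup>\<bottom>"
proof
  have cQ: "convex Q" by (rule polyhedron_imp_convex[OF Q])
  note nc = normal_cone_iff[OF cQ H ne]
  have HQ: "H \<subseteq> Q" by (rule face_of_imp_subset[OF H])
  have "w \<in> (direction_space H)\<^sup>\<bottom>" if "w \<in> normal_cone H Q" for w
    unfolding orthogonal_to_direction_space_iff using that HQ by (meson nc antisym subsetD)
  then show "span (normal_cone H Q) \<subseteq> (direction_space H)\<^sup>\<bottom>"
    by (intro span_minimal subspace_orthogonal_comp) blast
  obtain f where f: "f \<in> rel_interior H" "f \<in> H" "f \<in> Q" by (rule face_nonempty_rel_interior[OF H ne])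
  obtain I where I: "finite I" "0 \<notin> I" "\<And>a q. a \<in> I \<Longrightarrow> q \<in> Q \<Longrightarrow> a \<bullet> q \<le> a \<bullet> f"
    "\<And>v. (\<And>a. a \<in> I \<Longrightarrow> a \<bullet> v \<le> 0) \<Longrightarrow> \<exists>e>0. f + e *\<^sub>R v \<in> Q"
    using polyhedron_active_constraints[OF Q f(3)] by metis
  have IN: "I \<subseteq> normal_cone H Q"
  proof
    fix a assume a: "a \<in> I"
    show "a \<in> normal_cone H Q" unfolding nc
    proof (intro ballI)
      fix q h assume q: "q \<in> Q" and h: "h \<in> H"
      obtain t where t: "t > 0" "f + t *\<^sub>R (f - h) \<in> H"
        by (rule rel_interior_extend[OF face_of_imp_convex[OF H] f(1) h])
      then have "a \<bullet> (f + t *\<^sub>R (f - h)) \<le> a \<bullet> f" using I(3)[OF a] HQ by blast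
      then have "t * (a \<bullet> (f - h)) \<le> 0" by (simp add: inner_right_distrib)
      then have "a \<bullet> f \<le> a \<bullet> h" using t(1) by (simp add: mult_le_0_iff inner_diff_right)
      then show "a \<bullet> q \<le> a \<bullet> h" using I(3)[OF a q] by simp
    qed
  qed
  have "(span (normal_cone H Q))\<^sup>\<bottom> \<subseteq> direction_space H"
  proof
    fix v assume v: "v \<in> (span (normal_cone H Q))\<^sup>\<bottom>"
    have av: "a \<bullet> v = 0" if "a \<in> I" for a
      using v IN that by (meson orthogonal_comp_iff span_base subsetD)
    obtain e1 where e1: "e1 > 0" "f + e1 *\<^sub>R v \<in> Q" using I(4)[of v] av by auto
    obtain e2 where e2: "e2 > 0" "f + e2 *\<^sub>R (- v) \<in> Q" using I(4)[of "- v"] av by auto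
    show "v \<in> direction_space H"
    proof (cases "v = 0")
      case True then show ?thesis by (simp add: subspace_0)
    next
      case False
      \<comment> \<open>The weight for which \<open>f\<close> is the convex combination of its two displacements.\<close>
      define u where "u = e2 / (e1 + e2)"
      have u: "0 < u" "u < 1" using e1 e2 by (auto simp: u_def)
      have "(1 - u) * e2 = u * e1" using e1 e2 by (simp add: u_def field_simps)
      then have "((1 - u) * e2) *\<^sub>R v = (u * e1) *\<^sub>R v" by simp
      then have feq: "f = (1 - u) *\<^sub>R (f + e2 *\<^sub>R (- v)) + u *\<^sub>R (f + e1 *\<^sub>R v)"
        by (simp only: scaleR_add_right scaleR_scaleR scaleR_minus_right)
           (simp add: algebra_simps flip: scaleR_add_left)
      have "(e1 + e2) *\<^sub>R v \<noteq> 0" using False e1(1) e2(1) by simp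
      then have "f + e2 *\<^sub>R (- v) \<noteq> f + e1 *\<^sub>R v"
        by (auto simp: algebra_simps add_eq_0_iff2 neg_eq_iff_add_eq_0)
      then have "f \<in> open_segment (f + e2 *\<^sub>R (- v)) (f + e1 *\<^sub>R v)"
        unfolding in_segment using feq u by blast
      then have "f + e1 *\<^sub>R v \<in> H"
        using face_ofD[OF H _ e2(2) e1(2) f(2)] by blast
      then have "(f + e1 *\<^sub>R v) - f \<in> direction_space H" using f(2) by (rule diff_in_direction_space)
      then have d: "e1 *\<^sub>R v \<in> direction_space H" by simp
      show ?thesis
        using subspace_scale[OF subspace_direction_space d, of "inverse e1"] e1(1) by simp
    qed
  qed
  then have "(direction_space H)\<^sup>\<bottom> \<subseteq> (span (normal_cone H Q))\<^sup>\<bottom>\<^sup>\<bottom>"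
    by (rule orthogonal_comp_anti_mono)
  then show "(direction_space H)\<^sup>\<bottom> \<subseteq> span (normal_cone H Q)"
    by (simp add: orthogonal_comp_self)
qed

text \<open>Otherwise the functional would be positive at a point that is reached from \<open>c\<close> by a short step away
  from \<open>n\<close>.\<close>

lemma rel_interior_functional_zero:
  fixes N :: "'a::euclidean_space set"
  assumes N: "convex N" and c: "c \<in> rel_interior N" and le: "\<And>n. n \<in> N \<Longrightarrow> y \<bullet> n \<le> 0"
    and y: "y \<bullet> c = 0" and n: "n \<in> N"
  shows "y \<bullet> n = 0"
proof -
  obtain t where t: "t > 0" "c + t *\<^sub>R (c - n) \<in> N" by (rule rel_interior_extend[OF N c n])
  then have "y \<bullet> (c + t *\<^sub>R (c - n)) \<le> 0" using le by blast
  then have "0 \<le> t * (y \<bullet> n)" using y by (simp add: inner_right_distrib inner_diff_right)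
  then show ?thesis using t(1) le[OF n] by (simp add: zero_le_mult_iff)
qed

text \<open>If a functional in the relative interior also had a maximiser \<open>q\<close> outside \<open>H\<close>, then \<open>q - f\<close> with
  \<open>f \<in> H\<close> would be orthogonal to the whole normal cone and hence a direction of \<open>H\<close>. Conversely, a
  functional \<open>c\<close> on the relative boundary has a supporting hyperplane with normal vector \<open>a\<close>. Since the active
  constraints belong to the normal cone, a short step along \<open>-a\<close> stays in \<open>Q\<close>; it does not change the
  value of \<open>c\<close>, so it stays in \<open>H\<close>, and the hyperplane contains the normal cone.\<close>

lemma rel_interior_normal_cone:
  fixes Q :: "'a::euclidean_space set"
  assumes Q: "polyhedron Q" and H: "H face_of Q" and ne: "H \<noteq> {}"
  shows "rel_interior (normal_cone H Q) = exposing_functionals H Q"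
proof
  let ?N = "normal_cone H Q"
  have cQ: "convex Q" by (rule polyhedron_imp_convex[OF Q])
  note nc = normal_cone_iff[OF cQ H ne]
  have HQ: "H \<subseteq> Q" by (rule face_of_imp_subset[OF H])
  have cN: "convex ?N" and clN: "closed ?N" using closed_convex_cone_normal_cone[OF cQ H ne] by auto
  obtain f where f: "f \<in> rel_interior H" "f \<in> H" "f \<in> Q" by (rule face_nonempty_rel_interior[OF H ne])
  show "rel_interior ?N \<subseteq> exposing_functionals H Q"
  proof
    fix c assume c: "c \<in> rel_interior ?N"
    then have cin: "c \<in> ?N" using rel_interior_subset by blast
    have "q \<in> H" if q: "q \<in> Q" and max: "\<forall>p\<in>Q. c \<bullet> p \<le> c \<bullet> q" for q
    proof -
      have "c \<bullet> q = c \<bullet> f" using max f q cin nc by (meson antisym)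
      then have z: "(q - f) \<bullet> c = 0" by (simp add: inner_commute inner_diff_right)
      have "(q - f) \<bullet> n \<le> 0" if "n \<in> ?N" for n
        using that q f(2) by (simp add: nc inner_commute[of _ n] inner_diff_right)
      then have "\<And>n. n \<in> ?N \<Longrightarrow> (q - f) \<bullet> n = 0"
        using rel_interior_functional_zero[OF cN c _ z] by blast
      then have "q - f \<in> ?N\<^sup>\<bottom>" by (simp add: orthogonal_comp_iff inner_commute)
      then have "span ?N \<subseteq> {x. (q - f) \<bullet> x = 0}"
        by (intro span_minimal) (auto simp: orthogonal_comp_iff inner_commute[of "q - f"] subspace_def inner_left_distrib)
      then have "q - f \<in> (span ?N)\<^sup>\<bottom>" by (auto simp: orthogonal_comp_iff inner_commute)
      then have "q - f \<in> direction_space H"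
        by (simp add: span_normal_cone[OF Q H ne] orthogonal_comp_self)
      then have "q \<in> affine hull H"
        by (auto simp: affine_hull_direction_space[OF f(2)] image_iff intro!: bexI[of _ "q - f"])
      then show ?thesis using face_of_imp_eq_affine_Int[OF cQ H] q by blast
    qed
    moreover have "\<forall>q\<in>Q. c \<bullet> q \<le> c \<bullet> h" if "h \<in> H" for h using cin nc that by blast
    ultimately show "c \<in> exposing_functionals H Q"
      using HQ unfolding exposing_functionals_def by blast
  qed
  show "exposing_functionals H Q \<subseteq> rel_interior ?N"
  proof
    fix c assume "c \<in> exposing_functionals H Q"
    then have Heq: "H = {h \<in> Q. \<forall>q\<in>Q. c \<bullet> q \<le> c \<bullet> h}" by (simp add: exposing_functionals_def)
    then have cin: "c \<in> ?N" using nc by blast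
    show "c \<in> rel_interior ?N"
    proof (rule ccontr)
      assume "c \<notin> rel_interior ?N"
      then obtain a where a: "a \<noteq> 0" "\<And>y. y \<in> closure ?N \<Longrightarrow> a \<bullet> c \<le> a \<bullet> y"
        "\<And>y. y \<in> rel_interior ?N \<Longrightarrow> a \<bullet> c < a \<bullet> y"
        using supporting_hyperplane_relative_frontier[OF cN] cin closure_subset by (metis subsetD)
      have N0: "0 \<in> ?N" and N2: "2 *\<^sub>R c \<in> ?N"
        using closed_convex_cone_normal_cone[OF cQ H ne] cin by auto
      have "a \<bullet> c \<le> 0" using a(2)[of 0] N0 closure_subset by auto
      moreover have "a \<bullet> c \<le> a \<bullet> (2 *\<^sub>R c)" using a(2) N2 closure_subset by blast
      ultimately have ac: "a \<bullet> c = 0" by simp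
      have age: "a \<bullet> y \<ge> 0" if "y \<in> ?N" for y using a(2)[of y] that closure_subset ac by auto
      obtain I where I: "finite I" "0 \<notin> I" "\<And>b q. b \<in> I \<Longrightarrow> q \<in> Q \<Longrightarrow> b \<bullet> q \<le> b \<bullet> f"
        "\<And>v. (\<And>b. b \<in> I \<Longrightarrow> b \<bullet> v \<le> 0) \<Longrightarrow> \<exists>e>0. f + e *\<^sub>R v \<in> Q"
        using polyhedron_active_constraints[OF Q f(3)] by metis
      have "b \<in> ?N" if b: "b \<in> I" for b
        unfolding normal_cone_def mem_Collect_eq tangent_cone_eq[OF cQ H f(1)]
      proof (intro ballI)
        fix u assume "u \<in> {v. \<exists>e>0. f + e *\<^sub>R v \<in> Q}"
        then obtain e where e: "e > 0" "f + e *\<^sub>R u \<in> Q" by blast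
        then have "b \<bullet> (f + e *\<^sub>R u) \<le> b \<bullet> f" using I(3)[OF b] by blast
        then show "b \<bullet> u \<le> 0" using e(1) by (simp add: inner_right_distrib mult_le_0_iff)
      qed
      then have "b \<bullet> (- a) \<le> 0" if "b \<in> I" for b using age that by (simp add: inner_commute[of b])
      then obtain e where e: "e > 0" "f + e *\<^sub>R (- a) \<in> Q" using I(4) by blast
      have "c \<bullet> (f + e *\<^sub>R (- a)) = c \<bullet> f" using ac by (simp add: inner_diff_right inner_commute)
      then have "f + e *\<^sub>R (- a) \<in> H" using Heq f(2) e(2) by auto
      then have "w \<bullet> (f + e *\<^sub>R (- a)) = w \<bullet> f" if "w \<in> ?N" for w
        using that f(2,3) e(2) by (meson nc antisym)
      then have z: "a \<bullet> w = 0" if "w \<in> ?N" for w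
        using that e(1) by (simp add: inner_diff_right inner_commute[of a])
      have "rel_interior ?N \<noteq> {}" using cN N0 rel_interior_eq_empty by blast
      then obtain y where "y \<in> rel_interior ?N" by blast
      then show False using a(3)[of y] z[of y] ac rel_interior_subset by (metis less_irrefl subsetD)
    qed
  qed
qed

section \<open>Tangent cones and their faces\<close>

lemma convex_shrink:
  assumes "convex Q" "f \<in> Q" "f + e *\<^sub>R v \<in> Q" "0 \<le> d" "d \<le> e"
  shows "f + d *\<^sub>R v \<in> Q"
proof (cases "d = 0")
  case True then show ?thesis using assms by simp
next
  case False
  then have e: "e > 0" using assms by simp
  have "(1 - d / e) *\<^sub>R f + (d / e) *\<^sub>R (f + e *\<^sub>R v) \<in> Q"
    using assms e by (intro convexD) (auto simp: divide_simps)
  also have "(1 - d / e) *\<^sub>R f + (d / e) *\<^sub>R (f + e *\<^sub>R v) = f + d *\<^sub>R v"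
    using e by (simp add: algebra_simps)
  finally show ?thesis .
qed

text \<open>Finitely many tangent directions can be tested with one and the same step length, because
  shortening a step is harmless in a convex set.\<close>

lemma tangent_cone_common_scale:
  fixes Q :: "'a::euclidean_space set"
  assumes Q: "convex Q" "F face_of Q" "f \<in> rel_interior F" and R: "convex R" "F face_of R"
    and v: "v \<in> tangent_cone F Q" and w: "w \<in> tangent_cone F R"
  obtains e where "e > 0" "f + e *\<^sub>R v \<in> Q" "f + e *\<^sub>R w \<in> R"
proof -
  have fQ: "f \<in> Q" and fR: "f \<in> R"
    using Q R rel_interior_subset face_of_imp_subset by blast+
  obtain a where a: "a > 0" "f + a *\<^sub>R v \<in> Q" using v tangent_cone_eq[OF Q] by blast
  obtain b where b: "b > 0" "f + b *\<^sub>R w \<in> R" using w tangent_cone_eq[OF R Q(3)] by blast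
  have "f + min a b *\<^sub>R v \<in> Q" by (rule convex_shrink[OF Q(1) fQ a(2)]) (use a b in auto)
  moreover have "f + min a b *\<^sub>R w \<in> R" by (rule convex_shrink[OF R(1) fR b(2)]) (use a b in auto)
  ultimately show thesis using that[of "min a b"] a b by simp
qed

lemma tangent_cone_mono: "H \<subseteq> Q \<Longrightarrow> tangent_cone F H \<subseteq> tangent_cone F Q"
  unfolding tangent_cone_def by blast

lemma diff_in_tangent_cone: "f \<in> rel_interior F \<Longrightarrow> q \<in> Q \<Longrightarrow> q - f \<in> tangent_cone F Q"
  unfolding tangent_cone_def by (auto intro!: bexI[of _ f] exI[of _ 1])

lemma tangent_cone_scale:
  assumes "v \<in> tangent_cone F Q" "c > 0"
  shows "c *\<^sub>R v \<in> tangent_cone F Q"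
proof -
  obtain f e where f: "f \<in> rel_interior F" "e > 0" "f + e *\<^sub>R v \<in> Q"
    using assms(1) unfolding tangent_cone_def by blast
  have "f + (e / c) *\<^sub>R (c *\<^sub>R v) \<in> Q" using f assms(2) by simp
  then show ?thesis unfolding tangent_cone_def using f assms(2) by (blast intro: divide_pos_pos)
qed

lemma zero_in_tangent_cone:
  fixes Q :: "'a::euclidean_space set"
  assumes "F face_of Q" "F \<noteq> {}"
  shows "0 \<in> tangent_cone F Q"
proof -
  obtain f where f: "f \<in> rel_interior F" "f \<in> F" "f \<in> Q" by (rule face_nonempty_rel_interior[OF assms])
  then show ?thesis using diff_in_tangent_cone[of f F f Q] by simp
qed

lemma convex_tangent_cone:
  fixes Q :: "'a::euclidean_space set"
  assumes Q: "convex Q" "F face_of Q" and ne: "F \<noteq> {}"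
  shows "convex (tangent_cone F Q)"
proof (rule convexI)
  fix x y u v assume xy: "x \<in> tangent_cone F Q" "y \<in> tangent_cone F Q"
    and uv: "0 \<le> u" "0 \<le> v" "u + v = (1::real)"
  obtain f where f: "f \<in> rel_interior F" "f \<in> F" "f \<in> Q" by (rule face_nonempty_rel_interior[OF Q(2) ne])
  obtain e where e: "e > 0" "f + e *\<^sub>R x \<in> Q" "f + e *\<^sub>R y \<in> Q"
    using tangent_cone_common_scale[OF Q f(1) Q xy] by metis
  have "u *\<^sub>R (f + e *\<^sub>R x) + v *\<^sub>R (f + e *\<^sub>R y) \<in> Q"
    using uv by (intro convexD[OF Q(1)] e) auto
  also have "u *\<^sub>R (f + e *\<^sub>R x) + v *\<^sub>R (f + e *\<^sub>R y) = (u + v) *\<^sub>R f + e *\<^sub>R (u *\<^sub>R x + v *\<^sub>R y)"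
    by (simp add: algebra_simps)
  finally show "u *\<^sub>R x + v *\<^sub>R y \<in> tangent_cone F Q"
    using e(1) f(1) uv(3) unfolding tangent_cone_def by auto
qed

lemma polyhedron_tangent_cone:
  fixes Q :: "'a::euclidean_space set"
  assumes Q: "polyhedron Q" and F: "F face_of Q" "F \<noteq> {}"
  shows "polyhedron (tangent_cone F Q)"
proof -
  have cQ: "convex Q" by (rule polyhedron_imp_convex[OF Q])
  obtain f where f: "f \<in> rel_interior F" "f \<in> F" "f \<in> Q" by (rule face_nonempty_rel_interior[OF F])
  obtain I where I: "finite I" "0 \<notin> I" "\<And>a q. a \<in> I \<Longrightarrow> q \<in> Q \<Longrightarrow> a \<bullet> q \<le> a \<bullet> f"
    "\<And>v. (\<And>a. a \<in> I \<Longrightarrow> a \<bullet> v \<le> 0) \<Longrightarrow> \<exists>e>0. f + e *\<^sub>R v \<in> Q"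
    using polyhedron_active_constraints[OF Q f(3)] by metis
  have "tangent_cone F Q = \<Inter>((\<lambda>a. {v. a \<bullet> v \<le> 0}) ` I)"
  proof (intro equalityI subsetI)
    fix v assume "v \<in> tangent_cone F Q"
    then obtain e where e: "e > 0" "f + e *\<^sub>R v \<in> Q" using tangent_cone_eq[OF cQ F(1) f(1)] by blast
    have "a \<bullet> v \<le> 0" if "a \<in> I" for a
    proof -
      have "a \<bullet> (f + e *\<^sub>R v) \<le> a \<bullet> f" by (rule I(3)[OF that e(2)])
      then show ?thesis using e(1) by (simp add: inner_right_distrib mult_le_0_iff)
    qed
    then show "v \<in> \<Inter>((\<lambda>a. {v. a \<bullet> v \<le> 0}) ` I)" by blast
  next
    fix v assume "v \<in> \<Inter>((\<lambda>a. {v. a \<bullet> v \<le> 0}) ` I)"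
    then show "v \<in> tangent_cone F Q" using I(4)[of v] tangent_cone_eq[OF cQ F(1) f(1)] by blast
  qed
  then show ?thesis
    unfolding polyhedron_def using I(1,2)
    by (intro exI[of _ "(\<lambda>a. {v. a \<bullet> v \<le> 0}) ` I"]) (auto, metis)
qed

lemma tangent_cone_face_of:
  fixes Q :: "'a::euclidean_space set"
  assumes Q: "convex Q" and F: "F face_of Q" "F \<noteq> {}" and H: "H face_of Q" "F \<subseteq> H"
  shows "tangent_cone F H face_of tangent_cone F Q"
  unfolding face_of_def
proof (intro conjI ballI impI)
  have HQ: "H \<subseteq> Q" and cH: "convex H"
    using H(1) by (auto dest: face_of_imp_subset face_of_imp_convex)
  have FH: "F face_of H" by (rule face_of_subset[OF F(1) H(2) HQ])
  show "tangent_cone F H \<subseteq> tangent_cone F Q" by (rule tangent_cone_mono[OF HQ])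
  show "convex (tangent_cone F H)" by (rule convex_tangent_cone[OF cH FH F(2)])
  obtain f where f: "f \<in> rel_interior F" "f \<in> F" "f \<in> Q" by (rule face_nonempty_rel_interior[OF F])
  fix a b x assume a: "a \<in> tangent_cone F Q" and b: "b \<in> tangent_cone F Q"
    and x: "x \<in> tangent_cone F H" "x \<in> open_segment a b"
  obtain e1 where e1: "e1 > 0" "f + e1 *\<^sub>R a \<in> Q" "f + e1 *\<^sub>R b \<in> Q"
    using tangent_cone_common_scale[OF Q F(1) f(1) Q F(1) a b] by metis
  obtain e2 where e2: "e2 > 0" "f + e2 *\<^sub>R x \<in> H"
    using x(1) tangent_cone_eq[OF cH FH f(1)] by blast
  define e where "e = min e1 e2"
  have e: "e > 0" "e \<le> e1" "e \<le> e2" using e1 e2 by (auto simp: e_def)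
  have ea: "f + e *\<^sub>R a \<in> Q" "f + e *\<^sub>R b \<in> Q" "f + e *\<^sub>R x \<in> H"
    using convex_shrink[OF Q f(3) e1(2)] convex_shrink[OF Q f(3) e1(3)]
      convex_shrink[OF cH _ e2(2)] H(2) f(2) e by auto
  obtain u where u: "a \<noteq> b" "0 < u" "u < 1" "x = (1 - u) *\<^sub>R a + u *\<^sub>R b"
    using x(2) by (auto simp: in_segment)
  have "f + e *\<^sub>R x = (1 - u) *\<^sub>R (f + e *\<^sub>R a) + u *\<^sub>R (f + e *\<^sub>R b)"
    unfolding u(4) by (simp add: algebra_simps)
  then have "f + e *\<^sub>R x \<in> open_segment (f + e *\<^sub>R a) (f + e *\<^sub>R b)"
    using u e(1) by (auto simp: in_segment)
  then have "f + e *\<^sub>R a \<in> H \<and> f + e *\<^sub>R b \<in> H" using face_ofD[OF H(1) _ ea] by blast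
  then show "a \<in> tangent_cone F H" "b \<in> tangent_cone F H"
    using e(1) tangent_cone_eq[OF cH FH f(1)] by blast+
qed

text \<open>A face that contains \<open>F\<close> is determined by its tangent cone, so \<open>H \<mapsto> T\<^sub>F H\<close> is injective.\<close>

lemma face_from_tangent_cone:
  fixes Q :: "'a::euclidean_space set"
  assumes Q: "convex Q" and F: "F face_of Q" "F \<noteq> {}" and H: "H face_of Q" "F \<subseteq> H"
    and f: "f \<in> rel_interior F"
  shows "H = {q \<in> Q. q - f \<in> tangent_cone F H}"
proof (intro equalityI subsetI)
  have HQ: "H \<subseteq> Q" and cH: "convex H"
    using H(1) by (auto dest: face_of_imp_subset face_of_imp_convex)
  have FH: "F face_of H" by (rule face_of_subset[OF F(1) H(2) HQ])
  have fF: "f \<in> F" using f rel_interior_subset by blast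
  { fix q assume "q \<in> H"
    then show "q \<in> {q \<in> Q. q - f \<in> tangent_cone F H}" using HQ diff_in_tangent_cone[OF f] by blast }
  fix q assume "q \<in> {q \<in> Q. q - f \<in> tangent_cone F H}"
  then have q: "q \<in> Q" and "q - f \<in> tangent_cone F H" by auto
  then obtain e where e: "e > 0" "f + e *\<^sub>R (q - f) \<in> H"
    using tangent_cone_eq[OF cH FH f] by blast
  show "q \<in> H"
  proof (cases "q = f")
    case True then show ?thesis using fF H(2) by blast
  next
    case False
    define d where "d = min e (1/2)"
    have d: "0 < d" "d < 1" "d \<le> e" using e(1) by (auto simp: d_def)
    have "f + d *\<^sub>R (q - f) \<in> H"
      by (rule convex_shrink[OF cH _ e(2)]) (use fF H(2) d in auto)
    moreover have "f + d *\<^sub>R (q - f) \<in> open_segment f q"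
      using d False by (auto simp: in_segment algebra_simps intro!: exI[of _ d])
    ultimately show ?thesis using face_ofD[OF H(1)] fF F(1) q face_of_imp_subset by blast
  qed
qed

definition pos_homogeneous :: "'a::real_vector set \<Rightarrow> bool"
  where "pos_homogeneous C \<longleftrightarrow> (\<forall>x\<in>C. \<forall>c>0. c *\<^sub>R x \<in> C)"

text \<open>For a nonzero \<open>x\<close> in the face, the ray through \<open>x\<close> contains \<open>x\<close> between \<open>0\<close> and a large multiple
  of \<open>x\<close>, so both endpoints belong to the face.\<close>

lemma face_of_cone:
  fixes T :: "'a::euclidean_space set"
  assumes T: "0 \<in> T" "pos_homogeneous T" and K: "K face_of T" "K \<noteq> {}"
  shows "0 \<in> K" "pos_homogeneous K"
proof -
  have KT: "K \<subseteq> T" and cK: "convex K" using K(1) by (auto dest: face_of_imp_subset face_of_imp_convex)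
  have cone0: "0 \<in> K \<and> c *\<^sub>R x \<in> K" if x: "x \<in> K" and c: "c > 0" for x c
  proof (cases "x = 0")
    case True then show ?thesis using x by simp
  next
    case False
    \<comment> \<open>Larger than both \<open>1\<close> and \<open>c\<close>, so that \<open>x\<close> and \<open>c x\<close> lie between \<open>0\<close> and \<open>m x\<close>.\<close>
    define m where "m = 2 * (1 + c)"
    have m: "m > 1" "c < m" using c by (auto simp: m_def)
    have "m *\<^sub>R x \<in> T" using x KT m T(2) by (auto simp: pos_homogeneous_def)
    moreover have "x \<in> open_segment 0 (m *\<^sub>R x)"
      using False m by (auto simp: in_segment intro!: exI[of _ "1 / m"])
    ultimately have mK: "0 \<in> K" "m *\<^sub>R x \<in> K" using face_ofD[OF K(1)] T(1) x by blast+
    have "(1 - c / m) *\<^sub>R 0 + (c / m) *\<^sub>R (m *\<^sub>R x) \<in> K"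
      using m c mK by (intro convexD[OF cK]) auto
    then show ?thesis using mK(1) m by simp
  qed
  show "0 \<in> K" using cone0[of _ 1] K(2) by auto
  show "pos_homogeneous K" using cone0 by (simp add: pos_homogeneous_def)
qed

text \<open>The face of \<open>Q\<close> that belongs to a face \<open>K\<close> of the tangent cone consists of the points of \<open>Q\<close> that are
  seen from \<open>f\<close> in a direction of \<open>K\<close>.\<close>

lemma face_of_tangent_cone_exists:
  fixes Q :: "'a::euclidean_space set"
  assumes Q: "convex Q" and F: "F face_of Q" "F \<noteq> {}"
    and K: "K face_of tangent_cone F Q" "K \<noteq> {}"
  obtains H where "H face_of Q" "F \<subseteq> H" "K = tangent_cone F H"
proof -
  let ?T = "tangent_cone F Q"
  obtain f where f: "f \<in> rel_interior F" "f \<in> F" "f \<in> Q" by (rule face_nonempty_rel_interior[OF F])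
  have T0: "0 \<in> ?T" by (rule zero_in_tangent_cone[OF F])
  have KT: "K \<subseteq> ?T" and cK: "convex K" using K(1) by (auto dest: face_of_imp_subset face_of_imp_convex)
  have "pos_homogeneous ?T" by (simp add: pos_homogeneous_def tangent_cone_scale)
  note K0 = face_of_cone[OF T0 this K]
  have Ks: "c *\<^sub>R x \<in> K" if "x \<in> K" "c > 0" for x c
    using K0(2) that by (simp add: pos_homogeneous_def)
  define H where "H = {q \<in> Q. q - f \<in> K}"
  have fH: "f \<in> H" using K0(1) f(3) by (simp add: H_def)
  have HQ: "H face_of Q"
    unfolding face_of_def
  proof (intro conjI ballI impI)
    show "H \<subseteq> Q" by (auto simp: H_def)
    show "convex H"
    proof (rule convexI)
      fix x y u v assume "x \<in> H" "y \<in> H" and uv: "0 \<le> u" "0 \<le> v" "u + v = (1::real)"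
      then have xy: "x \<in> Q" "y \<in> Q" "x - f \<in> K" "y - f \<in> K" by (auto simp: H_def)
      have "u *\<^sub>R (x - f) + v *\<^sub>R (y - f) \<in> K" using uv xy by (intro convexD[OF cK]) auto
      also have "u *\<^sub>R (x - f) + v *\<^sub>R (y - f) = (u *\<^sub>R x + v *\<^sub>R y) - (u + v) *\<^sub>R f"
        by (simp add: algebra_simps)
      finally show "u *\<^sub>R x + v *\<^sub>R y \<in> H" using uv xy by (auto simp: H_def intro: convexD[OF Q])
    qed
    fix a b x assume ab: "a \<in> Q" "b \<in> Q" and x: "x \<in> H" "x \<in> open_segment a b"
    obtain u where u: "a \<noteq> b" "0 < u" "u < 1" "x = (1 - u) *\<^sub>R a + u *\<^sub>R b"
      using x(2) by (auto simp: in_segment)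
    have "x - f = (1 - u) *\<^sub>R (a - f) + u *\<^sub>R (b - f)" unfolding u(4) by (simp add: algebra_simps)
    then have "x - f \<in> open_segment (a - f) (b - f)" using u by (auto simp: in_segment)
    moreover have "a - f \<in> ?T" "b - f \<in> ?T" using diff_in_tangent_cone[OF f(1)] ab by blast+
    moreover have "x - f \<in> K" using x(1) by (simp add: H_def)
    ultimately have "a - f \<in> K \<and> b - f \<in> K" using face_ofD[OF K(1)] by blast
    then show "a \<in> H" "b \<in> H" using ab by (auto simp: H_def)
  qed
  have "F \<subseteq> H"
    by (rule subset_of_face_of[OF HQ face_of_imp_subset[OF F(1)]]) (use f fH in blast)
  moreover have "K = tangent_cone F H"
  proof (intro equalityI subsetI)
    have FH: "F face_of H" by (rule face_of_subset[OF F(1) \<open>F \<subseteq> H\<close> face_of_imp_subset[OF HQ]])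
    note tH = tangent_cone_eq[OF face_of_imp_convex[OF HQ] FH f(1)]
    { fix v assume v: "v \<in> K"
      then obtain e where e: "e > 0" "f + e *\<^sub>R v \<in> Q" using KT tangent_cone_eq[OF Q F(1) f(1)] by blast
      then have "f + e *\<^sub>R v \<in> H" using Ks[OF v e(1)] by (simp add: H_def)
      then show "v \<in> tangent_cone F H" using e(1) tH by blast }
    fix v assume "v \<in> tangent_cone F H"
    then obtain e where e: "e > 0" "f + e *\<^sub>R v \<in> H" using tH by blast
    then have "e *\<^sub>R v \<in> K" by (simp add: H_def)
    then have "(1 / e) *\<^sub>R (e *\<^sub>R v) \<in> K" using Ks[of "e *\<^sub>R v" "1 / e"] e(1) by simp
    then show "v \<in> K" using e(1) by simp
  qed
  ultimately show thesis using that HQ by blast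
qed

lemma direction_space_tangent_cone:
  fixes Q :: "'a::euclidean_space set"
  assumes Q: "convex Q" and F: "F face_of Q" "F \<noteq> {}"
  shows "direction_space (tangent_cone F Q) = direction_space Q"
proof
  obtain f where f: "f \<in> rel_interior F" "f \<in> F" "f \<in> Q" by (rule face_nonempty_rel_interior[OF F])
  have "v \<in> direction_space Q" if "v \<in> tangent_cone F Q" for v
  proof -
    from that obtain e where e: "e > 0" "f + e *\<^sub>R v \<in> Q" using tangent_cone_eq[OF Q F(1) f(1)] by blast
    have "(f + e *\<^sub>R v) - f \<in> direction_space Q" by (rule diff_in_direction_space[OF e(2) f(3)])
    then have d: "e *\<^sub>R v \<in> direction_space Q" by simp
    show ?thesis using subspace_scale[OF subspace_direction_space d, of "inverse e"] e(1) by simp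
  qed
  then have "span ((\<lambda>x. x - 0) ` tangent_cone F Q) \<subseteq> direction_space Q"
    by (intro span_minimal) auto
  then show "direction_space (tangent_cone F Q) \<subseteq> direction_space Q"
    by (simp add: direction_space_eq[OF zero_in_tangent_cone[OF F]])
  have "(\<lambda>x. x - f) ` Q \<subseteq> (\<lambda>x. x - 0) ` tangent_cone F Q"
    using diff_in_tangent_cone[OF f(1)] by auto
  then show "direction_space Q \<subseteq> direction_space (tangent_cone F Q)"
    unfolding direction_space_eq[OF zero_in_tangent_cone[OF F]] direction_space_eq[OF f(3)]
    by (rule span_mono)
qed

lemma span_tangent_cone:
  fixes Q :: "'a::euclidean_space set"
  assumes Q: "convex Q" and F: "F face_of Q" "F \<noteq> {}"
  shows "span (tangent_cone F Q) = direction_space Q"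
  using direction_space_tangent_cone[OF assms] direction_space_eq[OF zero_in_tangent_cone[OF F]] by simp

text \<open>Both normal cones are given by the same inequalities, up to translation by \<open>f\<close> and
  rescaling.\<close>

lemma normal_cone_tangent_cone:
  fixes Q :: "'a::euclidean_space set"
  assumes Q: "convex Q" and F: "F face_of Q" "F \<noteq> {}" and H: "H face_of Q" "F \<subseteq> H"
  shows "normal_cone (tangent_cone F H) (tangent_cone F Q) = normal_cone H Q"
proof (intro set_eqI iffI)
  have HQ: "H \<subseteq> Q" and cH: "convex H"
    using H(1) by (auto dest: face_of_imp_subset face_of_imp_convex)
  have FH: "F face_of H" by (rule face_of_subset[OF F(1) H(2) HQ])
  have Hne: "H \<noteq> {}" using H(2) F(2) by blast
  have Tne: "tangent_cone F H \<noteq> {}" using zero_in_tangent_cone[OF FH F(2)] by blast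
  note n1 = normal_cone_iff[OF Q H(1) Hne]
  note n2 = normal_cone_iff[OF convex_tangent_cone[OF Q F] tangent_cone_face_of[OF Q F H] Tne]
  obtain f where f: "f \<in> rel_interior F" "f \<in> F" "f \<in> Q" by (rule face_nonempty_rel_interior[OF F])
  fix w
  { assume w: "w \<in> normal_cone (tangent_cone F H) (tangent_cone F Q)"
    show "w \<in> normal_cone H Q"
      unfolding n1
    proof (intro ballI)
      fix q h assume "q \<in> Q" "h \<in> H"
      then have "w \<bullet> (q - f) \<le> w \<bullet> (h - f)"
        using w diff_in_tangent_cone[OF f(1)] unfolding n2 by blast
      then show "w \<bullet> q \<le> w \<bullet> h" by (simp add: inner_diff_right)
    qed }
  assume w: "w \<in> normal_cone H Q"
  show "w \<in> normal_cone (tangent_cone F H) (tangent_cone F Q)"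
    unfolding n2
  proof (intro ballI)
    fix t s assume "t \<in> tangent_cone F Q" "s \<in> tangent_cone F H"
    then obtain e where e: "e > 0" "f + e *\<^sub>R t \<in> Q" "f + e *\<^sub>R s \<in> H"
      using tangent_cone_common_scale[OF Q F(1) f(1) cH FH] by metis
    then have "w \<bullet> (f + e *\<^sub>R t) \<le> w \<bullet> (f + e *\<^sub>R s)" using w unfolding n1 by blast
    then show "w \<bullet> t \<le> w \<bullet> s" using e(1) by (simp add: inner_right_distrib)
  qed
qed

lemma bij_betw_faces_tangent_cone:
  fixes Q :: "'a::euclidean_space set"
  assumes Q: "convex Q" and F: "F face_of Q" "F \<noteq> {}"
  shows "bij_betw (tangent_cone F) {H \<in> faces_of_dim k Q. F \<subseteq> H} (faces_of_dim k (tangent_cone F Q))"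
proof (rule bij_betwI')
  obtain f where f: "f \<in> rel_interior F" "f \<in> F" "f \<in> Q" by (rule face_nonempty_rel_interior[OF F])
  have ad: "aff_dim (tangent_cone F H) = aff_dim H" if H: "H face_of Q" "F \<subseteq> H" for H
  proof -
    have FH: "F face_of H" by (rule face_of_subset[OF F(1) H(2) face_of_imp_subset[OF H(1)]])
    have "tangent_cone F H \<noteq> {}" "H \<noteq> {}" using zero_in_tangent_cone[OF FH F(2)] H(2) F(2) by auto
    then show ?thesis
      using direction_space_tangent_cone[OF face_of_imp_convex[OF H(1)] FH F(2)]
      by (simp add: aff_dim_direction_space)
  qed
  show "(tangent_cone F H = tangent_cone F H') = (H = H')"
    if "H \<in> {H \<in> faces_of_dim k Q. F \<subseteq> H}" "H' \<in> {H \<in> faces_of_dim k Q. F \<subseteq> H}" for H H'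
    using that face_from_tangent_cone[OF Q F _ _ f(1)] unfolding faces_of_dim_def by blast
  show "tangent_cone F H \<in> faces_of_dim k (tangent_cone F Q)"
    if "H \<in> {H \<in> faces_of_dim k Q. F \<subseteq> H}" for H
    using that ad tangent_cone_face_of[OF Q F] by (auto simp: faces_of_dim_def)
  show "\<exists>H\<in>{H \<in> faces_of_dim k Q. F \<subseteq> H}. K = tangent_cone F H"
    if K: "K \<in> faces_of_dim k (tangent_cone F Q)" for K
  proof -
    have "K face_of tangent_cone F Q" "K \<noteq> {}" using K by (auto simp: faces_of_dim_def)
    then obtain H where "H face_of Q" "F \<subseteq> H" "K = tangent_cone F H"
      using face_of_tangent_cone_exists[OF Q F] by metis
    then show ?thesis using K ad by (auto simp: faces_of_dim_def)
  qed
qed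

lemma sum_conic_intrinsic_volume_tangent_cones:
  fixes Q :: "'a::euclidean_space set"
  assumes Q: "convex Q"
  shows "(\<Sum>F\<in>faces_of_dim j Q. conic_intrinsic_volume k (tangent_cone F Q)) =
    (\<Sum>F\<in>faces_of_dim j Q. \<Sum>H\<in>{H \<in> faces_of_dim k Q. F \<subseteq> H}.
        solid_angle (tangent_cone F H) * solid_angle (normal_cone H Q))"
proof (rule sum.cong[OF refl])
  fix F assume "F \<in> faces_of_dim j Q"
  then have F: "F face_of Q" "F \<noteq> {}" by (auto simp: faces_of_dim_def)
  have "conic_intrinsic_volume k (tangent_cone F Q) = (\<Sum>H\<in>{H \<in> faces_of_dim k Q. F \<subseteq> H}.
        solid_angle (tangent_cone F H) * solid_angle (normal_cone (tangent_cone F H) (tangent_cone F Q)))"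
    unfolding conic_intrinsic_volume_def
    by (rule sum.reindex_bij_betw[OF bij_betw_faces_tangent_cone[OF Q F], symmetric])
  also have "\<dots> = (\<Sum>H\<in>{H \<in> faces_of_dim k Q. F \<subseteq> H}.
        solid_angle (tangent_cone F H) * solid_angle (normal_cone H Q))"
    by (intro sum.cong refl) (auto simp: faces_of_dim_def normal_cone_tangent_cone[OF Q F])
  finally show "conic_intrinsic_volume k (tangent_cone F Q) = \<dots>" .
qed

section \<open>Solid angles and rotation invariant laws\<close>

definition orth_proj :: "'a::euclidean_space set \<Rightarrow> 'a \<Rightarrow> 'a"
  where "orth_proj L x = (THE y. y \<in> L \<and> x - y \<in> L\<^sup>\<bottom>)"

lemma orthogonal_comp_inner: "x \<in> L \<Longrightarrow> y \<in> L\<^sup>\<bottom> \<Longrightarrow> x \<bullet> y = 0"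
  by (simp add: orthogonal_comp_iff)

lemma orth_proj_unique:
  assumes L: "subspace L" and y: "y \<in> L" "x - y \<in> L\<^sup>\<bottom>"
  shows "orth_proj L x = y"
  unfolding orth_proj_def
proof (rule the_equality)
  fix z assume z: "z \<in> L \<and> x - z \<in> L\<^sup>\<bottom>"
  have "(x - y) - (x - z) \<in> L\<^sup>\<bottom>"
    using subspace_diff[OF subspace_orthogonal_comp y(2) conjunct2[OF z]] .
  then have "z - y \<in> L\<^sup>\<bottom>" by simp
  moreover have "z - y \<in> L" using y z L by (intro subspace_diff) auto
  ultimately have "(z - y) \<bullet> (z - y) = 0" by (rule orthogonal_comp_inner[rotated])
  then show "z = y" by simp
qed (use y in blast)

lemma orth_proj:
  assumes L: "subspace L"
  shows "orth_proj L x \<in> L" "x - orth_proj L x \<in> L\<^sup>\<bottom>"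
proof -
  have "x \<in> L + L\<^sup>\<bottom>" using subspace_sum_orthogonal_comp[OF L] by simp
  then obtain y z where "y \<in> L" "z \<in> L\<^sup>\<bottom>" "x = y + z" by (auto simp: set_plus_def)
  then have "y \<in> L" "x - y \<in> L\<^sup>\<bottom>" by auto
  then show "orth_proj L x \<in> L" "x - orth_proj L x \<in> L\<^sup>\<bottom>"
    using orth_proj_unique[OF L] by auto
qed

lemma linear_orth_proj:
  assumes L: "subspace L"
  shows "linear (orth_proj L)"
proof (rule linearI)
  note p = orth_proj[OF L]
  fix x y :: 'a and c :: real
  have "(x - orth_proj L x) + (y - orth_proj L y) \<in> L\<^sup>\<bottom>"
    using p by (intro subspace_add subspace_orthogonal_comp)
  then show "orth_proj L (x + y) = orth_proj L x + orth_proj L y"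
    using p by (intro orth_proj_unique[OF L] subspace_add[OF L]) (auto simp: algebra_simps)
  have "c *\<^sub>R (x - orth_proj L x) \<in> L\<^sup>\<bottom>"
    using p by (intro subspace_scale subspace_orthogonal_comp)
  then show "orth_proj L (c *\<^sub>R x) = c *\<^sub>R orth_proj L x"
    using p by (intro orth_proj_unique[OF L] subspace_scale[OF L]) (auto simp: algebra_simps)
qed

lemma orth_proj_add:
  assumes "subspace L" "y \<in> L" "z \<in> L\<^sup>\<bottom>"
  shows "orth_proj L (y + z) = y"
  using assms by (intro orth_proj_unique) auto

lemma orth_proj_comp:
  assumes L: "subspace L"
  shows "orth_proj (L\<^sup>\<bottom>) x = x - orth_proj L x"
  using orth_proj[OF L]
  by (intro orth_proj_unique subspace_orthogonal_comp) (auto simp: orthogonal_comp_self[OF L])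

lemma orth_proj_eq_0_iff:
  assumes L: "subspace L"
  shows "orth_proj L x = 0 \<longleftrightarrow> x \<in> L\<^sup>\<bottom>"
  using orth_proj[OF L, of x] orth_proj_unique[OF L, of 0 x] subspace_0[OF L] by auto

lemma continuous_on_linear:
  fixes f :: "'a::euclidean_space \<Rightarrow> 'b::real_normed_vector"
  shows "linear f \<Longrightarrow> continuous_on S f"
  by (simp add: linear_continuous_on linear_conv_bounded_linear)

lemma borel_measurable_linear:
  fixes f :: "'a::euclidean_space \<Rightarrow> 'b::real_normed_vector"
  shows "linear f \<Longrightarrow> f \<in> borel_measurable borel"
  by (intro borel_measurable_continuous_onI continuous_on_linear)

text \<open>The proportion of the directions in \<open>L\<close> that belong to \<open>C\<close>. The subspace \<open>L\<close> is an argument of its own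
  because the sets \<open>C\<close> will also be relatively open cones. For \<open>L = {0}\<close> there is no sphere, and the value is chosen
  to match the convention that a linear subspace has solid angle one.\<close>

definition cone_angle :: "'a::euclidean_space set \<Rightarrow> 'a set \<Rightarrow> real"
  where "cone_angle L C = (if L = {0} then indicator C 0 else measure (sphere_uniform L) C)"

lemma pos_homogeneous_iff:
  assumes "pos_homogeneous C" "c > 0"
  shows "c *\<^sub>R x \<in> C \<longleftrightarrow> x \<in> C"
proof
  assume "c *\<^sub>R x \<in> C"
  then have "inverse c *\<^sub>R (c *\<^sub>R x) \<in> C"
    using assms unfolding pos_homogeneous_def by (meson positive_imp_inverse_positive)
  then show "x \<in> C" using assms(2) by simp
qed (use assms in \<open>auto simp: pos_homogeneous_def\<close>)

lemma solid_angle_eq_cone_angle: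
  assumes C: "0 \<in> C"
  shows "solid_angle C = cone_angle (span C) C"
proof (cases "subspace C")
  case True
  then have sp: "span C = C" by simp
  show ?thesis
  proof (cases "C = {0}")
    case False
    then have u: "is_sphere_uniform C (sphere_uniform C)"
      by (rule is_sphere_uniform_sphere_uniform[OF True])
    interpret prob_space "sphere_uniform C" using u by (simp add: is_sphere_uniform_def)
    have "C \<in> sets (sphere_uniform C)"
      using u closed_subspace[OF True] by (simp add: is_sphere_uniform_def)
    then have "measure (sphere_uniform C) (sphere 0 1 \<inter> C) \<le> measure (sphere_uniform C) C"
      by (intro finite_measure_mono) auto
    then have "measure (sphere_uniform C) C = 1"
      using u prob_le_1[of C] unfolding is_sphere_uniform_def by linarith
    then show ?thesis using True False by (simp add: solid_angle_def cone_angle_def sp)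
  qed (simp add: solid_angle_def cone_angle_def)
next
  case False
  have "span C \<noteq> {0}"
  proof
    assume "span C = {0}"
    then have "C \<subseteq> {0}" using span_superset by metis
    then have "C = {0}" using C by blast
    then show False using False by simp
  qed
  then show ?thesis using False by (simp add: solid_angle_def cone_angle_def)
qed

text \<open>Condition on the event \<open>B\<close>, which depends on the component in \<open>L\<^sup>\<bottom>\<close> only. The direction of the
  component in \<open>L\<close> is then still invariant under the rotations of \<open>L\<close>: a rotation of \<open>L\<close>, extended by the
  identity on \<open>L\<^sup>\<bottom>\<close>, preserves both the law and the event. By the uniqueness of the uniform distribution on
  the sphere, the direction is uniform.\<close>

lemma measure_proj_in_cone:
  fixes \<nu> :: "'a::euclidean_space measure"
  assumes "prob_space \<nu>" and sets [simp, measurable_cong]: "sets \<nu> = sets borel" and L: "subspace L"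
    and inv: "\<And>f. orthogonal_transformation f \<Longrightarrow> f ` L = L \<Longrightarrow> (\<And>x. x \<in> L\<^sup>\<bottom> \<Longrightarrow> f x = x) \<Longrightarrow> distr \<nu> borel f = \<nu>"
    and nz: "L \<noteq> {0} \<Longrightarrow> AE x in \<nu>. orth_proj L x \<noteq> 0"
    and C: "C \<in> sets borel" "pos_homogeneous C"
    and B: "B \<in> sets borel" "\<And>x. x - orth_proj L x \<in> B \<longleftrightarrow> x \<in> B"
  shows "measure \<nu> {x \<in> B. orth_proj L x \<in> C} = cone_angle L C * measure \<nu> B"
proof -
  interpret prob_space \<nu> by fact
  have spc: "space \<nu> = UNIV" using sets_eq_imp_space_eq[OF sets] by simp
  define p where "p = orth_proj L"
  have plin: "linear p" and p: "\<And>x. p x \<in> L" "\<And>x. x - p x \<in> L\<^sup>\<bottom>"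
    unfolding p_def using L by (auto intro: linear_orth_proj orth_proj)
  have [measurable]: "p \<in> borel_measurable borel" by (rule borel_measurable_linear[OF plin])
  have [measurable]: "B \<in> sets borel" "C \<in> sets borel" by fact+
  have BC [measurable]: "{x \<in> B. p x \<in> C} \<in> sets borel"
  proof -
    have "{x \<in> B. p x \<in> C} = B \<inter> (p -` C \<inter> space borel)" by auto
    then show ?thesis by simp
  qed
  show ?thesis
  proof (cases "L = {0} \<or> measure \<nu> B = 0")
    case True
    then show ?thesis
    proof
      assume "L = {0}"
      then have "\<And>x. p x = 0" using p(1) by blast
      then have "{x \<in> B. orth_proj L x \<in> C} = (if 0 \<in> C then B else {})" by (auto simp: p_def)
      then show ?thesis by (simp add: cone_angle_def \<open>L = {0}\<close>)
    next
      assume 0: "measure \<nu> B = 0"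
      have "measure \<nu> {x \<in> B. p x \<in> C} \<le> measure \<nu> B" by (rule finite_measure_mono) auto
      then show ?thesis using 0 by (simp add: p_def measure_le_0_iff)
    qed
  next
    case False
    then have Lne: "L \<noteq> {0}" and pos: "measure \<nu> B \<noteq> 0" by auto
    define r where "r x = p x /\<^sub>R norm (p x)" for x
    have [measurable]: "r \<in> borel_measurable borel" unfolding r_def by measurable
    define V where "V = uniform_measure \<nu> B"
    have eB: "emeasure \<nu> B \<noteq> 0" using pos by (auto simp: measure_def)
    interpret V: prob_space V
      unfolding V_def by (rule prob_space_uniform_measure) (use eB in auto)
    have setsV [simp, measurable_cong]: "sets V = sets borel" by (simp add: V_def)
    define \<mu> where "\<mu> = distr V borel r"
    interpret mu: prob_space \<mu> unfolding \<mu>_def by (rule V.prob_space_distr) simp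
    have AEV: "AE x in V. p x \<noteq> 0"
      unfolding V_def
      by (rule AE_uniform_measureI) (use nz[OF Lne] in \<open>auto simp: p_def\<close>)
    have mS: "sphere 0 1 \<inter> L \<in> sets borel" using closed_subspace[OF L] by (simp add: closed_Int)
    have mS': "{x \<in> space borel. x \<in> sphere 0 1 \<inter> L} \<in> sets borel"
      by (simp only: space_borel UNIV_I simp_thms Collect_mem_eq mS)
    from AEV have "AE x in V. r x \<in> sphere 0 1 \<inter> L"
      by (rule eventually_mono) (use p L in \<open>auto simp: r_def subspace_scale\<close>)
    then have "AE x in \<mu>. x \<in> sphere 0 1 \<inter> L"
      unfolding \<mu>_def by (subst AE_distr_iff[OF _ mS']) simp_all
    then have one: "measure \<mu> (sphere 0 1 \<inter> L) = 1"
      using mS mu.prob_eq_1[of "sphere 0 1 \<inter> L"] by (simp add: \<mu>_def)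
    have rot: "distr \<mu> borel f = \<mu>" if f: "orthogonal_transformation f" and fL: "f ` L = L" for f
    proof -
      have lin: "linear f" using f by (simp add: orthogonal_transformation_linear)
      have [measurable]: "f \<in> borel_measurable borel" by (rule borel_measurable_linear[OF lin])
      have nf: "norm (f x) = norm x" for x using f orthogonal_transformation by blast
      have fin: "f x \<bullet> f y = x \<bullet> y" for x y using f by (simp add: orthogonal_transformation_def)
      have fLin: "f x \<in> L" if "x \<in> L" for x using that fL by blast
      \<comment> \<open>The rotation \<open>f\<close> of \<open>L\<close>, extended by the identity on \<open>L\<^sup>\<bottom>\<close>.\<close>
      define g where "g x = f (p x) + (x - p x)" for x
      have ging: "g x \<bullet> g y = x \<bullet> y" for x y
      proof -
        have z: "f (p u) \<bullet> (v - p v) = 0" "(v - p v) \<bullet> f (p u) = 0"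
             "p u \<bullet> (v - p v) = 0" "(v - p v) \<bullet> p u = 0" for u v
          using orthogonal_comp_inner fLin p by (metis inner_commute)+
        have "g x \<bullet> g y = p x \<bullet> p y + (x - p x) \<bullet> (y - p y)"
          unfolding g_def by (simp only: inner_add_left inner_add_right z fin)
        also have "\<dots> = (p x + (x - p x)) \<bullet> (p y + (y - p y))"
          by (simp only: inner_add_left inner_add_right z)
        finally show ?thesis by simp
      qed
      have glin: "linear g"
        unfolding g_def
        by (intro linear_compose_add linear_compose_sub plin linear_ident linear_compose[OF plin lin, unfolded o_def])
      have gorth: "orthogonal_transformation g"
        by (simp add: orthogonal_transformation_def glin ging)
      have pL: "p x = x" if "x \<in> L" for x
        using that L unfolding p_def by (intro orth_proj_unique) (auto simp: subspace_0 subspace_orthogonal_comp)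
      have pLc: "p x = 0" if "x \<in> L\<^sup>\<bottom>" for x
        using that L unfolding p_def by (simp add: orth_proj_eq_0_iff)
      have "g ` L = f ` L" by (rule image_cong) (auto simp: g_def pL)
      then have gL: "g ` L = L" using fL by simp
      have gid: "g x = x" if "x \<in> L\<^sup>\<bottom>" for x using that by (simp add: g_def pLc linear_0[OF lin])
      have pg: "p (g x) = f (p x)" for x
        unfolding p_def g_def by (intro orth_proj_add L) (use p fLin in \<open>auto simp: p_def\<close>)
      have rg: "r (g x) = f (r x)" for x
        by (simp add: r_def pg nf linear_scale[OF lin])
      have [measurable]: "g \<in> borel_measurable borel" by (rule borel_measurable_linear[OF glin])
      have nug: "distr \<nu> borel g = \<nu>" by (rule inv[OF gorth gL gid])
      have Bg: "g x \<in> B \<longleftrightarrow> x \<in> B" for x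
      proof -
        have "g x - p (g x) = x - p x" by (simp add: pg) (simp add: g_def)
        then show ?thesis using B(2)[of x] B(2)[of "g x"] by (simp add: p_def)
      qed
      have Vg: "distr V borel g = V"
      proof (rule measure_eqI)
        fix E assume "E \<in> sets (distr V borel g)"
        then have E [measurable]: "E \<in> sets borel" by simp
        have "B \<inter> g -` E = g -` (B \<inter> E)" using Bg by auto
        then have "emeasure \<nu> (B \<inter> g -` E) = emeasure (distr \<nu> borel g) (B \<inter> E)"
          by (subst emeasure_distr) (auto simp: spc)
        then have eq: "emeasure \<nu> (B \<inter> g -` E) = emeasure \<nu> (B \<inter> E)" by (simp only: nug)
        have "g -` E \<in> sets borel" using measurable_sets[of g borel borel E] by simp
        then show "emeasure (distr V borel g) E = emeasure V E"
          by (subst emeasure_distr) (auto simp: V_def spc eq)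
      qed simp
      have "distr \<mu> borel f = distr V borel (\<lambda>x. f (r x))"
        unfolding \<mu>_def by (subst distr_distr) (auto simp: o_def)
      also have "\<dots> = distr V borel (\<lambda>x. r (g x))" by (simp add: rg)
      also have "\<dots> = distr (distr V borel g) borel r"
        by (subst distr_distr) (auto simp: o_def)
      also have "\<dots> = \<mu>" by (simp add: Vg \<mu>_def)
      finally show ?thesis .
    qed
    have "is_sphere_uniform L \<mu>"
      using one rot mu.prob_space_axioms by (auto simp: is_sphere_uniform_def \<mu>_def)
    then have su: "sphere_uniform L = \<mu>"
      using is_sphere_uniform_unique[OF is_sphere_uniform_sphere_uniform[OF L Lne] _ L] by blast
    have "cone_angle L C = measure V (r -` C)"
      using Lne by (simp add: cone_angle_def su \<mu>_def measure_distr V_def spc)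
    also have "\<dots> = measure V {x. p x \<in> C}"
    proof (rule V.finite_measure_eq_AE)
      show "AE x in V. (x \<in> r -` C) = (x \<in> {x. p x \<in> C})"
        using AEV by (rule eventually_mono) (simp add: r_def pos_homogeneous_iff[OF C(2)])
      show "r -` C \<in> sets V" using measurable_sets[of r borel borel C] by simp
      show "{x. p x \<in> C} \<in> sets V" using measurable_sets[of p borel borel C] by (simp add: vimage_def)
    qed
    also have "\<dots> = measure \<nu> (B \<inter> {x. p x \<in> C}) / measure \<nu> B"
    proof -
      have "{x. p x \<in> C} \<in> sets \<nu>" using measurable_sets[of p borel borel C] by (simp add: vimage_def)
      then show ?thesis unfolding V_def by (intro measure_uniform_measure) (use eB in auto)
    qed
    also have "B \<inter> {x. p x \<in> C} = {x \<in> B. p x \<in> C}" by auto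
    finally show ?thesis using pos by (simp add: p_def)
  qed
qed

text \<open>The directions of the two components are independent and uniform. This is the previous lemma for
  the event that the component in \<open>L\<^sup>\<bottom>\<close> lies in \<open>D\<close>, combined with the same lemma for \<open>L\<^sup>\<bottom>\<close>.\<close>

theorem measure_proj_in_cones:
  fixes \<nu> :: "'a::euclidean_space measure"
  assumes \<nu>: "prob_space \<nu>" "sets \<nu> = sets borel" and L: "subspace L"
    and inv: "\<And>f. orthogonal_transformation f \<Longrightarrow> f ` L = L \<Longrightarrow> distr \<nu> borel f = \<nu>"
    and nz: "L \<noteq> {0} \<Longrightarrow> AE x in \<nu>. x \<notin> L\<^sup>\<bottom>" "L\<^sup>\<bottom> \<noteq> {0} \<Longrightarrow> AE x in \<nu>. x \<notin> L"
    and C: "C \<in> sets borel" "pos_homogeneous C"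
    and D: "D \<in> sets borel" "pos_homogeneous D"
  shows "measure \<nu> {x. orth_proj L x \<in> C \<and> x - orth_proj L x \<in> D} = cone_angle L C * cone_angle (L\<^sup>\<bottom>) D"
proof -
  have Lc: "subspace (L\<^sup>\<bottom>)" by (rule subspace_orthogonal_comp)
  have [measurable]: "orth_proj L \<in> borel_measurable borel"
    by (rule borel_measurable_linear[OF linear_orth_proj[OF L]])
  have "(\<lambda>x. x - orth_proj L x) -` D \<inter> space borel \<in> sets borel"
    using D(1) by (intro measurable_sets[where A = borel]) auto
  then have B: "{x. x - orth_proj L x \<in> D} \<in> sets borel" by (simp add: vimage_def)
  have pp: "orth_proj L (x - orth_proj L x) = 0" for x
    using orth_proj[OF L, of x] by (simp add: orth_proj_eq_0_iff[OF L])
  have "measure \<nu> {x \<in> {x. x - orth_proj L x \<in> D}. orth_proj L x \<in> C}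
      = cone_angle L C * measure \<nu> {x. x - orth_proj L x \<in> D}"
    by (rule measure_proj_in_cone[OF \<nu> L inv _ C B])
       (use nz(1) in \<open>auto simp: pp orth_proj_eq_0_iff[OF L]\<close>)
  moreover have "measure \<nu> {x \<in> UNIV. orth_proj (L\<^sup>\<bottom>) x \<in> D} = cone_angle (L\<^sup>\<bottom>) D * measure \<nu> UNIV"
  proof (rule measure_proj_in_cone[OF \<nu> Lc _ _ D])
    fix f assume f: "orthogonal_transformation f" "f ` (L\<^sup>\<bottom>) = L\<^sup>\<bottom>" "\<And>x. x \<in> L\<^sup>\<bottom>\<^sup>\<bottom> \<Longrightarrow> f x = x"
    then have "f ` L = L" by (auto simp: orthogonal_comp_self[OF L] image_iff)
    then show "distr \<nu> borel f = \<nu>" by (rule inv[OF f(1)])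
  next
    assume "L\<^sup>\<bottom> \<noteq> {0}"
    then show "AE x in \<nu>. orth_proj (L\<^sup>\<bottom>) x \<noteq> 0"
      using nz(2) by (simp add: orth_proj_eq_0_iff[OF Lc] orthogonal_comp_self[OF L])
  qed auto
  moreover have "measure \<nu> UNIV = 1"
    using prob_space.prob_space[OF \<nu>(1)] sets_eq_imp_space_eq[OF \<nu>(2)] by simp
  ultimately show ?thesis by (simp add: orth_proj_comp[OF L] conj_commute)
qed

text \<open>A concrete rotation invariant law that gives no mass to proper subspaces. Only directions
  matter.\<close>

definition ball_uniform :: "'a::euclidean_space measure"
  where "ball_uniform = uniform_measure lborel (ball 0 1)"

lemma emeasure_lborel_unit_ball:
  "emeasure lborel (ball (0::'a::euclidean_space) 1) \<noteq> 0" "emeasure lborel (ball (0::'a) 1) \<noteq> \<infinity>"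
  using emeasure_lborel_open_nonzero[of "ball (0::'a) 1"] emeasure_lborel_ball_finite[of "0::'a" 1] by auto

lemma prob_space_ball_uniform: "prob_space ball_uniform"
  unfolding ball_uniform_def by (intro prob_space_uniform_measure emeasure_lborel_unit_ball)

lemma sets_ball_uniform [simp, measurable_cong]: "sets ball_uniform = sets borel"
  and space_ball_uniform [simp]: "space ball_uniform = UNIV"
  by (auto simp: ball_uniform_def)

lemma distr_ball_uniform:
  fixes f :: "'a::euclidean_space \<Rightarrow> 'a"
  assumes f: "orthogonal_transformation f"
  shows "distr ball_uniform borel f = (ball_uniform :: 'a measure)"
proof (rule measure_eqI)
  have [measurable]: "f \<in> borel_measurable borel"
    by (rule borel_measurable_linear) (simp add: f orthogonal_transformation_linear)
  have nf: "norm (f x) = norm x" for x using f orthogonal_transformation by blast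
  fix E assume "E \<in> sets (distr ball_uniform borel f)"
  then have [measurable]: "E \<in> sets borel" by simp
  have "ball 0 1 \<inter> f -` E = f -` (ball 0 1 \<inter> E)" by (auto simp: nf)
  then have "emeasure lborel (ball 0 1 \<inter> f -` E) = emeasure (distr lborel borel f) (ball 0 1 \<inter> E)"
    by (subst emeasure_distr) auto
  then have eq: "emeasure lborel (ball 0 1 \<inter> f -` E) = emeasure lborel (ball 0 1 \<inter> E)"
    by (simp only: lborel_orthogonal_transformation[OF f])
  have "f -` E \<in> sets borel" using measurable_sets[of f borel borel E] by simp
  then show "emeasure (distr ball_uniform borel f) E = emeasure ball_uniform E"
    by (subst emeasure_distr) (auto simp: ball_uniform_def eq)
qed simp

lemma AE_ball_uniform:
  assumes "negligible N" "{x. \<not> P x} \<subseteq> N"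
  shows "AE x in ball_uniform. P x"
proof -
  have "AE x in lebesgue. x \<notin> N"
    using assms(1) by (simp add: negligible_iff_null_sets AE_not_in)
  then have "AE x in lborel. x \<notin> N" by (simp add: AE_completion_iff)
  then have "AE x in lborel. P x" by (rule eventually_mono) (use assms(2) in blast)
  then show ?thesis unfolding ball_uniform_def by (intro AE_uniform_measureI) auto
qed

lemma AE_ball_uniform_not_in_subspace:
  assumes "subspace L" "L \<noteq> UNIV"
  shows "AE x in ball_uniform. x \<notin> L"
proof (rule AE_ball_uniform)
  have "dim L \<noteq> DIM('a)" using assms by (metis dim_eq_full span_eq_iff)
  then have "dim L < DIM('a)" using dim_subset_UNIV[of L] by simp
  then show "negligible L" by (rule negligible_lowdim)
qed auto

lemma ball_uniform_proj_in_cones: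
  fixes L :: "'a::euclidean_space set"
  assumes L: "subspace L"
    and C: "C \<in> sets borel" "pos_homogeneous C" and D: "D \<in> sets borel" "pos_homogeneous D"
  shows "measure ball_uniform {x. orth_proj L x \<in> C \<and> x - orth_proj L x \<in> D} = cone_angle L C * cone_angle (L\<^sup>\<bottom>) D"
proof (rule measure_proj_in_cones[OF prob_space_ball_uniform sets_ball_uniform L distr_ball_uniform _ _ C D])
  show "AE x in ball_uniform. x \<notin> L\<^sup>\<bottom>" if "L \<noteq> {0}"
  proof (rule AE_ball_uniform_not_in_subspace[OF subspace_orthogonal_comp])
    show "L\<^sup>\<bottom> \<noteq> UNIV" using that orthogonal_comp_self[OF L] by auto
  qed
  show "AE x in ball_uniform. x \<notin> L" if "L\<^sup>\<bottom> \<noteq> {0}"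
    by (rule AE_ball_uniform_not_in_subspace[OF L]) (use that in auto)
qed

lemma cone_angle_UNIV: "subspace L \<Longrightarrow> cone_angle L UNIV = 1"
proof (cases "L = {0}")
  case False
  assume "subspace L"
  then have u: "is_sphere_uniform L (sphere_uniform L)"
    using False by (rule is_sphere_uniform_sphere_uniform)
  then have "space (sphere_uniform L) = UNIV" "prob_space (sphere_uniform L)"
    using sets_eq_imp_space_eq[of "sphere_uniform L" borel] by (auto simp: is_sphere_uniform_def)
  then show ?thesis using False prob_space.prob_space[of "sphere_uniform L"] by (simp add: cone_angle_def)
qed (simp add: cone_angle_def)

lemma cone_angle_eq_ball_uniform:
  fixes L :: "'a::euclidean_space set"
  assumes L: "subspace L" and C: "C \<in> sets borel" "pos_homogeneous C"
  shows "cone_angle L C = measure ball_uniform {x. orth_proj L x \<in> C}"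
  using ball_uniform_proj_in_cones[OF L C, of UNIV] cone_angle_UNIV[OF subspace_orthogonal_comp[of L]]
  by (simp add: pos_homogeneous_def)

lemma cone_angle_uminus:
  fixes L :: "'a::euclidean_space set"
  assumes L: "subspace L" and C: "C \<in> sets borel" "pos_homogeneous C"
  shows "cone_angle L (uminus ` C) = cone_angle L C"
proof -
  have o: "orthogonal_transformation (uminus :: 'a \<Rightarrow> 'a)"
    by (auto simp: orthogonal_transformation_def linear_uminus)
  have p: "linear (orth_proj L)" by (rule linear_orth_proj[OF L])
  have [measurable]: "orth_proj L \<in> borel_measurable borel" by (rule borel_measurable_linear[OF p])
  have eqC: "uminus ` C = uminus -` C \<inter> space borel" by force
  have mC: "uminus ` C \<in> sets borel" unfolding eqC
    by (rule measurable_sets[OF borel_measurable_linear[OF linear_uminus] C(1)])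
  have hC: "pos_homogeneous (uminus ` C)"
    using C(2) by (auto simp: pos_homogeneous_def)
  have mp: "{x. orth_proj L x \<in> C} \<in> sets borel"
    using measurable_sets[of "orth_proj L" borel borel C] C(1) by (simp add: vimage_def)
  have "cone_angle L C = measure (distr ball_uniform borel uminus) {x. orth_proj L x \<in> C}"
    by (simp only: cone_angle_eq_ball_uniform[OF L C] distr_ball_uniform[OF o])
  also have "\<dots> = measure ball_uniform (uminus -` {x. orth_proj L x \<in> C})"
    using mp by (subst measure_distr) auto
  also have "uminus -` {x. orth_proj L x \<in> C} = {x. orth_proj L x \<in> uminus ` C}"
    using linear_neg[OF p] by (auto simp: image_iff) (metis minus_equation_iff)
  finally show ?thesis using cone_angle_eq_ball_uniform[OF L mC hC] by simp
qed

lemma rel_interior_in_borel: "rel_interior N \<in> sets borel" for N :: "'a::euclidean_space set"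
proof -
  have "rel_interior N = closure N - rel_frontier N"
    using rel_interior_subset_closure by (auto simp: rel_frontier_def)
  then show ?thesis by (metis borel_closed closed_closure closed_rel_frontier sets.Diff)
qed

lemma rel_interior_pos_homogeneous:
  fixes N :: "'a::euclidean_space set"
  assumes "convex N" "pos_homogeneous N"
  shows "pos_homogeneous (rel_interior N)"
  unfolding pos_homogeneous_def
proof (intro ballI allI impI)
  fix x and c :: real assume x: "x \<in> rel_interior N" and c: "c > 0"
  have "(\<lambda>x. c *\<^sub>R x) ` N = N"
  proof (intro equalityI subsetI)
    fix y assume "y \<in> N"
    then have "inverse c *\<^sub>R y \<in> N" using assms(2) c by (simp add: pos_homogeneous_def)
    then show "y \<in> (\<lambda>x. c *\<^sub>R x) ` N" using c by (intro image_eqI[of _ _ "inverse c *\<^sub>R y"]) auto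
  qed (use assms(2) c in \<open>auto simp: pos_homogeneous_def\<close>)
  then show "c *\<^sub>R x \<in> rel_interior N"
    using rel_interior_convex_linear_image[OF linear_scaleR assms(1), of c] x by auto
qed

text \<open>The difference of the two events lies in the frontier of the convex set of all points that project into
  \<open>N\<close>, and frontiers of convex sets are negligible.\<close>

lemma cone_angle_rel_interior:
  fixes N :: "'a::euclidean_space set"
  assumes N: "closed N" "convex N" "pos_homogeneous N" "N \<subseteq> L" and L: "subspace L"
  shows "cone_angle L (rel_interior N) = cone_angle L N"
proof -
  interpret prob_space "ball_uniform :: 'a measure" by (rule prob_space_ball_uniform)
  define p where "p = orth_proj L"
  have p: "linear p" unfolding p_def by (rule linear_orth_proj[OF L])
  have [measurable]: "p \<in> borel_measurable borel" by (rule borel_measurable_linear[OF p])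
  define S where "S = p -` N"
  have pL: "p x = x" if "x \<in> L" for x
    using that L unfolding p_def by (intro orth_proj_unique) (auto simp: subspace_0 subspace_orthogonal_comp)
  have cS: "convex S" unfolding S_def by (rule convex_linear_vimage[OF p N(2)])
  have "p ` S = N"
  proof (intro equalityI subsetI)
    fix y assume "y \<in> N"
    then have "p y = y" "y \<in> S" using N(4) pL by (auto simp: S_def)
    then show "y \<in> p ` S" by (metis imageI)
  qed (auto simp: S_def)
  then have ri: "p ` rel_interior S = rel_interior N"
    using rel_interior_convex_linear_image[OF p cS] by simp
  have "AE x in ball_uniform. (p x \<in> rel_interior N) = (p x \<in> N)"
  proof (rule AE_ball_uniform[OF negligible_convex_frontier[OF cS]], rule subsetI)
    fix x assume "x \<in> {x. \<not> (p x \<in> rel_interior N) = (p x \<in> N)}"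
    then have x: "p x \<in> N" "p x \<notin> rel_interior N" using rel_interior_subset by auto
    have "x \<in> S" using x(1) by (simp add: S_def)
    moreover have "x \<notin> interior S" using x(2) ri interior_subset_rel_interior by blast
    ultimately show "x \<in> frontier S" unfolding frontier_def using closure_subset by blast
  qed
  moreover have "{x. p x \<in> E} \<in> sets borel" if "E \<in> sets borel" for E
    using measurable_sets[of p borel borel E] that by (simp add: vimage_def)
  ultimately have "measure ball_uniform {x. p x \<in> rel_interior N} = measure ball_uniform {x. p x \<in> N}"
    using rel_interior_in_borel[of N] borel_closed[OF N(1)] by (intro finite_measure_eq_AE) auto
  then show ?thesis
    using N rel_interior_pos_homogeneous[OF N(2,3)] rel_interior_in_borel[of N]
    by (simp add: cone_angle_eq_ball_uniform[OF L] p_def)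
qed

section \<open>The conic Gauss-Bonnet relation\<close>

text \<open>The smallest face that contains \<open>y\<close>: if \<open>y\<close> were on its relative boundary, a facet of it would be a
  smaller one.\<close>

lemma polyhedron_face_rel_interior_exists:
  fixes C :: "'a::euclidean_space set"
  assumes C: "polyhedron C" and y: "y \<in> C"
  obtains G where "G face_of C" "y \<in> rel_interior G"
proof -
  define G where "G = \<Inter>{F. F face_of C \<and> y \<in> F}"
  have CC: "C face_of C" using C by (simp add: face_of_refl polyhedron_imp_convex)
  have G: "G face_of C" unfolding G_def by (rule face_of_Inter) (use CC y in auto)
  have yG: "y \<in> G" by (auto simp: G_def)
  have "y \<in> rel_interior G"
  proof (rule ccontr)
    assume "y \<notin> rel_interior G"
    then have "y \<in> G - rel_interior G" using yG by blast
    then obtain F where F: "F facet_of G" "y \<in> F"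
      using rel_boundary_of_polyhedron[OF face_of_polyhedron_polyhedron[OF C G]] by blast
    then have "F face_of C" using face_of_trans[OF facet_of_imp_face_of G] by blast
    then have "G \<subseteq> F" using F(2) by (auto simp: G_def)
    moreover have "F \<subseteq> G" using F(1) by (rule facet_of_imp_subset)
    ultimately show False using F(1) facet_of_irrefl by (metis subset_antisym)
  qed
  then show thesis using that G by blast
qed

locale polyhedral_cone =
  fixes C :: "'a::euclidean_space set"
  assumes polyhedron: "polyhedron C" and zero: "0 \<in> C" and homogeneous: "pos_homogeneous C"
begin

definition "cone_faces = {K. K face_of C \<and> K \<noteq> {}}"

lemma convex: "convex C"
  using polyhedron by (rule polyhedron_imp_convex)

lemma finite_cone_faces: "finite cone_faces"
  unfolding cone_faces_def by (rule finite_subset[OF _ finite_polyhedron_faces[OF polyhedron]]) blast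

lemma cone_face_props:
  assumes K: "K \<in> cone_faces"
  shows "K face_of C" "K \<noteq> {}" "K \<subseteq> C" "convex K" "closed K" "0 \<in> K" "pos_homogeneous K"
    "direction_space K = span K" "aff_dim K = int (dim K)"
proof -
  show KC: "K face_of C" and ne: "K \<noteq> {}" using K by (auto simp: cone_faces_def)
  show "K \<subseteq> C" "convex K" using KC by (auto dest: face_of_imp_subset face_of_imp_convex)
  show "closed K" using face_of_polyhedron_polyhedron[OF polyhedron KC] by (rule polyhedron_imp_closed)
  show 0: "0 \<in> K" and "pos_homogeneous K" using face_of_cone[OF zero homogeneous KC ne] by auto
  show d: "direction_space K = span K" using direction_space_eq[OF 0] by simp
  show "aff_dim K = int (dim K)" using aff_dim_direction_space[OF ne] by (simp add: d)
qed

lemma cone_face_scale: "K \<in> cone_faces \<Longrightarrow> v \<in> K \<Longrightarrow> c \<ge> 0 \<Longrightarrow> c *\<^sub>R v \<in> K"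
  using cone_face_props(6,7)[of K] by (cases "c = 0") (auto simp: pos_homogeneous_def)

lemma cone_face_add:
  assumes K: "K \<in> cone_faces" and v: "v \<in> K" "w \<in> K"
  shows "v + w \<in> K"
proof -
  have "(1/2) *\<^sub>R v + (1/2) *\<^sub>R w \<in> K" using v by (intro convexD[OF cone_face_props(4)[OF K]]) auto
  then have "2 *\<^sub>R ((1/2) *\<^sub>R v + (1/2) *\<^sub>R w) \<in> K" by (rule cone_face_scale[OF K]) simp
  then show ?thesis by (simp add: scaleR_add_right)
qed

lemma whole_cone_face: "C \<in> cone_faces"
  using zero by (auto simp: cone_faces_def face_of_refl convex)

lemma normal_cone_cone_iff:
  assumes K: "K \<in> cone_faces"
  shows "w \<in> normal_cone K C \<longleftrightarrow> (\<forall>c\<in>C. w \<bullet> c \<le> 0) \<and> (\<forall>y\<in>K. w \<bullet> y = 0)"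
proof -
  note nc = normal_cone_iff[OF convex cone_face_props(1,2)[OF K]]
  have 0: "0 \<in> K" and KC: "K \<subseteq> C" using cone_face_props[OF K] by auto
  show ?thesis
  proof
    assume "w \<in> normal_cone K C"
    then have a: "\<And>q h. q \<in> C \<Longrightarrow> h \<in> K \<Longrightarrow> w \<bullet> q \<le> w \<bullet> h" using nc by blast
    have c: "w \<bullet> c \<le> 0" if "c \<in> C" for c using a[OF that 0] by simp
    moreover have "w \<bullet> y = 0" if "y \<in> K" for y using a[OF zero that] c[of y] that KC by auto
    ultimately show "(\<forall>c\<in>C. w \<bullet> c \<le> 0) \<and> (\<forall>y\<in>K. w \<bullet> y = 0)" by blast
  qed (simp add: nc)
qed

lemma normal_cone_antimono:
  "G \<in> cone_faces \<Longrightarrow> H \<in> cone_faces \<Longrightarrow> G \<subseteq> H \<Longrightarrow> normal_cone H C \<subseteq> normal_cone G C"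
  by (simp add: normal_cone_cone_iff subset_iff)

text \<open>A curve in the span of \<open>N\<close> that passes through a relative interior point of \<open>N\<close> stays in \<open>N\<close> for a
  while.\<close>

lemma eventually_in_by_rel_interior:
  fixes N :: "'a set" and z :: "real \<Rightarrow> 'a"
  assumes N: "0 \<in> N" and z0: "z t0 \<in> rel_interior N" and cont: "isCont z t0"
    and sp: "\<And>t. z t \<in> span N"
  shows "eventually (\<lambda>t. z t \<in> N) (nhds t0)"
proof -
  obtain e where e: "e > 0" "ball (z t0) e \<inter> affine hull N \<subseteq> N"
    using z0 by (auto simp: mem_rel_interior_ball)
  have ah: "affine hull N = span N" by (rule affine_hull_span_0) (use N in \<open>simp add: hull_inc\<close>)
  have "filterlim z (nhds (z t0)) (nhds t0)" using cont by (simp add: isCont_def tendsto_at_iff_tendsto_nhds)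
  then have "eventually (\<lambda>t. z t \<in> ball (z t0) e) (nhds t0)"
    using e(1) by (simp add: tendsto_def del: mem_ball)
  then show ?thesis by (rule eventually_mono) (use e(2) ah sp in blast)
qed

text \<open>The cone \<open>K - N\<^sub>K C\<close>. The sets \<open>K + N\<^sub>K C\<close> tile the space; reflecting the second summand does not change
  the measure, but it makes the cones overlap, and unless \<open>C\<close> is a
  subspace they overlap in such a way that their alternating sum vanishes.\<close>

definition orth_sum :: "'a set \<Rightarrow> 'a set"
  where "orth_sum K = {x. orth_proj (span K) x \<in> K \<and> - (x - orth_proj (span K) x) \<in> normal_cone K C}"

lemma orth_sumI:
  assumes K: "K \<in> cone_faces" and y: "y \<in> K" and z: "- z \<in> normal_cone K C"
  shows "y + z \<in> orth_sum K" "orth_proj (span K) (y + z) = y"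
proof -
  have "- z \<in> (span K)\<^sup>\<bottom>"
    using span_normal_cone[OF polyhedron cone_face_props(1,2)[OF K]] cone_face_props(8)[OF K] z
    by (metis span_base)
  then have "z \<in> (span K)\<^sup>\<bottom>" by (metis minus_minus subspace_neg subspace_orthogonal_comp)
  then show p: "orth_proj (span K) (y + z) = y"
    using y by (intro orth_proj_add) (auto intro: span_base)
  show "y + z \<in> orth_sum K" using p y z by (simp add: orth_sum_def)
qed

lemma closed_orth_sum:
  assumes K: "K \<in> cone_faces"
  shows "closed (orth_sum K)"
proof -
  define p where "p = orth_proj (span K)"
  have p: "linear p" unfolding p_def by (rule linear_orth_proj) simp
  have "orth_sum K = p -` K \<inter> (\<lambda>x. - (x - p x)) -` normal_cone K C"
    by (auto simp: orth_sum_def p_def)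
  moreover have "closed (p -` K)"
    by (rule closed_vimage[OF cone_face_props(5)[OF K] continuous_on_linear[OF p]])
  moreover have "closed ((\<lambda>x. - (x - p x)) -` normal_cone K C)"
    by (rule closed_vimage[OF closed_convex_cone_normal_cone(1)[OF convex cone_face_props(1,2)[OF K]]])
       (intro continuous_intros continuous_on_linear[OF p])
  ultimately show ?thesis by (simp add: closed_Int)
qed

lemma orth_sum_scale:
  assumes K: "K \<in> cone_faces" and x: "x \<in> orth_sum K" and c: "c \<ge> 0"
  shows "c *\<^sub>R x \<in> orth_sum K"
proof -
  have p: "linear (orth_proj (span K))" by (rule linear_orth_proj) simp
  have "c *\<^sub>R (- (x - orth_proj (span K) x)) \<in> normal_cone K C"
    using x closed_convex_cone_normal_cone(4)[OF convex cone_face_props(1,2)[OF K] c] by (simp add: orth_sum_def)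
  then show ?thesis
    using x cone_face_scale[OF K _ c] by (simp add: orth_sum_def linear_scale[OF p] scaleR_diff_right)
qed

text \<open>For a point \<open>y + z\<close> of \<open>K - N\<^sub>K C\<close> let \<open>G\<close> be the smallest face that contains \<open>y\<close>, and let \<open>H\<close> be the face on
  which the functional \<open>z\<close> vanishes. Then \<open>G \<subseteq> K \<subseteq> H\<close>, and both inclusions are equalities exactly in
  the relative interior.\<close>

lemma smallest_and_largest_face:
  assumes K: "K \<in> cone_faces" and y: "y \<in> K" and z: "- z \<in> normal_cone K C"
  obtains G H where "G \<in> cone_faces" "H \<in> cone_faces" "G \<subseteq> K" "K \<subseteq> H"
    "y \<in> rel_interior G" "- z \<in> rel_interior (normal_cone H C)"
proof -
  obtain G where G: "G face_of C" "y \<in> rel_interior G"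
    using polyhedron_face_rel_interior_exists[OF polyhedron] y cone_face_props(3)[OF K] by blast
  have GK: "G \<subseteq> K"
    by (rule subset_of_face_of[OF cone_face_props(1)[OF K] face_of_imp_subset[OF G(1)]]) (use G y in blast)
  have zc: "(- z) \<bullet> c \<le> 0" "k \<in> K \<Longrightarrow> (- z) \<bullet> k = 0" if "c \<in> C" for c k
    using z that by (auto simp: normal_cone_cone_iff[OF K] simp del: inner_minus_left)
  define H where "H = C \<inter> {c. (- z) \<bullet> c = 0}"
  have H: "H face_of C" unfolding H_def
    by (rule face_of_Int_supporting_hyperplane_le[OF convex zc(1)])
  have KH: "K \<subseteq> H" unfolding H_def using zc(2) cone_face_props(3)[OF K] by blast
  have "h \<in> H \<longleftrightarrow> h \<in> C \<and> (\<forall>q\<in>C. (- z) \<bullet> q \<le> (- z) \<bullet> h)" for h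
  proof
    show "h \<in> C \<and> (\<forall>q\<in>C. (- z) \<bullet> q \<le> (- z) \<bullet> h)" if "h \<in> H"
      using that zc(1) by (simp add: H_def del: inner_minus_left)
    show "h \<in> H" if h: "h \<in> C \<and> (\<forall>q\<in>C. (- z) \<bullet> q \<le> (- z) \<bullet> h)"
    proof -
      have "(- z) \<bullet> 0 \<le> (- z) \<bullet> h" using h zero by blast
      then show ?thesis using h zc(1)[of h] by (simp add: H_def)
    qed
  qed
  then have "- z \<in> exposing_functionals H C"
    unfolding exposing_functionals_def by blast
  moreover have "H \<noteq> {}" using KH cone_face_props(2)[OF K] by blast
  ultimately have "- z \<in> rel_interior (normal_cone H C)"
    using rel_interior_normal_cone[OF polyhedron H] by blast
  moreover have "G \<noteq> {}" using G(2) rel_interior_subset by blast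
  ultimately show thesis
    using that[of G H] G GK H KH \<open>H \<noteq> {}\<close> by (auto simp: cone_faces_def)
qed

lemma smallest_largest_face_unique:
  assumes "G \<in> cone_faces" "H \<in> cone_faces" "y \<in> rel_interior G" "w \<in> rel_interior (normal_cone H C)"
    and "G' \<in> cone_faces" "H' \<in> cone_faces" "y \<in> rel_interior G'" "w \<in> rel_interior (normal_cone H' C)"
  shows "G = G'" "H = H'"
proof -
  show "G = G'" using face_of_eq[of G C G'] assms cone_face_props(1) by blast
  have "w \<in> exposing_functionals H C" "w \<in> exposing_functionals H' C"
    using assms rel_interior_normal_cone[OF polyhedron cone_face_props(1,2)] by blast+
  then show "H = H'" by (simp add: exposing_functionals_def)
qed

text \<open>Let \<open>G\<close> be a facet of \<open>H\<close>, and let the line \<open>x + t w\<close> meet the common wall \<open>G - N\<^sub>H C\<close> of the two cones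
  \<open>G - N\<^sub>G C\<close> and \<open>H - N\<^sub>H C\<close> in a relatively interior point. Both cones lie on the same side of this wall. To see this,
  let \<open>u\<close> be the direction in the span of \<open>H\<close> that is orthogonal to \<open>G\<close> and points into \<open>H\<close>, and split the
  point into a part in the span of \<open>G\<close>, a multiple \<open>s t\<close> of \<open>u\<close>, and a part orthogonal to \<open>H\<close>. Near the wall,
  membership in either cone means \<open>s t \<ge> 0\<close>.\<close>

lemma facet_pair_change:
  fixes x w :: 'a
  assumes G: "G \<in> cone_faces" and H: "H \<in> cone_faces" and GH: "G \<subseteq> H" and dims: "dim H = dim G + 1"
    and y: "y \<in> rel_interior G" and z: "- z \<in> rel_interior (normal_cone H C)"
    and xt: "x + t0 *\<^sub>R w = y + z"
  shows "eventually (\<lambda>t. x + t *\<^sub>R w \<in> orth_sum G \<longleftrightarrow> x + t *\<^sub>R w \<in> orth_sum H) (nhds t0)"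
proof -
  have yG: "y \<in> G" and zN: "- z \<in> normal_cone H C" using y z rel_interior_subset by blast+
  have spH: "span (normal_cone H C) = (span H)\<^sup>\<bottom>" and spG: "span (normal_cone G C) = (span G)\<^sup>\<bottom>"
    using span_normal_cone[OF polyhedron cone_face_props(1,2)] cone_face_props(8) G H by metis+
  have sGH: "span G \<subseteq> span H" by (rule span_mono[OF GH])
  define p where "p = orth_proj (span G)"
  have plin: "linear p" unfolding p_def by (rule linear_orth_proj) simp
  have p: "p v \<in> span G" "v - p v \<in> (span G)\<^sup>\<bottom>" for v
    unfolding p_def using orth_proj[of "span G" v] by auto
  have "\<not> H \<subseteq> span G"
  proof
    assume "H \<subseteq> span G"
    then have "dim H \<le> dim (span G)" by (rule dim_subset)
    then show False using dims by simp
  qed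
  then obtain h0 where h0: "h0 \<in> H" "h0 \<notin> span G" by blast
  define u where "u = h0 - p h0"
  have uG: "u \<in> (span G)\<^sup>\<bottom>" using p by (simp add: u_def)
  have u0: "u \<noteq> 0" using h0(2) p(1)[of h0] by (auto simp: u_def)
  then have uu: "u \<bullet> u > 0" by simp
  have uH: "u \<in> span H" unfolding u_def using h0(1) p(1) sGH by (intro span_diff) (auto intro: span_base)
  have gu: "g \<bullet> u = 0" "u \<bullet> g = 0" if "g \<in> span G" for g
    using orthogonal_comp_inner[OF that uG] by (auto simp: inner_commute)
  have dec: "\<exists>k. v = p v + k *\<^sub>R u" if v: "v \<in> span H" for v
  proof -
    have "span (insert h0 G) = span H"
    proof (rule subspace_dim_equal)
      show "span (insert h0 G) \<subseteq> span H" using h0(1) GH by (intro span_mono) auto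
      show "dim (span H) \<le> dim (span (insert h0 G))" using h0(2) dims by (simp add: dim_insert)
    qed auto
    then obtain k where k: "v - k *\<^sub>R h0 \<in> span G" using v span_breakdown_eq by blast
    have pg: "p g = g" if "g \<in> span G" for g
      unfolding p_def using that by (intro orth_proj_unique) (auto simp: subspace_0 subspace_orthogonal_comp)
    have "p (v - k *\<^sub>R h0) = v - k *\<^sub>R h0" by (rule pg[OF k])
    then have "v = p v + k *\<^sub>R u"
      by (simp add: linear_diff[OF plin] linear_scale[OF plin] u_def algebra_simps)
    then show ?thesis ..
  qed
  have orthH: "v \<in> (span H)\<^sup>\<bottom>" if v: "v \<in> (span G)\<^sup>\<bottom>" "v \<bullet> u = 0" for v
    unfolding orthogonal_comp_iff
  proof
    fix s assume "s \<in> span H"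
    then obtain k where "s = p s + k *\<^sub>R u" using dec by blast
    then have "s \<bullet> v = p s \<bullet> v + k * (u \<bullet> v)" by (metis inner_add_left inner_scaleR_left)
    then show "s \<bullet> v = 0" using orthogonal_comp_inner[OF p(1) v(1)] v(2) by (simp add: inner_commute)
  qed
  have "\<exists>n\<in>normal_cone G C. n \<bullet> u \<noteq> 0"
  proof (rule ccontr)
    assume "\<not> ?thesis"
    then have "normal_cone G C \<subseteq> {n. n \<bullet> u = 0}" by blast
    then have "span (normal_cone G C) \<subseteq> {n. n \<bullet> u = 0}"
      by (rule span_minimal) (simp add: subspace_def inner_left_distrib)
    then have "u \<bullet> u = 0" using spG uG by blast
    then show False using u0 by simp
  qed
  then obtain n where n: "n \<in> normal_cone G C" "n \<bullet> u \<noteq> 0" by blast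
  have nG: "n \<bullet> g = 0" if "g \<in> span G" for g
  proof -
    have "n \<in> (span G)\<^sup>\<bottom>" using n(1) spG span_base by blast
    then show ?thesis using orthogonal_comp_inner[OF that] by (metis inner_commute)
  qed
  have nC: "n \<bullet> c \<le> 0" if "c \<in> C" for c using n(1) that by (simp add: normal_cone_cone_iff[OF G])
  have "n \<bullet> u = n \<bullet> h0" using nG[OF p(1)] by (simp add: u_def inner_diff_right)
  then have nu: "n \<bullet> u < 0" using nC[of h0] h0(1) cone_face_props(3)[OF H] n(2) by auto
  \<comment> \<open>A normal vector \<open>n\<close> of \<open>G\<close> with a component along \<open>-u\<close> plays for \<open>N\<^sub>G C\<close> the role that \<open>h0\<close> plays for \<open>H\<close>.\<close>
  define b where "b = - (n \<bullet> u) / (u \<bullet> u)"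
  have b: "b > 0" unfolding b_def using nu uu by (intro divide_pos_pos) auto
  define n0 where "n0 = n + b *\<^sub>R u"
  have n0: "n0 \<in> (span H)\<^sup>\<bottom>"
  proof (rule orthH)
    have "n \<in> (span G)\<^sup>\<bottom>" using n(1) spG span_base by blast
    then show "n0 \<in> (span G)\<^sup>\<bottom>" unfolding n0_def
      using uG by (intro subspace_add subspace_scale subspace_orthogonal_comp)
    have "n0 \<bullet> u = n \<bullet> u + b * (u \<bullet> u)" by (simp add: n0_def inner_add_left)
    then show "n0 \<bullet> u = 0" using uu by (simp add: b_def)
  qed
  define X where "X t = x + t *\<^sub>R w" for t
  define yt where "yt t = p (X t)" for t
  define s where "s t = (X t \<bullet> u) / (u \<bullet> u)" for t
  define zt where "zt t = X t - yt t - s t *\<^sub>R u" for t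
  have ytG: "yt t \<in> span G" for t by (simp add: yt_def p)
  have ztH: "zt t \<in> (span H)\<^sup>\<bottom>" for t
  proof (rule orthH)
    show "zt t \<in> (span G)\<^sup>\<bottom>"
      unfolding zt_def yt_def
      by (rule subspace_diff[OF subspace_orthogonal_comp p(2) subspace_scale[OF subspace_orthogonal_comp uG]])
    show "zt t \<bullet> u = 0"
      using uu gu(1)[OF ytG] by (simp add: zt_def inner_diff_left s_def)
  qed
  have zHc: "z \<in> (span H)\<^sup>\<bottom>"
  proof -
    have "- z \<in> (span H)\<^sup>\<bottom>" using zN spH span_base by blast
    then show ?thesis by (metis minus_minus subspace_neg subspace_orthogonal_comp)
  qed
  have zGc: "z \<in> (span G)\<^sup>\<bottom>" using zHc orthogonal_comp_anti_mono[OF sGH] by blast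
  have y0: "yt t0 = y"
    unfolding yt_def p_def X_def xt using yG zGc by (intro orth_proj_add) (auto intro: span_base)
  have s0: "s t0 = 0"
    unfolding s_def X_def xt using gu(1)[OF span_base[OF yG]] orthogonal_comp_inner[OF uH zHc]
    by (simp add: inner_add_left inner_add_right inner_commute)
  have z0: "zt t0 = z" unfolding zt_def y0 s0 X_def xt by simp
  have cX: "isCont X t" for t unfolding X_def by (intro continuous_intros)
  have cy: "isCont yt t" for t unfolding yt_def
    by (intro isCont_o2[OF cX]) (meson continuous_on_linear[OF plin] continuous_on_eq_continuous_at open_UNIV UNIV_I)
  have cs: "isCont s t" for t unfolding s_def using u0 by (intro continuous_intros cX) auto
  have cz: "isCont zt t" for t unfolding zt_def by (intro continuous_intros cX cy cs)
  have N0H: "0 \<in> normal_cone H C" using closed_convex_cone_normal_cone(3)[OF convex cone_face_props(1,2)[OF H]] .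
  have e1: "eventually (\<lambda>t. yt t \<in> G) (nhds t0)"
    by (rule eventually_in_by_rel_interior) (use y y0 cy ytG cone_face_props(6)[OF G] in auto)
  have e2: "eventually (\<lambda>t. yt t - s t *\<^sub>R p h0 \<in> G) (nhds t0)"
    by (rule eventually_in_by_rel_interior)
       (use y y0 s0 ytG cone_face_props(6)[OF G] p in \<open>auto intro!: continuous_intros cy cs span_diff span_scale\<close>)
  have neg: "- v \<in> span (normal_cone H C)" if "v \<in> (span H)\<^sup>\<bottom>" for v
    unfolding spH using that by (intro subspace_neg subspace_orthogonal_comp)
  have e3: "eventually (\<lambda>t. - zt t \<in> normal_cone H C) (nhds t0)"
    by (rule eventually_in_by_rel_interior) (use z z0 neg[OF ztH] N0H in \<open>auto intro!: continuous_intros cz\<close>)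
  have e4: "eventually (\<lambda>t. - (zt t + (s t / b) *\<^sub>R n0) \<in> normal_cone H C) (nhds t0)"
  proof (rule eventually_in_by_rel_interior)
    show "- (zt t + (s t / b) *\<^sub>R n0) \<in> span (normal_cone H C)" for t
      by (rule neg) (intro subspace_add subspace_scale subspace_orthogonal_comp ztH n0)
  qed (use z z0 s0 N0H b in \<open>auto intro!: continuous_intros cz cs\<close>)
  show ?thesis
    using e1 e2 e3 e4
  proof eventually_elim
    case (elim t)
    have XH: "X t = (yt t + s t *\<^sub>R u) + zt t" and XG: "X t = yt t + (s t *\<^sub>R u + zt t)"
      by (auto simp: zt_def)
    have pH: "orth_proj (span H) (X t) = yt t + s t *\<^sub>R u"
      unfolding XH using ytG sGH uH ztH by (intro orth_proj_add) (auto intro!: span_add span_scale)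
    have oH: "X t \<in> orth_sum H \<longleftrightarrow> yt t + s t *\<^sub>R u \<in> H"
      unfolding orth_sum_def mem_Collect_eq pH using elim(3) by (simp add: zt_def algebra_simps)
    have oG: "X t \<in> orth_sum G \<longleftrightarrow> - (s t *\<^sub>R u + zt t) \<in> normal_cone G C"
      unfolding orth_sum_def mem_Collect_eq p_def[symmetric] yt_def[symmetric]
      using elim(1) by (simp add: zt_def algebra_simps)
    have "yt t + s t *\<^sub>R u \<in> H \<longleftrightarrow> s t \<ge> 0"
    proof
      assume "yt t + s t *\<^sub>R u \<in> H"
      then have "n \<bullet> (yt t + s t *\<^sub>R u) \<le> 0" using nC cone_face_props(3)[OF H] by blast
      then have "s t * (n \<bullet> u) \<le> 0" using nG[OF ytG] by (simp add: inner_add_right)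
      then show "s t \<ge> 0" using nu by (simp add: mult_le_0_iff)
    next
      assume "s t \<ge> 0"
      then have "(yt t - s t *\<^sub>R p h0) + s t *\<^sub>R h0 \<in> H"
        using elim(2) GH h0(1) by (intro cone_face_add[OF H] cone_face_scale[OF H]) auto
      then show "yt t + s t *\<^sub>R u \<in> H" by (simp add: u_def algebra_simps)
    qed
    moreover have "- (s t *\<^sub>R u + zt t) \<in> normal_cone G C \<longleftrightarrow> s t \<ge> 0"
    proof
      assume "- (s t *\<^sub>R u + zt t) \<in> normal_cone G C"
      then have "(- (s t *\<^sub>R u + zt t)) \<bullet> h0 \<le> 0"
        using h0(1) cone_face_props(3)[OF H] normal_cone_cone_iff[OF G] by blast
      moreover have "zt t \<bullet> h0 = 0"
        using orthogonal_comp_inner[OF span_base[OF h0(1)] ztH] by (simp add: inner_commute)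
      moreover have "u \<bullet> h0 = u \<bullet> u" using gu(2)[OF p(1)[of h0]] by (simp add: u_def inner_diff_right)
      ultimately have "0 \<le> s t * (u \<bullet> u)" by (simp add: inner_diff_left inner_add_left)
      then show "s t \<ge> 0" using uu by (simp add: zero_le_mult_iff)
    next
      assume st: "s t \<ge> 0"
      note ncG = closed_convex_cone_normal_cone[OF convex cone_face_props(1,2)[OF G]]
      have "(s t / b) *\<^sub>R n + (- (zt t + (s t / b) *\<^sub>R n0)) \<in> normal_cone G C"
        using st b n(1) elim(4) normal_cone_antimono[OF G H GH] by (intro ncG(5) ncG(4)) auto
      moreover have "(s t / b) *\<^sub>R n + (- (zt t + (s t / b) *\<^sub>R n0)) = - (s t *\<^sub>R u + zt t)"
        using b by (simp add: n0_def scaleR_add_right)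
      ultimately show "- (s t *\<^sub>R u + zt t) \<in> normal_cone G C" by (simp only:)
    qed
    ultimately show ?case using oH oG by (simp add: X_def)
  qed
qed

end

context polyhedral_cone
begin

text \<open>The alternating number of the cones that contain \<open>x\<close>. Unless \<open>C\<close> is a subspace, it turns out to be
  zero for almost all \<open>x\<close>.\<close>

definition euler_count :: "'a \<Rightarrow> int"
  where "euler_count x = (\<Sum>K\<in>cone_faces. (-1) ^ dim K * of_bool (x \<in> orth_sum K))"

text \<open>The line through \<open>x\<close> in direction \<open>w\<close> avoids the linear hulls of all walls of codimension two or more.\<close>

definition generic_line :: "'a \<Rightarrow> 'a \<Rightarrow> bool"
  where "generic_line w x \<longleftrightarrow> (\<forall>G\<in>cone_faces. \<forall>H\<in>cone_faces. dim G + 2 \<le> dim H \<longrightarrow>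
    x \<notin> span (insert w (span G \<union> (span H)\<^sup>\<bottom>)))"

lemma dim_face_less:
  assumes "G \<in> cone_faces" "H \<in> cone_faces" "G \<subseteq> H" "G \<noteq> H"
  shows "dim G < dim H"
proof -
  have "G face_of H" using face_of_subset[OF cone_face_props(1)[OF assms(1)] assms(3)] cone_face_props(3)[OF assms(2)] by blast
  then have "aff_dim G < aff_dim H" using face_of_aff_dim_lt[OF cone_face_props(4)[OF assms(2)]] assms(4) by blast
  then show ?thesis using cone_face_props(9) assms by simp
qed

lemma generic_line_dims:
  assumes gen: "generic_line w x" and G: "G \<in> cone_faces" and H: "H \<in> cone_faces" and GH: "G \<subseteq> H"
    and y: "y \<in> G" and z: "- z \<in> normal_cone H C" and xt: "x + t *\<^sub>R w = y + z"
  shows "G = H \<or> dim H = dim G + 1"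
proof (rule ccontr)
  assume "\<not> ?thesis"
  then have "dim G + 2 \<le> dim H" using dim_face_less[OF G H GH] by force
  moreover have "x \<in> span (insert w (span G \<union> (span H)\<^sup>\<bottom>))"
  proof -
    have "- z \<in> (span H)\<^sup>\<bottom>"
      using span_normal_cone[OF polyhedron cone_face_props(1,2)[OF H]] cone_face_props(8)[OF H] z
      by (metis span_base)
    then have "z \<in> (span H)\<^sup>\<bottom>" by (metis minus_minus subspace_neg subspace_orthogonal_comp)
    then have "(y + z) - t *\<^sub>R w \<in> span (insert w (span G \<union> (span H)\<^sup>\<bottom>))"
      using span_base[OF y] by (intro span_diff span_add span_scale span_base) auto
    also have "(y + z) - t *\<^sub>R w = x" using xt by (simp add: algebra_simps)
    finally show ?thesis .
  qed
  ultimately show False using gen G H unfolding generic_line_def by blast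
qed

text \<open>At a parameter \<open>t0\<close> a cone can gain or lose the point only if the pair \<open>G \<subset> H\<close> of smallest and largest
  face is proper. On a generic line \<open>G\<close> is then a facet of \<open>H\<close> and \<open>K\<close> is one of the two. Exchanging
  them is an involution \<open>q\<close> on these faces, and the contributions of partners cancel near \<open>t0\<close>, since they have
  opposite signs and change simultaneously.\<close>

lemma euler_count_locally_constant:
  assumes gen: "generic_line w x"
  shows "eventually (\<lambda>t. euler_count (x + t *\<^sub>R w) = euler_count (x + t0 *\<^sub>R w)) (nhds t0)"
proof -
  define X where "X t = x + t *\<^sub>R w" for t
  define S where "S = {K \<in> cone_faces. X t0 \<in> orth_sum K}"
  define y where "y K = orth_proj (span K) (X t0)" for K
  define z where "z K = X t0 - y K" for K
  have yz: "y K \<in> K" "- z K \<in> normal_cone K C" if "K \<in> S" for K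
    using that by (auto simp: S_def orth_sum_def y_def z_def)
  define R where "R K G H \<longleftrightarrow> G \<in> cone_faces \<and> H \<in> cone_faces \<and> G \<subseteq> K \<and> K \<subseteq> H \<and>
      y K \<in> rel_interior G \<and> - z K \<in> rel_interior (normal_cone H C)" for K G H
  have "\<exists>G H. R K G H" if "K \<in> S" for K
  proof -
    have "K \<in> cone_faces" using that by (simp add: S_def)
    then show ?thesis
      using smallest_and_largest_face[OF _ yz[OF that]] unfolding R_def by metis
  qed
  then obtain g h where "\<And>K. K \<in> S \<Longrightarrow> R K (g K) (h K)" by metis
  note gh = this[unfolded R_def]
  have yg: "y K \<in> g K" and zh: "- z K \<in> normal_cone (h K) C" if "K \<in> S" for K
    using gh[OF that] rel_interior_subset by blast+
  have Xyz: "X t0 = y K + z K" for K by (simp add: z_def)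
  \<comment> \<open>The faces whose cone has the point on its boundary.\<close>
  define S2 where "S2 = {K \<in> S. g K \<noteq> h K}"
  have dim2: "dim (h K) = dim (g K) + 1" if K: "K \<in> S2" for K
  proof -
    have K': "K \<in> S" and ne: "g K \<noteq> h K" using K by (auto simp: S2_def)
    have "g K \<subseteq> h K" using gh[OF K'] by blast
    then show ?thesis
      using generic_line_dims[OF gen _ _ _ yg[OF K'] zh[OF K'], of t0] gh[OF K'] ne Xyz[of K] X_def by auto
  qed
  have K2: "K = g K \<or> K = h K" if K: "K \<in> S2" for K
  proof -
    have K': "K \<in> S" "K \<in> cone_faces" using K by (auto simp: S2_def S_def)
    then show ?thesis
      using dim_face_less[of "g K" K] dim_face_less[of K "h K"] gh[OF K'(1)] dim2[OF K] by fastforce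
  qed
  define q where "q K = (if K = g K then h K else g K)" for K
  have q: "q K \<in> S2" "g (q K) = g K" "h (q K) = h K" if K: "K \<in> S2" for K
  proof -
    have K': "K \<in> S" using K by (auto simp: S2_def)
    note G = gh[OF K']
    have qf: "q K \<in> cone_faces" "g K \<subseteq> q K" "q K \<subseteq> h K" using G by (auto simp: q_def)
    have "y K \<in> q K" "- z K \<in> normal_cone (q K) C"
      using yg[OF K'] zh[OF K'] qf normal_cone_antimono[OF qf(1) _ qf(3)] G by auto
    note os = orth_sumI[OF qf(1) this]
    have qS: "q K \<in> S" using os(1) qf(1) by (simp add: S_def Xyz[of K])
    have yq: "y (q K) = y K" using os(2) by (simp add: y_def[of "q K"] Xyz[of K])
    then have zq: "z (q K) = z K" by (simp add: z_def)
    have G': "g (q K) \<in> cone_faces" "h (q K) \<in> cone_faces" "y K \<in> rel_interior (g (q K))"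
        "- z K \<in> rel_interior (normal_cone (h (q K)) C)"
      using gh[OF qS] yq zq by auto
    show gq: "g (q K) = g K" "h (q K) = h K"
      using smallest_largest_face_unique[of "g (q K)" "h (q K)" "y K" "- z K" "g K" "h K"] G' G by auto
    then show "q K \<in> S2" using qS K by (simp add: S2_def)
  qed
  have qq: "q (q K) = K" if K: "K \<in> S2" for K
  proof (cases "K = g K")
    case True
    then have qK: "q K = h K" by (simp add: q_def)
    have "q K \<noteq> g (q K)" using q(2)[OF K] qK K by (auto simp: S2_def)
    then have "q (q K) = g (q K)" by (simp add: q_def)
    then show ?thesis using q(2)[OF K] True by simp
  next
    case False
    then have qK: "q K = g K" by (simp add: q_def)
    then have "q K = g (q K)" using q(2)[OF K] by simp
    then have "q (q K) = h (q K)" by (simp add: q_def)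
    then show ?thesis using q(3)[OF K] K2[OF K] False by simp
  qed
  have sign: "(-1::int) ^ dim (q K) = - ((-1) ^ dim K)" if K: "K \<in> S2" for K
  proof (cases "K = g K")
    case True
    then have "q K = h K" by (simp add: q_def)
    moreover have "dim K = dim (g K)" by (rule arg_cong[where f = dim, OF True])
    ultimately show ?thesis using dim2[OF K] by simp
  next
    case False
    then have "q K = g K" by (simp add: q_def)
    moreover have "dim K = dim (h K)" using K2[OF K] False by metis
    ultimately show ?thesis using dim2[OF K] by simp
  qed
  have fin: "finite cone_faces" by (rule finite_cone_faces)
  have finS: "finite S" "finite S2" using fin by (auto simp: S_def S2_def)
  have ev_out: "eventually (\<lambda>t. X t \<notin> orth_sum K) (nhds t0)" if K: "K \<in> cone_faces - S" for K
  proof -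
    have "open (- orth_sum K)" using closed_orth_sum K by blast
    moreover have "X t0 \<in> - orth_sum K" using K by (simp add: S_def)
    moreover have "filterlim X (nhds (X t0)) (nhds t0)"
    proof -
      have "isCont X t0" unfolding X_def by (intro continuous_intros)
      then show ?thesis by (simp add: isCont_def tendsto_at_iff_tendsto_nhds)
    qed
    ultimately have "eventually (\<lambda>t. X t \<in> - orth_sum K) (nhds t0)"
      by (simp add: tendsto_def del: Compl_iff)
    then show ?thesis by simp
  qed
  have ev_in: "eventually (\<lambda>t. X t \<in> orth_sum K) (nhds t0)" if K: "K \<in> S - S2" for K
  proof -
    have K': "K \<in> S" "K \<in> cone_faces" "g K = h K" using K by (auto simp: S2_def S_def)
    then have gK: "g K = K" "h K = K" using gh[OF K'(1)] by auto
    define p where "p = orth_proj (span K)"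
    have plin: "linear p" unfolding p_def by (rule linear_orth_proj) simp
    have cX: "isCont X t0" unfolding X_def by (intro continuous_intros)
    have cp: "isCont (\<lambda>t. p (X t)) t0"
      by (intro isCont_o2[OF cX]) (meson continuous_on_linear[OF plin] continuous_on_eq_continuous_at open_UNIV UNIV_I)
    have sp: "span (normal_cone K C) = (span K)\<^sup>\<bottom>"
      using span_normal_cone[OF polyhedron cone_face_props(1,2)[OF K'(2)]] cone_face_props(8)[OF K'(2)] by simp
    have "eventually (\<lambda>t. p (X t) \<in> K) (nhds t0)"
    proof (rule eventually_in_by_rel_interior[OF _ _ cp])
      show "p (X t0) \<in> rel_interior K" using gh[OF K'(1)] gK by (simp add: p_def y_def)
    qed (use cone_face_props(6)[OF K'(2)] in \<open>auto simp: p_def orth_proj\<close>)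
    moreover have "eventually (\<lambda>t. - (X t - p (X t)) \<in> normal_cone K C) (nhds t0)"
    proof (rule eventually_in_by_rel_interior)
      show "0 \<in> normal_cone K C"
        using closed_convex_cone_normal_cone(3)[OF convex cone_face_props(1,2)[OF K'(2)]] .
      show "- (X t0 - p (X t0)) \<in> rel_interior (normal_cone K C)"
        using gh[OF K'(1)] gK by (simp add: p_def y_def z_def)
      show "isCont (\<lambda>t. - (X t - p (X t))) t0" by (intro continuous_intros cX cp)
      show "- (X t - p (X t)) \<in> span (normal_cone K C)" for t
        unfolding sp p_def by (intro subspace_neg subspace_orthogonal_comp orth_proj) simp
    qed
    ultimately show ?thesis by eventually_elim (simp add: orth_sum_def p_def)
  qed
  have ev_pair: "eventually (\<lambda>t. X t \<in> orth_sum K \<longleftrightarrow> X t \<in> orth_sum (q K)) (nhds t0)" if K: "K \<in> S2" for K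
  proof -
    have K': "K \<in> S" using K by (auto simp: S2_def)
    have "g K \<subseteq> h K" using gh[OF K'] by blast
    then have "eventually (\<lambda>t. X t \<in> orth_sum (g K) \<longleftrightarrow> X t \<in> orth_sum (h K)) (nhds t0)"
      unfolding X_def
      by (intro facet_pair_change[where y = "y K" and z = "z K"])
         (use gh[OF K'] dim2[OF K] Xyz[of K] in \<open>auto simp: X_def\<close>)
    then show ?thesis by (rule eventually_mono) (use K2[OF K] in \<open>auto simp: q_def\<close>)
  qed
  define a where "a = (\<Sum>K\<in>S - S2. (-1::int) ^ dim K)"
  have "eventually (\<lambda>t. (\<forall>K\<in>cone_faces - S. X t \<notin> orth_sum K) \<and> (\<forall>K\<in>S - S2. X t \<in> orth_sum K) \<and>
      (\<forall>K\<in>S2. X t \<in> orth_sum K \<longleftrightarrow> X t \<in> orth_sum (q K))) (nhds t0)"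
    using fin finS ev_out ev_in ev_pair by (intro eventually_conj eventually_ball_finite) auto
  then have ev: "eventually (\<lambda>t. euler_count (X t) = a) (nhds t0)"
  proof (rule eventually_mono)
    fix t assume t: "(\<forall>K\<in>cone_faces - S. X t \<notin> orth_sum K) \<and> (\<forall>K\<in>S - S2. X t \<in> orth_sum K) \<and>
      (\<forall>K\<in>S2. X t \<in> orth_sum K \<longleftrightarrow> X t \<in> orth_sum (q K))"
    define f where "f K = (-1::int) ^ dim K * of_bool (X t \<in> orth_sum K)" for K
    have "(\<Sum>K\<in>S2. f K) = (\<Sum>K\<in>S2. f (q K))"
      by (rule sum.reindex_bij_witness[where i = q and j = q]) (use q qq in auto)
    also have "\<dots> = (\<Sum>K\<in>S2. - f K)"
      by (rule sum.cong) (use sign t in \<open>auto simp: f_def\<close>)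
    finally have s2: "(\<Sum>K\<in>S2. f K) = 0" by (simp add: sum_negf)
    have "euler_count (X t) = (\<Sum>K\<in>S. f K) + (\<Sum>K\<in>cone_faces - S. f K)"
      unfolding euler_count_def f_def using fin
      by (subst add.commute, intro sum.subset_diff) (auto simp: S_def)
    also have "(\<Sum>K\<in>cone_faces - S. f K) = 0" using t by (intro sum.neutral) (auto simp: f_def)
    also have "(\<Sum>K\<in>S. f K) = (\<Sum>K\<in>S2. f K) + (\<Sum>K\<in>S - S2. f K)"
      using finS by (subst add.commute, intro sum.subset_diff) (auto simp: S2_def)
    also have "(\<Sum>K\<in>S - S2. f K) = a" unfolding a_def using t by (intro sum.cong) (auto simp: f_def)
    finally show "euler_count (X t) = a" using s2 by simp
  qed
  then have "euler_count (X t0) = a" by (rule eventually_nhds_x_imp_x)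
  then show ?thesis using ev by (simp add: X_def)
qed

text \<open>Take the negative of a functional \<open>a\<close> that separates \<open>-c \<notin> C\<close> from \<open>C\<close>. If \<open>-a = y + z\<close> as in the definition of
  \<open>orth_sum\<close>, then \<open>y \<bullet> y = - a \<bullet> y \<le> 0\<close>, so \<open>y = 0\<close>, and the functional \<open>-a\<close> would be nonnegative at \<open>c\<close>.\<close>

lemma escaping_direction_exists:
  assumes "\<not> subspace C"
  obtains w where "\<And>K. K \<in> cone_faces \<Longrightarrow> w \<notin> orth_sum K"
proof -
  have "\<exists>c\<in>C. - c \<notin> C"
  proof (rule ccontr)
    assume "\<not> ?thesis"
    then have neg: "- c \<in> C" if "c \<in> C" for c using that by blast
    have "r *\<^sub>R c \<in> C" if "c \<in> C" for r c
      using cone_face_scale[OF whole_cone_face that, of r] cone_face_scale[OF whole_cone_face neg[OF that], of "- r"]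
      by (cases "r \<ge> 0") auto
    then have "subspace C" using zero cone_face_add[OF whole_cone_face] by (simp add: subspace_def)
    then show False using assms by simp
  qed
  then obtain c where c: "c \<in> C" "- c \<notin> C" by blast
  obtain a b where ab: "a \<bullet> (- c) < b" "\<And>x. x \<in> C \<Longrightarrow> a \<bullet> x > b"
    using separating_hyperplane_closed_point[OF convex cone_face_props(5)[OF whole_cone_face] c(2)] by blast
  have b0: "b < 0" using ab(2)[OF zero] by simp
  have aC: "a \<bullet> x \<ge> 0" if "x \<in> C" for x
  proof (rule ccontr)
    assume "\<not> a \<bullet> x \<ge> 0"
    then have neg: "a \<bullet> x < 0" by simp
    have "(b / (a \<bullet> x)) *\<^sub>R x \<in> C" by (rule cone_face_scale[OF whole_cone_face that]) (use b0 neg in \<open>simp add: divide_nonpos_nonpos\<close>)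
    then have "b < a \<bullet> ((b / (a \<bullet> x)) *\<^sub>R x)" by (rule ab(2))
    then show False using neg by simp
  qed
  have ac: "a \<bullet> c > 0" using ab(1) b0 by simp
  show thesis
  proof (rule that[of "- a"])
    fix K assume K: "K \<in> cone_faces"
    show "- a \<notin> orth_sum K"
    proof
      assume "- a \<in> orth_sum K"
      define y where "y = orth_proj (span K) (- a)"
      have y: "y \<in> K" and z: "- (- a - y) \<in> normal_cone K C"
        using \<open>- a \<in> orth_sum K\<close> by (auto simp: orth_sum_def y_def)
      have "(a + y) \<bullet> y = 0" and le: "(a + y) \<bullet> c \<le> 0"
        using z y c(1) by (auto simp: normal_cone_cone_iff[OF K] add.commute)
      moreover have "a \<bullet> y \<ge> 0" using aC y cone_face_props(3)[OF K] by blast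
      ultimately have "y \<bullet> y \<le> 0" by (simp add: inner_add_left)
      then have "y = 0" using inner_ge_zero[of y] by (metis antisym inner_eq_zero_iff)
      then show False using le ac by simp
    qed
  qed
qed

text \<open>Far out in the direction \<open>w\<close> the line has left all the cones, since they are closed and \<open>w\<close> is in none of
  them. The count is zero there, and it is constant along the line.\<close>

lemma euler_count_generic:
  assumes w: "\<And>K. K \<in> cone_faces \<Longrightarrow> w \<notin> orth_sum K" and gen: "generic_line w x"
  shows "euler_count x = 0"
proof -
  have "eventually (\<lambda>t. x + t *\<^sub>R w \<notin> orth_sum K) at_top" if K: "K \<in> cone_faces" for K
  proof -
    have "((\<lambda>t. inverse t *\<^sub>R x + w) \<longlongrightarrow> 0 *\<^sub>R x + w) at_top"
      by (intro tendsto_intros tendsto_inverse_0_at_top filterlim_ident)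
    then have lim: "((\<lambda>t. inverse t *\<^sub>R x + w) \<longlongrightarrow> w) at_top" by simp
    have "open (- orth_sum K)" using closed_orth_sum[OF K] by blast
    moreover have "w \<in> - orth_sum K" using w[OF K] by simp
    ultimately have "eventually (\<lambda>t. inverse t *\<^sub>R x + w \<in> - orth_sum K) at_top"
      using lim by (simp add: tendsto_def del: Compl_iff)
    moreover have "eventually (\<lambda>t. t > (0::real)) at_top" by (rule eventually_gt_at_top)
    ultimately show ?thesis
    proof eventually_elim
      case (elim t)
      show ?case
      proof
        assume "x + t *\<^sub>R w \<in> orth_sum K"
        then have "inverse t *\<^sub>R (x + t *\<^sub>R w) \<in> orth_sum K"
          using elim(2) by (intro orth_sum_scale[OF K]) auto
        then show False using elim by (simp add: scaleR_add_right)
      qed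
    qed
  qed
  then have "eventually (\<lambda>t. \<forall>K\<in>cone_faces. x + t *\<^sub>R w \<notin> orth_sum K) at_top"
    using finite_cone_faces by (intro eventually_ball_finite) auto
  then obtain T where T: "\<forall>K\<in>cone_faces. x + T *\<^sub>R w \<notin> orth_sum K"
    unfolding eventually_at_top_linorder by blast
  have "euler_count (x + 0 *\<^sub>R w) = euler_count (x + T *\<^sub>R w)"
  proof (rule connected_local_const[where A = UNIV and f = "\<lambda>t. euler_count (x + t *\<^sub>R w)"])
    show "\<forall>a\<in>UNIV. eventually (\<lambda>b. euler_count (x + a *\<^sub>R w) = euler_count (x + b *\<^sub>R w)) (at a within UNIV)"
    proof
      fix a :: real
      have "eventually (\<lambda>b. euler_count (x + b *\<^sub>R w) = euler_count (x + a *\<^sub>R w)) (at a)"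
        by (rule eventually_nhds_conv_at[THEN iffD1, THEN conjunct1, OF euler_count_locally_constant[OF gen]])
      then show "eventually (\<lambda>b. euler_count (x + a *\<^sub>R w) = euler_count (x + b *\<^sub>R w)) (at a within UNIV)"
        by (rule eventually_mono) simp
    qed
  qed auto
  also have "euler_count (x + T *\<^sub>R w) = 0"
    unfolding euler_count_def using T by (intro sum.neutral) auto
  finally show ?thesis by simp
qed

text \<open>The subspaces in question are proper: projecting onto the span of \<open>H\<close> leaves at most
  \<open>dim G + 1 < dim H\<close> dimensions.\<close>

lemma AE_generic_line: "AE x in ball_uniform. generic_line w x"
proof -
  have "AE x in ball_uniform. x \<notin> span (insert w (span G \<union> (span H)\<^sup>\<bottom>))"
    if dims: "dim G + 2 \<le> dim H" for G H :: "'a set"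
  proof (rule AE_ball_uniform_not_in_subspace)
    let ?W = "insert w (span G \<union> (span H)\<^sup>\<bottom>)"
    show "span ?W \<noteq> UNIV"
    proof
      assume U: "span ?W = UNIV"
      define p where "p = orth_proj (span H)"
      have plin: "linear p" unfolding p_def by (rule linear_orth_proj) simp
      have "p v = v" if "v \<in> span H" for v
        unfolding p_def using that by (intro orth_proj_unique) (auto simp: subspace_0 subspace_orthogonal_comp)
      then have "span H \<subseteq> p ` span ?W" unfolding U by (metis UNIV_I image_eqI subsetI)
      also have "p ` span ?W = span (p ` ?W)" by (rule linear_span_image[OF plin, symmetric])
      also have "\<dots> \<subseteq> span (insert (p w) (p ` span G))"
      proof (rule span_minimal)
        have "p v = 0" if "v \<in> (span H)\<^sup>\<bottom>" for v
          unfolding p_def using that by (simp add: orth_proj_eq_0_iff)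
        then show "p ` ?W \<subseteq> span (insert (p w) (p ` span G))"
          by (auto intro: span_base simp: span_zero)
      qed simp
      finally have "dim H \<le> dim (insert (p w) (p ` span G))"
        by (metis dim_span dim_subset)
      also have "\<dots> \<le> dim (p ` span G) + 1" by (simp add: dim_insert)
      also have "dim (p ` span G) \<le> dim G" using dim_image_le[OF plin, of "span G"] by simp
      finally show False using dims by simp
    qed
  qed simp
  then show ?thesis
    unfolding generic_line_def using finite_cone_faces by (intro AE_finite_allI AE_impI) auto
qed

text \<open>The reflection of the normal cone does not change its angle.\<close>

lemma measure_orth_sum:
  assumes K: "K \<in> cone_faces"
  shows "measure ball_uniform (orth_sum K) = solid_angle K * solid_angle (normal_cone K C)"
proof -
  note nc = closed_convex_cone_normal_cone[OF convex cone_face_props(1,2)[OF K]]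
  have sp: "span (normal_cone K C) = (span K)\<^sup>\<bottom>"
    using span_normal_cone[OF polyhedron cone_face_props(1,2)[OF K]] cone_face_props(8)[OF K] by simp
  have N: "normal_cone K C \<in> sets borel" "pos_homogeneous (normal_cone K C)"
    using nc(1,4) by (auto simp: pos_homogeneous_def)
  have N': "uminus ` normal_cone K C \<in> sets borel" "pos_homogeneous (uminus ` normal_cone K C)"
    using nc(1,4) by (auto simp: pos_homogeneous_def closed_negations)
  have K': "K \<in> sets borel" "pos_homogeneous K" using cone_face_props[OF K] by auto
  have eq: "orth_sum K = {x. orth_proj (span K) x \<in> K \<and> x - orth_proj (span K) x \<in> uminus ` normal_cone K C}"
  proof -
    have "- v \<in> normal_cone K C \<longleftrightarrow> v \<in> uminus ` normal_cone K C" for v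
      by (metis imageE imageI minus_minus)
    then show ?thesis unfolding orth_sum_def by blast
  qed
  have "measure ball_uniform (orth_sum K) = cone_angle (span K) K * cone_angle ((span K)\<^sup>\<bottom>) (uminus ` normal_cone K C)"
    unfolding eq by (rule ball_uniform_proj_in_cones[OF subspace_span K' N'])
  also have "cone_angle ((span K)\<^sup>\<bottom>) (uminus ` normal_cone K C) = cone_angle ((span K)\<^sup>\<bottom>) (normal_cone K C)"
    by (rule cone_angle_uminus[OF subspace_orthogonal_comp N])
  finally show ?thesis
    using solid_angle_eq_cone_angle[OF cone_face_props(6)[OF K]] solid_angle_eq_cone_angle[OF nc(3)]
    by (simp add: sp)
qed

lemma alternating_sum_angles:
  assumes ns: "\<not> subspace C"
  shows "(\<Sum>K\<in>cone_faces. (-1) ^ dim K * (solid_angle K * solid_angle (normal_cone K C))) = 0"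
proof -
  interpret prob_space "ball_uniform :: 'a measure" by (rule prob_space_ball_uniform)
  obtain w where w: "\<And>K. K \<in> cone_faces \<Longrightarrow> w \<notin> orth_sum K"
    using escaping_direction_exists[OF ns] by metis
  have m: "orth_sum K \<in> sets borel" if "K \<in> cone_faces" for K
    using closed_orth_sum[OF that] by (rule borel_closed)
  have "(\<Sum>K\<in>cone_faces. (-1) ^ dim K * (solid_angle K * solid_angle (normal_cone K C)))
     = (\<Sum>K\<in>cone_faces. (-1) ^ dim K * (\<integral>x. indicator (orth_sum K) x \<partial>ball_uniform))"
    using m by (intro sum.cong refl) (simp add: measure_orth_sum)
  also have "\<dots> = (\<integral>x. (\<Sum>K\<in>cone_faces. (-1) ^ dim K * indicator (orth_sum K) x) \<partial>ball_uniform)"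
    using m by (subst Bochner_Integration.integral_sum) (auto intro!: integrable_real_indicator simp: less_top[symmetric])
  also have "\<dots> = (\<integral>x. 0 \<partial>(ball_uniform :: 'a measure))"
  proof (rule integral_cong_AE)
    show "AE x in ball_uniform. (\<Sum>K\<in>cone_faces. (-1) ^ dim K * indicator (orth_sum K) x) = (0::real)"
      using AE_generic_line[of w]
    proof (rule eventually_mono)
      fix x assume "generic_line w x"
      then have "real_of_int (euler_count x) = 0" using euler_count_generic[OF w] by simp
      then show "(\<Sum>K\<in>cone_faces. (-1) ^ dim K * indicator (orth_sum K) x) = (0::real)"
        by (simp add: euler_count_def indicator_def of_bool_def if_distrib cong: if_cong)
    qed
  qed (use m in auto)
  finally show ?thesis by simp
qed

end

text \<open>The integral of the almost everywhere vanishing function \<open>euler_count\<close>, with the faces grouped by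
  dimension.\<close>

theorem conic_gauss_bonnet:
  fixes C :: "'a::euclidean_space set"
  assumes C: "polyhedron C" "0 \<in> C" "pos_homogeneous C" and ns: "\<not> subspace C"
  shows "(\<Sum>k\<le>DIM('a). (-1) ^ k * conic_intrinsic_volume k C) = 0"
proof -
  interpret polyhedral_cone C using C by unfold_locales
  let ?v = "\<lambda>K. solid_angle K * solid_angle (normal_cone K C)"
  have fd: "faces_of_dim k C = {K \<in> cone_faces. dim K = k}" for k
  proof -
    have "F \<noteq> {}" if "aff_dim F = int k" for F :: "'a set" using that by auto
    then show ?thesis
      using cone_face_props(9) unfolding faces_of_dim_def cone_faces_def by force
  qed
  have "(\<Sum>k\<le>DIM('a). (-1) ^ k * conic_intrinsic_volume k C)
      = (\<Sum>k\<le>DIM('a). \<Sum>K\<in>{K \<in> cone_faces. dim K = k}. (-1) ^ dim K * ?v K)"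
    by (intro sum.cong refl) (simp add: conic_intrinsic_volume_def fd sum_distrib_left)
  also have "\<dots> = (\<Sum>K\<in>cone_faces. (-1) ^ dim K * ?v K)"
    by (rule sum.group[OF finite_cone_faces]) (auto simp: dim_subset_UNIV)
  also have "\<dots> = 0" by (rule alternating_sum_angles[OF ns])
  finally show ?thesis .
qed

section \<open>Linear images of polyhedra\<close>

definition nonempty_faces :: "'a::euclidean_space set \<Rightarrow> 'a set set"
  where "nonempty_faces P = {F. F face_of P \<and> F \<noteq> {}}"

lemma finite_nonempty_faces: "polyhedron P \<Longrightarrow> finite (nonempty_faces P)"
  unfolding nonempty_faces_def by (rule finite_subset[OF _ finite_polyhedron_faces]) auto

lemma nonempty_facesD:
  assumes "F \<in> nonempty_faces P"
  shows "F face_of P" "F \<noteq> {}" "F \<subseteq> P" "convex F"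
  using assms by (auto simp: nonempty_faces_def dest: face_of_imp_subset face_of_imp_convex)

lemma faces_of_dim_eq: "faces_of_dim k P = {F \<in> nonempty_faces P. aff_dim F = int k}"
proof -
  have "F \<noteq> {}" if "aff_dim F = int k" for F :: "'a set" using that by auto
  then show ?thesis unfolding faces_of_dim_def nonempty_faces_def by blast
qed

lemma closed_linear_image_inj_on:
  fixes A :: "'a::euclidean_space \<Rightarrow> 'b::euclidean_space"
  assumes A: "linear A" and V: "subspace V" "inj_on A V" and S: "closed S" "S \<subseteq> V"
  shows "closed (A ` S)"
proof -
  obtain g where g: "range g \<subseteq> V" "linear g" "\<forall>v\<in>V. g (A v) = v"
    using linear_exists_left_inverse_on[OF A V] by blast
  have "A ` S = A ` V \<inter> g -` S" using g(3) S(2) by (auto simp: subset_iff)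
  moreover have "closed (A ` V)" by (rule closed_subspace[OF linear_subspace_image[OF A V(1)]])
  moreover have "closed (g -` S)" by (rule closed_vimage[OF S(1) continuous_on_linear[OF g(2)]])
  ultimately show ?thesis by (simp add: closed_Int)
qed

text \<open>Every point of the image is the image of a point \<open>p\<close> of minimal norm. If \<open>F\<close> is the face with \<open>p\<close> in its relative
  interior, then \<open>p\<close> is orthogonal to all directions of \<open>F\<close> that \<open>A\<close> annihilates. So the image is the finite
  union of the images of the closed sets \<open>E F\<close> of such points, and on \<open>E F\<close> the map is injective up to translation.\<close>

lemma closed_polyhedron_linear_image:
  fixes A :: "'a::euclidean_space \<Rightarrow> 'b::euclidean_space"
  assumes A: "linear A" and P: "polyhedron P"
  shows "closed (A ` P)"
proof -
  note cP = polyhedron_imp_convex[OF P] and clP = polyhedron_imp_closed[OF P]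
  define E where "E F = {p \<in> F. \<forall>v. A v = 0 \<longrightarrow> v \<in> direction_space F \<longrightarrow> p \<bullet> v = 0}" for F
  have ex: "\<exists>F\<in>nonempty_faces P. y \<in> A ` E F" if y: "y \<in> A ` P" for y
  proof -
    define S where "S = P \<inter> A -` {y}"
    have S: "closed S" "convex S" "S \<noteq> {}"
      unfolding S_def using y
      by (auto intro!: closed_Int clP closed_vimage continuous_on_linear[OF A] convex_Int cP convex_linear_vimage[OF A])
    obtain p where p: "p \<in> S" "\<And>z. z \<in> S \<Longrightarrow> dist 0 p \<le> dist 0 z"
      using distance_attains_inf[OF S(1,3), of 0] by blast
    obtain F where F: "F face_of P" "p \<in> rel_interior F"
      using polyhedron_face_rel_interior_exists[OF P] p(1) by (auto simp: S_def)
    have pF: "p \<in> F" using F(2) rel_interior_subset by blast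
    have ge: "p \<bullet> v \<ge> 0" if v: "A v = 0" "v \<in> direction_space F" for v
    proof -
      have "p + (- v) \<in> affine hull F"
        using subspace_neg[OF subspace_direction_space v(2)] by (auto simp: affine_hull_direction_space[OF pF])
      then obtain t where t: "t > 1" "(1 - t) *\<^sub>R (p + - v) + t *\<^sub>R p \<in> F"
        using convex_rel_interior_if2[OF face_of_imp_convex[OF F(1)] F(2)] by blast
      have "(1 - t) *\<^sub>R (p + - v) + t *\<^sub>R p = p + (t - 1) *\<^sub>R v" by (simp add: algebra_simps)
      then have "p + (t - 1) *\<^sub>R v \<in> P" using t(2) face_of_imp_subset[OF F(1)] by auto
      moreover have "A (p + (t - 1) *\<^sub>R v) = y"
        using p(1) v(1) by (simp add: linear_add[OF A] linear_scale[OF A] S_def)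
      ultimately have "p + (t - 1) *\<^sub>R v \<in> S" by (simp add: S_def)
      then have "(0 - p) \<bullet> ((p + (t - 1) *\<^sub>R v) - p) \<le> 0"
        using any_closest_point_dot[OF S(2,1) p(1), of _ 0] p(2) by blast
      then show ?thesis using t(1) by (simp add: zero_le_mult_iff)
    qed
    have "p \<bullet> v = 0" if v: "A v = 0" "v \<in> direction_space F" for v
      using ge[OF v] ge[of "- v"] v linear_neg[OF A] subspace_neg[OF subspace_direction_space v(2)] by simp
    then have "p \<in> E F" using pF by (simp add: E_def)
    moreover have "y = A p" using p(1) by (simp add: S_def)
    ultimately show ?thesis using F(1) pF by (auto simp: nonempty_faces_def)
  qed
  have sub: "E F \<subseteq> P" if "F \<in> nonempty_faces P" for F
    using that by (auto simp: E_def nonempty_faces_def dest: face_of_imp_subset)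
  have eq: "A ` P = (\<Union>F\<in>nonempty_faces P. A ` E F)"
  proof
    show "A ` P \<subseteq> (\<Union>F\<in>nonempty_faces P. A ` E F)" using ex by (intro subsetI) (simp only: UN_iff)
    show "(\<Union>F\<in>nonempty_faces P. A ` E F) \<subseteq> A ` P" by (intro UN_least image_mono sub)
  qed
  have "closed (A ` E F)" if F: "F \<in> nonempty_faces P" for F
  proof (cases "E F = {}")
    case False
    then obtain e where e: "e \<in> E F" by blast
    define V where "V = direction_space F \<inter> {u. \<forall>v. A v = 0 \<longrightarrow> v \<in> direction_space F \<longrightarrow> u \<bullet> v = 0}"
    have sV: "subspace V"
      unfolding V_def by (rule subspace_inter[OF subspace_direction_space]) (auto simp: subspace_def inner_left_distrib)
    have clF: "closed F"
      using face_of_polyhedron_polyhedron[OF P] F polyhedron_imp_closed by (auto simp: nonempty_faces_def)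
    have "E F = F \<inter> (\<Inter>v\<in>{v. A v = 0 \<and> v \<in> direction_space F}. {p. v \<bullet> p = 0})"
      by (auto simp: E_def inner_commute)
    then have clE: "closed (E F)"
      using clF by (auto intro!: closed_Int closed_INT closed_hyperplane)
    have inj: "inj_on A V"
    proof (rule linear_inj_on_iff_eq_0[OF A sV, THEN iffD2], intro ballI impI)
      fix v assume v: "v \<in> V" "A v = 0"
      then have "v \<bullet> v = 0" unfolding V_def by blast
      then show "v = 0" by simp
    qed
    define S where "S = (\<lambda>x. - e + x) ` E F"
    have "closed S" unfolding S_def by (rule closed_translation[OF clE])
    moreover have "S \<subseteq> V"
    proof
      fix s assume "s \<in> S"
      then obtain x where x: "x \<in> E F" "s = x - e" by (auto simp: S_def)
      then have "s \<in> direction_space F" using e by (auto simp: E_def intro: diff_in_direction_space)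
      then show "s \<in> V" using x e by (auto simp: V_def E_def inner_diff_left)
    qed
    ultimately have "closed (A ` S)" by (rule closed_linear_image_inj_on[OF A sV inj])
    then have "closed ((\<lambda>x. A e + x) ` A ` S)" by (rule closed_translation)
    moreover have "(\<lambda>x. A e + x) ` A ` S = A ` E F"
      by (simp add: S_def image_image linear_diff[OF A])
    ultimately show ?thesis by simp
  qed simp
  then show ?thesis unfolding eq using finite_nonempty_faces[OF P] by (intro closed_UN) auto
qed

lemma face_of_linear_preimage:
  assumes A: "linear A" and F: "F face_of A ` P" and P: "convex P"
  shows "{p \<in> P. A p \<in> F} face_of P"
  unfolding face_of_def
proof (intro conjI ballI impI)
  have "{p \<in> P. A p \<in> F} = P \<inter> A -` F" by auto
  then show "convex {p \<in> P. A p \<in> F}"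
    using P convex_linear_vimage[OF A face_of_imp_convex[OF F]] by (simp add: convex_Int)
  fix a b x assume ab: "a \<in> P" "b \<in> P" and x: "x \<in> {p \<in> P. A p \<in> F}" "x \<in> open_segment a b"
  obtain u where u: "0 < u" "u < 1" "x = (1 - u) *\<^sub>R a + u *\<^sub>R b"
    using x(2) by (auto simp: in_segment)
  have Ax: "A x = (1 - u) *\<^sub>R A a + u *\<^sub>R A b"
    by (simp add: u(3) linear_add[OF A] linear_scale[OF A])
  have "A a \<in> F \<and> A b \<in> F"
  proof (cases "A a = A b")
    case True
    then have "A x = A a" using Ax by (simp flip: scaleR_add_left)
    then show ?thesis using x(1) True by auto
  next
    case False
    then have "A x \<in> open_segment (A a) (A b)" using Ax u by (auto simp: in_segment)
    then show ?thesis using face_ofD[OF F] ab x(1) by blast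
  qed
  then show "a \<in> {p \<in> P. A p \<in> F}" "b \<in> {p \<in> P. A p \<in> F}" using ab by auto
qed auto

text \<open>A closed convex set with finitely many faces is a polyhedron, and the faces of the image are determined by their
  preimages, which are faces.\<close>

lemma polyhedron_linear_image:
  fixes A :: "'a::euclidean_space \<Rightarrow> 'b::euclidean_space"
  assumes A: "linear A" and P: "polyhedron P"
  shows "polyhedron (A ` P)"
  unfolding polyhedron_eq_finite_faces
proof (intro conjI)
  note cP = polyhedron_imp_convex[OF P]
  show "convex (A ` P)" by (rule convex_linear_image[OF A cP])
  show "closed (A ` P)" by (rule closed_polyhedron_linear_image[OF A P])
  show "finite {F. F face_of A ` P}"
  proof (rule inj_on_finite[OF _ _ finite_polyhedron_faces[OF P]])
    show "inj_on (\<lambda>F. {p \<in> P. A p \<in> F}) {F. F face_of A ` P}"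
    proof (rule inj_onI)
      fix F G assume FG: "F \<in> {F. F face_of A ` P}" "G \<in> {F. F face_of A ` P}"
        and eq: "{p \<in> P. A p \<in> F} = {p \<in> P. A p \<in> G}"
      have "F = A ` {p \<in> P. A p \<in> F}" "G = A ` {p \<in> P. A p \<in> G}"
        using FG by (auto dest!: face_of_imp_subset)
      then show "F = G" using eq by simp
    qed
    show "(\<lambda>F. {p \<in> P. A p \<in> F}) ` {F. F face_of A ` P} \<subseteq> {F. F face_of P}"
      using face_of_linear_preimage[OF A _ cP] by auto
  qed
qed

lemma exposing_functionals_face_of:
  assumes P: "convex P" and w: "w \<in> exposing_functionals F P"
  shows "F face_of P"
proof (cases "F = {}")
  case True then show ?thesis by (simp add: empty_face_of)
next
  case False
  have F: "F = {h \<in> P. \<forall>q\<in>P. w \<bullet> q \<le> w \<bullet> h}" using w by (simp add: exposing_functionals_def)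
  obtain f where f: "f \<in> F" using False by blast
  have le: "w \<bullet> x \<le> w \<bullet> f" if "x \<in> P" for x using f that F by blast
  have "F = P \<inter> {x. w \<bullet> x = w \<bullet> f}"
  proof (intro equalityI subsetI)
    fix h assume h: "h \<in> F"
    then have "h \<in> P" "w \<bullet> f \<le> w \<bullet> h" using F f by blast+
    then show "h \<in> P \<inter> {x. w \<bullet> x = w \<bullet> f}" using le[of h] by auto
  next
    fix h assume "h \<in> P \<inter> {x. w \<bullet> x = w \<bullet> f}"
    then show "h \<in> F" using le by (subst F) auto
  qed
  then show ?thesis using face_of_Int_supporting_hyperplane_le[OF P le] by metis
qed

lemma exposing_functional_exists:
  assumes P: "polyhedron P" and F: "F face_of P" "F \<noteq> {}"
  shows "\<exists>w. w \<in> exposing_functionals F P"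
proof -
  have "F exposed_face_of P" using exposed_face_of_polyhedron[OF P] F by blast
  then obtain a b where ab: "P \<subseteq> {x. a \<bullet> x \<le> b}" "F = P \<inter> {x. a \<bullet> x = b}"
    unfolding exposed_face_of_def by blast
  obtain f where f: "f \<in> F" using F(2) by blast
  have "F = {h \<in> P. \<forall>q\<in>P. a \<bullet> q \<le> a \<bullet> h}"
  proof (intro equalityI subsetI)
    fix h assume "h \<in> F" then show "h \<in> {h \<in> P. \<forall>q\<in>P. a \<bullet> q \<le> a \<bullet> h}" using ab by auto
  next
    fix h assume h: "h \<in> {h \<in> P. \<forall>q\<in>P. a \<bullet> q \<le> a \<bullet> h}"
    then have "a \<bullet> f \<le> a \<bullet> h" using f ab(2) by blast
    moreover have "a \<bullet> h \<le> b" "a \<bullet> f = b" using h f ab by auto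
    ultimately show "h \<in> F" using h ab(2) by auto
  qed
  then show ?thesis by (auto simp: exposing_functionals_def)
qed

text \<open>The maximisers of \<open>A\<^sup>T w\<close> over \<open>P\<close> are the preimages of the maximisers of \<open>w\<close> over \<open>A P\<close>.\<close>

lemma exposing_functionals_linear_image:
  fixes A :: "'a::euclidean_space \<Rightarrow> 'b::euclidean_space"
  assumes A: "linear A" and FP: "F \<subseteq> P"
  shows "adjoint A w \<in> exposing_functionals F P \<longleftrightarrow>
    w \<in> exposing_functionals (A ` F) (A ` P) \<and> F = {p \<in> P. A p \<in> A ` F}"
proof -
  have adj: "adjoint A w \<bullet> x = w \<bullet> A x" for x
    using adjoint_works[OF A, of x w] by (simp add: inner_commute)
  show ?thesis
  proof
    assume "adjoint A w \<in> exposing_functionals F P"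
    then have F: "F = {h \<in> P. \<forall>q\<in>P. w \<bullet> A q \<le> w \<bullet> A h}"
      by (simp add: exposing_functionals_def adj)
    have "A ` F = {y \<in> A ` P. \<forall>q\<in>A ` P. w \<bullet> q \<le> w \<bullet> y}" by (subst F) auto
    moreover have "p \<in> F" if "p \<in> P" "A p \<in> A ` F" for p
    proof -
      from that(2) obtain f where "f \<in> F" "A p = A f" by blast
      then show ?thesis using that(1) F by force
    qed
    then have "F = {p \<in> P. A p \<in> A ` F}" using FP by blast
    ultimately show "w \<in> exposing_functionals (A ` F) (A ` P) \<and> F = {p \<in> P. A p \<in> A ` F}"
      by (simp add: exposing_functionals_def)
  next
    assume a: "w \<in> exposing_functionals (A ` F) (A ` P) \<and> F = {p \<in> P. A p \<in> A ` F}"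
    then have AF: "A ` F = {y \<in> A ` P. \<forall>q\<in>A ` P. w \<bullet> q \<le> w \<bullet> y}"
      by (simp add: exposing_functionals_def)
    have "A p \<in> A ` F \<longleftrightarrow> (\<forall>q\<in>P. w \<bullet> A q \<le> w \<bullet> A p)" if "p \<in> P" for p
      using that by (subst AF) auto
    then have "F = {h \<in> P. \<forall>q\<in>P. w \<bullet> A q \<le> w \<bullet> A h}" using a by blast
    then show "adjoint A w \<in> exposing_functionals F P"
      by (simp add: exposing_functionals_def adj)
  qed
qed

text \<open>The faces of \<open>P\<close> that are full preimages of faces of the image; since all faces of the
  image are exposed, this can be said with functionals, which is the form in which it is a Borel condition on
  \<open>A\<close>.\<close>

definition surviving :: "('a::euclidean_space \<Rightarrow> 'b::euclidean_space) \<Rightarrow> 'a set \<Rightarrow> 'a set \<Rightarrow> bool"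
  where "surviving A F P \<longleftrightarrow> (\<exists>w. adjoint A w \<in> exposing_functionals F P)"

lemma surviving_image:
  fixes A :: "'a::euclidean_space \<Rightarrow> 'b::euclidean_space"
  assumes A: "linear A" and P: "convex P" and F: "F \<in> nonempty_faces P" "surviving A F P"
  shows "A ` F \<in> nonempty_faces (A ` P)" "F = {p \<in> P. A p \<in> A ` F}"
proof -
  obtain w where "adjoint A w \<in> exposing_functionals F P" using F(2) by (auto simp: surviving_def)
  then have w: "w \<in> exposing_functionals (A ` F) (A ` P)" "F = {p \<in> P. A p \<in> A ` F}"
    using exposing_functionals_linear_image[OF A nonempty_facesD(3)[OF F(1)]] by blast+
  show "A ` F \<in> nonempty_faces (A ` P)"
    using exposing_functionals_face_of[OF convex_linear_image[OF A P] w(1)] nonempty_facesD(2)[OF F(1)]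
    by (simp add: nonempty_faces_def)
  show "F = {p \<in> P. A p \<in> A ` F}" by (fact w(2))
qed

text \<open>Every nonempty face of the image is reached because it is exposed by some functional \<open>w\<close>; then \<open>A\<^sup>T w\<close> exposes its
  preimage.\<close>

lemma bij_betw_surviving_faces:
  fixes A :: "'a::euclidean_space \<Rightarrow> 'b::euclidean_space"
  assumes A: "linear A" and P: "polyhedron P"
  shows "bij_betw (image A) {F \<in> nonempty_faces P. surviving A F P \<and> R (A ` F)} {F \<in> nonempty_faces (A ` P). R F}"
proof (rule bij_betwI')
  have cP: "convex P" by (rule polyhedron_imp_convex[OF P])
  note si = surviving_image[OF A cP]
  show "(A ` F = A ` F') = (F = F')"
    if "F \<in> {F \<in> nonempty_faces P. surviving A F P \<and> R (A ` F)}" "F' \<in> {F \<in> nonempty_faces P. surviving A F P \<and> R (A ` F)}" for F F'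
    using that si(2)[of F] si(2)[of F'] by auto
  show "A ` F \<in> {F \<in> nonempty_faces (A ` P). R F}"
    if "F \<in> {F \<in> nonempty_faces P. surviving A F P \<and> R (A ` F)}" for F
    using that si(1)[of F] by auto
  show "\<exists>F\<in>{F \<in> nonempty_faces P. surviving A F P \<and> R (A ` F)}. K = A ` F"
    if K: "K \<in> {F \<in> nonempty_faces (A ` P). R F}" for K
  proof -
    have KQ: "K face_of A ` P" "K \<noteq> {}" using K by (auto simp: nonempty_faces_def)
    obtain w where w: "w \<in> exposing_functionals K (A ` P)"
      using exposing_functional_exists[OF polyhedron_linear_image[OF A P] KQ] by blast
    define F where "F = {p \<in> P. A p \<in> K}"
    have KF: "K = A ` F" using face_of_imp_subset[OF KQ(1)] by (auto simp: F_def)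
    have FP: "F \<subseteq> P" by (auto simp: F_def)
    have "w \<in> exposing_functionals (A ` F) (A ` P) \<and> F = {p \<in> P. A p \<in> A ` F}"
      unfolding KF[symmetric] using w F_def by (intro conjI)
    then have "adjoint A w \<in> exposing_functionals F P"
      by (rule exposing_functionals_linear_image[OF A FP, THEN iffD2])
    then have FF: "surviving A F P" "F face_of P"
      using exposing_functionals_face_of[OF cP] by (auto simp: surviving_def)
    moreover have "F \<noteq> {}" using KQ(2) KF by blast
    moreover have "R (A ` F)" using K KF by simp
    ultimately show ?thesis using KF by (intro bexI[of _ F]) (simp_all add: nonempty_faces_def FF)
  qed
qed

lemma pos_homogeneous_tangent_cone: "pos_homogeneous (tangent_cone F Q)"
  by (simp add: pos_homogeneous_def tangent_cone_scale)

lemma exposing_functionals_properties: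
  fixes Q :: "'a::euclidean_space set"
  assumes Q: "polyhedron Q" and H: "H \<in> nonempty_faces Q"
  shows "exposing_functionals H Q \<in> sets borel" "pos_homogeneous (exposing_functionals H Q)"
    "exposing_functionals H Q \<subseteq> (direction_space H)\<^sup>\<bottom>"
    "solid_angle (normal_cone H Q) = cone_angle ((direction_space H)\<^sup>\<bottom>) (exposing_functionals H Q)"
proof -
  note cQ = polyhedron_imp_convex[OF Q]
  note H' = nonempty_facesD(1,2)[OF H]
  note nc = closed_convex_cone_normal_cone[OF cQ H']
  have hom: "pos_homogeneous (normal_cone H Q)" using nc(4) by (simp add: pos_homogeneous_def)
  note ri = rel_interior_normal_cone[OF Q H']
  note sp = span_normal_cone[OF Q H']
  show "exposing_functionals H Q \<in> sets borel" using rel_interior_in_borel[of "normal_cone H Q"] by (simp add: ri)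
  show "pos_homogeneous (exposing_functionals H Q)"
    using rel_interior_pos_homogeneous[OF nc(2) hom] by (simp add: ri)
  have NL: "normal_cone H Q \<subseteq> (direction_space H)\<^sup>\<bottom>" using span_superset[of "normal_cone H Q"] by (simp add: sp)
  then show "exposing_functionals H Q \<subseteq> (direction_space H)\<^sup>\<bottom>"
    using rel_interior_subset[of "normal_cone H Q"] by (simp add: ri)
  have "solid_angle (normal_cone H Q) = cone_angle ((direction_space H)\<^sup>\<bottom>) (normal_cone H Q)"
    using solid_angle_eq_cone_angle[OF nc(3)] by (simp add: sp)
  also have "\<dots> = cone_angle ((direction_space H)\<^sup>\<bottom>) (exposing_functionals H Q)"
    using cone_angle_rel_interior[OF nc(1,2) hom NL subspace_orthogonal_comp] by (simp add: ri)
  finally show "solid_angle (normal_cone H Q) = cone_angle ((direction_space H)\<^sup>\<bottom>) (exposing_functionals H Q)" .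
qed

lemma tangent_cone_properties:
  fixes Q :: "'a::euclidean_space set"
  assumes Q: "polyhedron Q" and F: "F \<in> nonempty_faces Q" and H: "H \<in> nonempty_faces Q" and FH: "F \<subseteq> H"
  shows "closed (tangent_cone F H)" "tangent_cone F H \<subseteq> direction_space H"
    "solid_angle (tangent_cone F H) = cone_angle (direction_space H) (tangent_cone F H)"
proof -
  have H': "polyhedron H" "convex H" using face_of_polyhedron_polyhedron[OF Q nonempty_facesD(1)[OF H]] nonempty_facesD(4)[OF H] by auto
  have F': "F face_of H" by (rule face_of_subset[OF nonempty_facesD(1)[OF F] FH nonempty_facesD(3)[OF H]])
  note ne = nonempty_facesD(2)[OF F]
  show "closed (tangent_cone F H)" by (rule polyhedron_imp_closed[OF polyhedron_tangent_cone[OF H'(1) F' ne]])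
  have sp: "span (tangent_cone F H) = direction_space H" by (rule span_tangent_cone[OF H'(2) F' ne])
  show "tangent_cone F H \<subseteq> direction_space H" using span_superset[of "tangent_cone F H"] by (simp add: sp)
  show "solid_angle (tangent_cone F H) = cone_angle (direction_space H) (tangent_cone F H)"
    using solid_angle_eq_cone_angle[OF zero_in_tangent_cone[OF F' ne]] by (simp add: sp)
qed

text \<open>The spans of the two cones are orthogonal complements, so the summands are the two orthogonal
  projections of \<open>y\<close>.\<close>

lemma solid_angle_product:
  fixes Q :: "'a::euclidean_space set"
  assumes Q: "polyhedron Q" and F: "F \<in> nonempty_faces Q" and H: "H \<in> nonempty_faces Q" and FH: "F \<subseteq> H"
  shows "solid_angle (tangent_cone F H) * solid_angle (normal_cone H Q) =
    measure ball_uniform {y. \<exists>x\<in>tangent_cone F H. y - x \<in> exposing_functionals H Q}"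
proof -
  let ?L = "direction_space H"
  note t = tangent_cone_properties[OF Q F H FH]
  note e = exposing_functionals_properties[OF Q H]
  have "measure ball_uniform {x. orth_proj ?L x \<in> tangent_cone F H \<and> x - orth_proj ?L x \<in> exposing_functionals H Q}
    = cone_angle ?L (tangent_cone F H) * cone_angle (?L\<^sup>\<bottom>) (exposing_functionals H Q)"
    by (rule ball_uniform_proj_in_cones[OF subspace_direction_space borel_closed[OF t(1)] pos_homogeneous_tangent_cone e(1,2)])
  also have "{x. orth_proj ?L x \<in> tangent_cone F H \<and> x - orth_proj ?L x \<in> exposing_functionals H Q}
      = {y. \<exists>x\<in>tangent_cone F H. y - x \<in> exposing_functionals H Q}"
  proof (intro set_eqI iffI)
    fix y assume "y \<in> {y. \<exists>x\<in>tangent_cone F H. y - x \<in> exposing_functionals H Q}"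
    then obtain x where x: "x \<in> tangent_cone F H" "y - x \<in> exposing_functionals H Q" by blast
    have "orth_proj ?L y = x"
      by (rule orth_proj_unique) (use x t(2) e(3) in auto)
    then show "y \<in> {x. orth_proj ?L x \<in> tangent_cone F H \<and> x - orth_proj ?L x \<in> exposing_functionals H Q}"
      using x by simp
  qed blast
  finally show ?thesis by (simp add: t(3) e(4))
qed

lemma tangent_cone_linear_image:
  fixes A :: "'a::euclidean_space \<Rightarrow> 'b::euclidean_space"
  assumes A: "linear A" and F: "convex F"
  shows "tangent_cone (A ` F) (A ` H) = A ` tangent_cone F H"
proof (intro equalityI subsetI)
  note ri = rel_interior_convex_linear_image[OF A F, symmetric]
  fix v assume "v \<in> tangent_cone (A ` F) (A ` H)"
  then obtain f e h where f: "f \<in> rel_interior F" "e > 0" "h \<in> H" "A f + e *\<^sub>R v = A h"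
    unfolding tangent_cone_def ri by auto
  define x where "x = (1 / e) *\<^sub>R (h - f)"
  have "x \<in> tangent_cone F H"
    unfolding x_def using f by (intro tangent_cone_scale diff_in_tangent_cone) auto
  moreover have "A x = v"
    using f(2,4) by (simp add: x_def linear_scale[OF A] linear_diff[OF A] flip: f(4))
  ultimately show "v \<in> A ` tangent_cone F H" by blast
next
  note ri = rel_interior_convex_linear_image[OF A F, symmetric]
  fix v assume "v \<in> A ` tangent_cone F H"
  then obtain x f e where x: "v = A x" "f \<in> rel_interior F" "e > 0" "f + e *\<^sub>R x \<in> H"
    unfolding tangent_cone_def by auto
  have "A f + e *\<^sub>R v = A (f + e *\<^sub>R x)" by (simp add: x(1) linear_add[OF A] linear_scale[OF A])
  then show "v \<in> tangent_cone (A ` F) (A ` H)"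
    unfolding tangent_cone_def ri using x by blast
qed

text \<open>The contribution of the images of \<open>F\<close> and \<open>H\<close>, written with data of \<open>P\<close>. It vanishes by itself when \<open>H\<close> does
  not survive.\<close>

definition projected_angle :: "('a::euclidean_space \<Rightarrow> 'b::euclidean_space) \<Rightarrow> 'a set \<Rightarrow> 'a set \<Rightarrow> 'a set \<Rightarrow> real"
  where "projected_angle A F H P =
    measure ball_uniform {y. \<exists>x\<in>tangent_cone F H. adjoint A (y - A x) \<in> exposing_functionals H P}"

lemma projected_angle_surviving:
  fixes A :: "'a::euclidean_space \<Rightarrow> 'b::euclidean_space"
  assumes A: "linear A" and P: "polyhedron P" and F: "F \<in> nonempty_faces P" "surviving A F P"
    and H: "H \<in> nonempty_faces P" "surviving A H P" and FH: "F \<subseteq> H"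
  shows "solid_angle (tangent_cone (A ` F) (A ` H)) * solid_angle (normal_cone (A ` H) (A ` P)) = projected_angle A F H P"
proof -
  note cP = polyhedron_imp_convex[OF P]
  note HP = nonempty_facesD(3)[OF H(1)]
  note Hs = surviving_image(2)[OF A cP H]
  have "solid_angle (tangent_cone (A ` F) (A ` H)) * solid_angle (normal_cone (A ` H) (A ` P)) =
    measure ball_uniform {y. \<exists>x\<in>tangent_cone (A ` F) (A ` H). y - x \<in> exposing_functionals (A ` H) (A ` P)}"
    by (rule solid_angle_product[OF polyhedron_linear_image[OF A P]])
       (use surviving_image(1)[OF A cP] F H FH in auto)
  also have "\<dots> = projected_angle A F H P"
    unfolding projected_angle_def tangent_cone_linear_image[OF A nonempty_facesD(4)[OF F(1)]]
    using exposing_functionals_linear_image[OF A HP] Hs by auto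
  finally show ?thesis .
qed

lemma projected_angle_not_surviving: "\<not> surviving A H P \<Longrightarrow> projected_angle A F H P = 0"
  by (simp add: projected_angle_def surviving_def)

lemma sum_filter_of_bool:
  fixes g :: "'a \<Rightarrow> real"
  shows "finite S \<Longrightarrow> (\<Sum>x\<in>{x \<in> S. Q x}. g x) = (\<Sum>x\<in>S. of_bool (Q x) * g x)"
  by (subst sum.inter_filter) (auto intro!: sum.cong simp: of_bool_def)

text \<open>The index set on the right does not depend on \<open>A\<close>, so measurability in \<open>A\<close> can be checked term by term. The
  dimensions are those of the images, because \<open>A\<close> may be degenerate.\<close>

theorem sum_conic_intrinsic_volume_linear_image:
  fixes A :: "'a::euclidean_space \<Rightarrow> 'b::euclidean_space"
  assumes A: "linear A" and P: "polyhedron P"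
  shows "(\<Sum>F\<in>faces_of_dim j (A ` P). conic_intrinsic_volume k (tangent_cone F (A ` P))) =
    (\<Sum>F\<in>nonempty_faces P. \<Sum>H\<in>{H \<in> nonempty_faces P. F \<subseteq> H}.
       of_bool (surviving A F P \<and> aff_dim (A ` F) = int j \<and> aff_dim (A ` H) = int k) * projected_angle A F H P)"
proof -
  let ?Q = "A ` P"
  note cP = polyhedron_imp_convex[OF P]
  note fin = finite_nonempty_faces[OF P]
  let ?g = "\<lambda>F H. solid_angle (tangent_cone F H) * solid_angle (normal_cone H ?Q)"
  have inner: "(\<Sum>H\<in>{H \<in> faces_of_dim k ?Q. A ` F \<subseteq> H}. ?g (A ` F) H) =
      (\<Sum>H\<in>{H \<in> nonempty_faces P. F \<subseteq> H}. of_bool (aff_dim (A ` H) = int k) * projected_angle A F H P)"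
    if F: "F \<in> nonempty_faces P" "surviving A F P" for F
  proof -
    have "{H \<in> faces_of_dim k ?Q. A ` F \<subseteq> H} = {H \<in> nonempty_faces ?Q. aff_dim H = int k \<and> A ` F \<subseteq> H}"
      by (auto simp: faces_of_dim_eq)
    then have "(\<Sum>H\<in>{H \<in> faces_of_dim k ?Q. A ` F \<subseteq> H}. ?g (A ` F) H) =
        (\<Sum>H\<in>{H \<in> nonempty_faces P. surviving A H P \<and> aff_dim (A ` H) = int k \<and> A ` F \<subseteq> A ` H}. ?g (A ` F) (A ` H))"
      using sum.reindex_bij_betw[OF bij_betw_surviving_faces[OF A P, of "\<lambda>H. aff_dim H = int k \<and> A ` F \<subseteq> H"], of "?g (A ` F)"]
      by simp
    also have "{H \<in> nonempty_faces P. surviving A H P \<and> aff_dim (A ` H) = int k \<and> A ` F \<subseteq> A ` H} =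
        {H \<in> {H \<in> nonempty_faces P. F \<subseteq> H}. surviving A H P \<and> aff_dim (A ` H) = int k}"
      using surviving_image(2)[OF A cP] nonempty_facesD(3)[OF F(1)] by blast
    also have "(\<Sum>H\<in>\<dots>. ?g (A ` F) (A ` H)) = (\<Sum>H\<in>\<dots>. projected_angle A F H P)"
      by (intro sum.cong refl projected_angle_surviving[OF A P F]) auto
    also have "\<dots> = (\<Sum>H\<in>{H \<in> nonempty_faces P. F \<subseteq> H}. of_bool (surviving A H P \<and> aff_dim (A ` H) = int k) * projected_angle A F H P)"
      using fin by (intro sum_filter_of_bool) auto
    also have "\<dots> = (\<Sum>H\<in>{H \<in> nonempty_faces P. F \<subseteq> H}. of_bool (aff_dim (A ` H) = int k) * projected_angle A F H P)"
      by (intro sum.cong refl) (auto simp: projected_angle_not_surviving)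
    finally show ?thesis .
  qed
  have "(\<Sum>F\<in>faces_of_dim j ?Q. conic_intrinsic_volume k (tangent_cone F ?Q)) =
     (\<Sum>F\<in>faces_of_dim j ?Q. \<Sum>H\<in>{H \<in> faces_of_dim k ?Q. F \<subseteq> H}. ?g F H)"
    by (rule sum_conic_intrinsic_volume_tangent_cones[OF convex_linear_image[OF A cP]])
  also have "\<dots> = (\<Sum>F\<in>{F \<in> nonempty_faces P. surviving A F P \<and> aff_dim (A ` F) = int j}.
      \<Sum>H\<in>{H \<in> faces_of_dim k ?Q. A ` F \<subseteq> H}. ?g (A ` F) H)"
    unfolding faces_of_dim_eq[of j]
    by (rule sum.reindex_bij_betw[OF bij_betw_surviving_faces[OF A P], symmetric])
  also have "\<dots> = (\<Sum>F\<in>{F \<in> nonempty_faces P. surviving A F P \<and> aff_dim (A ` F) = int j}.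
      \<Sum>H\<in>{H \<in> nonempty_faces P. F \<subseteq> H}. of_bool (aff_dim (A ` H) = int k) * projected_angle A F H P)"
    by (intro sum.cong refl inner) auto
  also have "\<dots> = (\<Sum>F\<in>nonempty_faces P. of_bool (surviving A F P \<and> aff_dim (A ` F) = int j) *
      (\<Sum>H\<in>{H \<in> nonempty_faces P. F \<subseteq> H}. of_bool (aff_dim (A ` H) = int k) * projected_angle A F H P))"
    by (rule sum_filter_of_bool[OF fin])
  also have "\<dots> = (\<Sum>F\<in>nonempty_faces P. \<Sum>H\<in>{H \<in> nonempty_faces P. F \<subseteq> H}.
       of_bool (surviving A F P \<and> aff_dim (A ` F) = int j \<and> aff_dim (A ` H) = int k) * projected_angle A F H P)"
    by (intro sum.cong refl) (auto simp: sum_distrib_left intro!: sum.cong)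
  finally show ?thesis .
qed

lemma sum_conic_intrinsic_volume_pairs:
  fixes P :: "'a::euclidean_space set"
  assumes P: "polyhedron P"
  shows "(\<Sum>F\<in>faces_of_dim j P. conic_intrinsic_volume k (tangent_cone F P)) =
    (\<Sum>F\<in>nonempty_faces P. \<Sum>H\<in>{H \<in> nonempty_faces P. F \<subseteq> H}.
       of_bool (aff_dim F = int j \<and> aff_dim H = int k) * (solid_angle (tangent_cone F H) * solid_angle (normal_cone H P)))"
proof -
  note fin = finite_nonempty_faces[OF P]
  let ?g = "\<lambda>F H. solid_angle (tangent_cone F H) * solid_angle (normal_cone H P)"
  have "(\<Sum>F\<in>faces_of_dim j P. conic_intrinsic_volume k (tangent_cone F P)) =
     (\<Sum>F\<in>faces_of_dim j P. \<Sum>H\<in>{H \<in> {H \<in> nonempty_faces P. F \<subseteq> H}. aff_dim H = int k}. ?g F H)"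
    unfolding sum_conic_intrinsic_volume_tangent_cones[OF polyhedron_imp_convex[OF P]]
    by (intro sum.cong refl) (auto simp: faces_of_dim_eq)
  also have "\<dots> = (\<Sum>F\<in>faces_of_dim j P. \<Sum>H\<in>{H \<in> nonempty_faces P. F \<subseteq> H}. of_bool (aff_dim H = int k) * ?g F H)"
    using fin by (intro sum.cong refl sum_filter_of_bool) auto
  also have "\<dots> = (\<Sum>F\<in>nonempty_faces P. of_bool (aff_dim F = int j) *
      (\<Sum>H\<in>{H \<in> nonempty_faces P. F \<subseteq> H}. of_bool (aff_dim H = int k) * ?g F H))"
    unfolding faces_of_dim_eq by (rule sum_filter_of_bool[OF fin])
  also have "\<dots> = (\<Sum>F\<in>nonempty_faces P. \<Sum>H\<in>{H \<in> nonempty_faces P. F \<subseteq> H}.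
       of_bool (aff_dim F = int j \<and> aff_dim H = int k) * ?g F H)"
    by (intro sum.cong refl) (auto simp: sum_distrib_left intro!: sum.cong)
  finally show ?thesis .
qed

section \<open>Borel measurability in the matrix\<close>

lemma fsigma_vimage:
  assumes "fsigma S" "continuous_on UNIV f"
  shows "fsigma (f -` S)"
proof -
  obtain F where F: "\<And>n::nat. closed (F n)" "S = (\<Union>n. F n)"
    using assms(1) by (auto simp: fsigma.simps)
  have "fsigma (\<Union>n. f -` F n)" by (intro fsigma.intros closed_vimage F assms(2))
  also have "(\<Union>n. f -` F n) = f -` S" using F(2) by auto
  finally show ?thesis .
qed

lemma closed_imp_fsigma: "closed S \<Longrightarrow> fsigma S"
  using fsigma.intros[of "\<lambda>_. S"] by simp

lemma fsigma_Int_closed: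
  assumes "fsigma S" "closed C"
  shows "fsigma (C \<inter> S)"
proof -
  obtain F where F: "\<And>n::nat. closed (F n)" "S = (\<Union>n. F n)"
    using assms(1) by (auto simp: fsigma.simps)
  have "fsigma (\<Union>n. C \<inter> F n)" by (intro fsigma.intros closed_Int F assms(2))
  also have "(\<Union>n. C \<inter> F n) = C \<inter> S" using F(2) by auto
  finally show ?thesis .
qed

lemma open_imp_fsigma:
  fixes S :: "'a::euclidean_space set"
  assumes "open S"
  shows "fsigma S"
proof -
  obtain D where D: "countable D" "D \<subseteq> Pow S" "\<And>X. X \<in> D \<Longrightarrow> \<exists>a b. X = cbox a b" "\<Union>D = S"
    using open_countable_Union_open_cbox[OF assms] by metis
  show ?thesis
  proof (cases "D = {}")
    case True then show ?thesis using D(4) by (simp add: closed_imp_fsigma)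
  next
    case False
    have "closed (from_nat_into D n)" for n
      using D(3)[OF from_nat_into[OF False, of n]] by auto
    then have "fsigma (\<Union>n. from_nat_into D n)" by (rule fsigma.intros)
    also have "(\<Union>n. from_nat_into D n) = S"
      using range_from_nat_into[OF False D(1)] D(4) by auto
    finally show ?thesis .
  qed
qed

text \<open>In a Euclidean space a countable union of closed sets is one of compact sets, and these are
  preserved by continuous maps. With coordinate projections as maps, this eliminates existential quantifiers over vectors.\<close>

lemma fsigma_continuous_image_borel:
  fixes f :: "'a::euclidean_space \<Rightarrow> 'b::euclidean_space"
  assumes "fsigma S" "continuous_on UNIV f"
  shows "f ` S \<in> sets borel"
proof -
  obtain F :: "nat \<Rightarrow> 'a set" where F: "range F \<subseteq> Collect compact" "S = (\<Union>n. F n)"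
    using assms(1) fsigma_Union_compact[of S] by auto
  have "compact (f ` F n)" for n
    using F(1) assms(2) by (intro compact_continuous_image) (auto intro: continuous_on_subset)
  then have "(\<Union>n. f ` F n) \<in> sets borel"
    by (intro sets.countable_UN) (auto intro: borel_compact)
  moreover have "f ` S = (\<Union>n. f ` F n)" using F(2) by auto
  ultimately show ?thesis by simp
qed

lemma continuous_on_matrix_mult:
  fixes f :: "'a::topological_space \<Rightarrow> real^'n^'m"
  assumes "continuous_on S f" "continuous_on S g"
  shows "continuous_on S (\<lambda>z. f z *v g z)"
  unfolding matrix_vector_mult_def using assms by (intro continuous_intros)

lemma continuous_on_transpose:
  fixes f :: "'a::topological_space \<Rightarrow> real^'n^'m"
  assumes "continuous_on S f"
  shows "continuous_on S (\<lambda>z. transpose (f z))"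
  unfolding transpose_def using assms by (intro continuous_intros)

lemma fsigma_exposing_functionals:
  fixes P :: "'a::euclidean_space set"
  assumes P: "polyhedron P" and H: "H \<in> nonempty_faces P"
  shows "fsigma (exposing_functionals H P)"
proof -
  let ?N = "normal_cone H P"
  have "closed ?N" using closed_convex_cone_normal_cone(1)[OF polyhedron_imp_convex[OF P] nonempty_facesD(1,2)[OF H]] .
  moreover have "fsigma (- rel_frontier ?N)" by (intro open_imp_fsigma) (simp add: open_Compl)
  moreover have "rel_interior ?N = closure ?N \<inter> - rel_frontier ?N"
    using rel_interior_subset_closure[of ?N] by (auto simp: rel_frontier_def)
  ultimately show ?thesis
    using fsigma_Int_closed rel_interior_normal_cone[OF P nonempty_facesD(1,2)[OF H]] by simp
qed

lemma fst_image_eq: "fst ` S = {a. \<exists>b. (a, b) \<in> S}"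
  by force

lemma borel_surviving:
  fixes P :: "(real^'n) set"
  assumes P: "polyhedron P" and H: "H \<in> nonempty_faces P"
  shows "{B :: real^'n^'d. surviving ((*v) B) H P} \<in> sets borel"
proof -
  have "fsigma ((\<lambda>z :: (real^'n^'d) \<times> (real^'d). transpose (fst z) *v snd z) -` exposing_functionals H P)"
    by (intro fsigma_vimage fsigma_exposing_functionals[OF P H] continuous_on_matrix_mult continuous_on_transpose continuous_intros)
  then have "fst ` ((\<lambda>z :: (real^'n^'d) \<times> (real^'d). transpose (fst z) *v snd z) -` exposing_functionals H P) \<in> sets borel"
    by (rule fsigma_continuous_image_borel) (intro continuous_intros)
  also have "fst ` ((\<lambda>z :: (real^'n^'d) \<times> (real^'d). transpose (fst z) *v snd z) -` exposing_functionals H P)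
      = {B. surviving ((*v) B) H P}"
    by (simp add: surviving_def fst_image_eq adjoint_matrix del: transpose_matrix_vector)
  finally show ?thesis .
qed

lemma borel_measurable_projected_angle:
  fixes P :: "(real^'n) set"
  assumes P: "polyhedron P" and F: "F \<in> nonempty_faces P" and H: "H \<in> nonempty_faces P" and FH: "F \<subseteq> H"
  shows "{z :: (real^'n^'d) \<times> (real^'d). \<exists>x\<in>tangent_cone F H. adjoint ((*v) (fst z)) (snd z - fst z *v x) \<in> exposing_functionals H P} \<in> sets borel"
      (is "?Q \<in> _")
    and "(\<lambda>B :: real^'n^'d. projected_angle ((*v) B) F H P) \<in> borel_measurable borel"
proof -
  let ?E = "(\<lambda>z :: ((real^'n^'d) \<times> (real^'d)) \<times> (real^'n).
      transpose (fst (fst z)) *v (snd (fst z) - fst (fst z) *v snd z)) -` exposing_functionals H P"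
  let ?T = "snd -` tangent_cone F H :: (((real^'n^'d) \<times> (real^'d)) \<times> (real^'n)) set"
  have "fsigma ?E"
    by (intro fsigma_vimage fsigma_exposing_functionals[OF P H] continuous_on_matrix_mult continuous_on_transpose continuous_intros)
  moreover have "closed ?T"
    by (intro closed_vimage tangent_cone_properties(1)[OF P F H FH] continuous_intros)
  ultimately have "fsigma (?T \<inter> ?E)" by (rule fsigma_Int_closed)
  then have "fst ` (?T \<inter> ?E) \<in> sets borel"
    by (rule fsigma_continuous_image_borel) (intro continuous_intros)
  also have "fst ` (?T \<inter> ?E) = ?Q"
    by (auto simp: fst_image_eq adjoint_matrix simp del: transpose_matrix_vector)
  finally show Q: "?Q \<in> sets borel" .
  interpret prob_space "ball_uniform :: (real^'d) measure" by (rule prob_space_ball_uniform)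
  have "sets (borel \<Otimes>\<^sub>M (ball_uniform :: (real^'d) measure)) = sets (borel \<Otimes>\<^sub>M borel :: ((real^'n^'d) \<times> (real^'d)) measure)"
    by (intro sets_pair_measure_cong) auto
  then have "?Q \<in> sets (borel \<Otimes>\<^sub>M ball_uniform)" using Q by (simp only: borel_prod)
  then have "(\<lambda>B. emeasure ball_uniform (Pair B -` ?Q)) \<in> borel_measurable borel"
    by (rule measurable_emeasure_Pair)
  then have "(\<lambda>B. enn2real (emeasure ball_uniform (Pair B -` ?Q))) \<in> borel_measurable borel"
    by simp
  then show "(\<lambda>B :: real^'n^'d. projected_angle ((*v) B) F H P) \<in> borel_measurable borel"
    by (simp add: projected_angle_def measure_def vimage_def)
qed

text \<open>A linear map fails to be injective on \<open>W\<close> iff it annihilates a unit vector of \<open>W\<close>.\<close>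

lemma borel_inj_on:
  assumes W: "subspace W"
  shows "{B :: real^'n^'d. inj_on ((*v) B) W} \<in> sets borel"
proof -
  let ?S = "{z :: (real^'n^'d) \<times> (real^'n). snd z \<in> W \<and> norm (snd z) = 1 \<and> fst z *v snd z = 0}"
  have "?S = snd -` W \<inter> (snd -` sphere 0 1 \<inter> (\<lambda>z. fst z *v snd z) -` {0})" by auto
  moreover have "closed (snd -` W \<inter> (snd -` sphere 0 1 \<inter> (\<lambda>z :: (real^'n^'d) \<times> (real^'n). fst z *v snd z) -` {0}))"
    by (intro closed_Int closed_vimage closed_subspace[OF W] closed_sphere closed_singleton continuous_on_matrix_mult continuous_intros)
  ultimately have "closed ?S" by simp
  then have "fst ` ?S \<in> sets borel"
    by (intro fsigma_continuous_image_borel closed_imp_fsigma continuous_intros)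
  moreover have "{B :: real^'n^'d. inj_on ((*v) B) W} = - fst ` ?S"
  proof -
    have "inj_on ((*v) B) W \<longleftrightarrow> B \<notin> fst ` ?S" for B :: "real^'n^'d"
    proof -
      have "inj_on ((*v) B) W \<longleftrightarrow> (\<forall>v\<in>W. B *v v = 0 \<longrightarrow> v = 0)"
        by (rule linear_inj_on_iff_eq_0) (auto simp: W)
      also have "\<dots> \<longleftrightarrow> B \<notin> fst ` ?S"
      proof
        assume "\<forall>v\<in>W. B *v v = 0 \<longrightarrow> v = 0"
        then show "B \<notin> fst ` ?S" by (auto simp: fst_image_eq)
      next
        assume B: "B \<notin> fst ` ?S"
        show "\<forall>v\<in>W. B *v v = 0 \<longrightarrow> v = 0"
        proof (intro ballI impI, rule ccontr)
          fix v assume v: "v \<in> W" "B *v v = 0" "v \<noteq> 0"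
          have "(B, inverse (norm v) *\<^sub>R v) \<in> ?S"
            using v by (simp add: subspace_scale[OF W] matrix_vector_mult_scaleR)
          then show False using B by (auto simp: fst_image_eq)
        qed
      qed
      finally show ?thesis .
    qed
    then show ?thesis by blast
  qed
  ultimately show ?thesis by (simp add: borel_comp)
qed

text \<open>Expresses the rank by injectivity on finitely many subspaces that do not depend on the
  map.\<close>

lemma dim_image_ge_iff:
  fixes f :: "'a::euclidean_space \<Rightarrow> 'b::euclidean_space"
  assumes f: "linear f" and V: "finite V"
  shows "m \<le> dim (f ` span V) \<longleftrightarrow> (\<exists>S\<subseteq>V. dim S = m \<and> inj_on f (span S))"
proof
  assume m: "m \<le> dim (f ` span V)"
  have fsp: "f ` span V = span (f ` V)" by (simp add: linear_span_image[OF f])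
  obtain I where I: "I \<subseteq> f ` V" "independent I" "card I = dim (f ` V)"
    using basis_exists[of "f ` V"] by metis
  have "m \<le> card I" using m I(3) by (simp add: fsp)
  then obtain J where J: "J \<subseteq> I" "card J = m" by (meson obtain_subset_with_card_n)
  have Ji: "independent J" using I(2) J(1) by (rule independent_mono)
  obtain S where S: "S \<subseteq> V" "inj_on f S" "J = f ` S"
    using J(1) I(1) subset_image_inj[of J f V] by auto
  have inj: "inj_on f (span S)"
    using linear_inj_on_span_iff_independent_image[OF f] Ji S by blast
  have "dim S = dim (f ` span S)"
    using dim_image_eq[OF f, of S] inj by (simp flip: linear_span_image[OF f])
  also have "f ` span S = span J" by (simp add: linear_span_image[OF f] S(3))
  also have "dim (span J) = m" using Ji J(2) by (simp add: dim_eq_card_independent)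
  finally show "\<exists>S\<subseteq>V. dim S = m \<and> inj_on f (span S)" using S(1) inj by blast
next
  assume "\<exists>S\<subseteq>V. dim S = m \<and> inj_on f (span S)"
  then obtain S where S: "S \<subseteq> V" "dim S = m" "inj_on f (span S)" by blast
  have "m = dim (f ` span S)" using dim_image_eq[OF f, of S] S by (simp flip: linear_span_image[OF f])
  also have "\<dots> \<le> dim (f ` span V)" by (intro dim_subset image_mono span_mono S(1))
  finally show "m \<le> dim (f ` span V)" .
qed

lemma borel_dim_image:
  assumes W: "subspace W"
  shows "{B :: real^'n^'d. dim ((*v) B ` W) = m} \<in> sets borel"
proof -
  obtain V where V: "V \<subseteq> W" "independent V" "W \<subseteq> span V" using basis_exists[of W] by metis
  have finV: "finite V" using V(2) by (rule independent_imp_finite)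
  have WV: "W = span V" using V(1,3) W span_minimal by blast
  have ge: "{B :: real^'n^'d. m \<le> dim ((*v) B ` W)} \<in> sets borel" for m
  proof -
    have "{B :: real^'n^'d. m \<le> dim ((*v) B ` W)} = (\<Union>S\<in>{S \<in> Pow V. dim S = m}. {B. inj_on ((*v) B) (span S)})"
      unfolding WV using dim_image_ge_iff[OF _ finV, of "(*v) B" m for B :: "real^'n^'d"] by auto
    then show ?thesis using finV by (auto intro!: sets.finite_UN borel_inj_on)
  qed
  have "{B :: real^'n^'d. dim ((*v) B ` W) = m} = {B. m \<le> dim ((*v) B ` W)} - {B. Suc m \<le> dim ((*v) B ` W)}"
    by auto
  then show ?thesis using ge by (simp add: sets.Diff)
qed

lemma borel_aff_dim_image:
  assumes F: "F \<noteq> {}"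
  shows "{B :: real^'n^'d. aff_dim ((*v) B ` F) = int m} \<in> sets borel"
proof -
  have "aff_dim ((*v) B ` F) = int (dim ((*v) B ` direction_space F))" for B :: "real^'n^'d"
    using F aff_dim_direction_space[of "(*v) B ` F"] direction_space_linear_image[of "(*v) B" F] by simp
  then show ?thesis using borel_dim_image[OF subspace_direction_space, of F m] by simp
qed

section \<open>Matrices in general position\<close>

text \<open>Eigenvectors of distinct eigenvalues are linearly independent.\<close>

lemma finite_eigenvalues:
  fixes h :: "'a::euclidean_space \<Rightarrow> 'a"
  assumes h: "linear h"
  shows "finite {c. \<exists>v. v \<noteq> 0 \<and> h v = c *\<^sub>R v}"
proof (rule ccontr)
  define E where "E = {c. \<exists>v. v \<noteq> 0 \<and> h v = c *\<^sub>R v}"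
  assume "infinite {c. \<exists>v. v \<noteq> 0 \<and> h v = c *\<^sub>R v}"
  then have "\<exists>S. finite S \<and> card S = Suc DIM('a) \<and> S \<subseteq> E"
    unfolding E_def[symmetric] by (rule infinite_arbitrarily_large)
  then obtain S where S: "S \<subseteq> E" "finite S" "card S = Suc DIM('a)" by blast
  have "\<forall>c\<in>S. \<exists>v. v \<noteq> 0 \<and> h v = c *\<^sub>R v" using S(1) by (auto simp: E_def)
  then obtain v where "\<forall>c\<in>S. v c \<noteq> 0 \<and> h (v c) = c *\<^sub>R v c" by (rule bchoice[THEN exE])
  then have v: "\<And>c. c \<in> S \<Longrightarrow> v c \<noteq> 0 \<and> h (v c) = c *\<^sub>R v c" by blast
  have ind: "\<forall>c\<in>T. a c = 0" if "finite T" "T \<subseteq> S" "(\<Sum>c\<in>T. a c *\<^sub>R v c) = 0" for T and a :: "real \<Rightarrow> real"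
    using that
  proof (induction T arbitrary: a rule: finite_induct)
    case (insert c0 T)
    have "0 = h (\<Sum>c\<in>insert c0 T. a c *\<^sub>R v c) - c0 *\<^sub>R (\<Sum>c\<in>insert c0 T. a c *\<^sub>R v c)"
      using insert.prems(2) linear_0[OF h] by simp
    also have "h (\<Sum>c\<in>insert c0 T. a c *\<^sub>R v c) = (\<Sum>c\<in>insert c0 T. (c * a c) *\<^sub>R v c)"
      unfolding linear_sum[OF h] using insert.prems(1) v
      by (intro sum.cong refl) (auto simp: linear_scale[OF h] mult.commute)
    also have "\<dots> - c0 *\<^sub>R (\<Sum>c\<in>insert c0 T. a c *\<^sub>R v c) = (\<Sum>c\<in>insert c0 T. ((c - c0) * a c) *\<^sub>R v c)"
      by (simp add: scaleR_sum_right sum_subtractf[symmetric] algebra_simps)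
    also have "\<dots> = (\<Sum>c\<in>T. ((c - c0) * a c) *\<^sub>R v c)" using insert.hyps by simp
    finally have "(\<Sum>c\<in>T. ((c - c0) * a c) *\<^sub>R v c) = 0" by simp
    then have "\<forall>c\<in>T. (c - c0) * a c = 0" using insert.IH[of "\<lambda>c. (c - c0) * a c"] insert.prems(1) by blast
    then have T0: "\<forall>c\<in>T. a c = 0" using insert.hyps(2) by auto
    then have "a c0 *\<^sub>R v c0 = 0" using insert.prems(2) insert.hyps by simp
    then show ?case using T0 v insert.prems(1) by auto
  qed simp
  have inj: "inj_on v S"
  proof (rule inj_onI)
    fix c c' assume "c \<in> S" "c' \<in> S" "v c = v c'"
    then have "c *\<^sub>R v c = c' *\<^sub>R v c" using v by metis
    then show "c = c'" using v \<open>c \<in> S\<close> by simp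
  qed
  have "independent (v ` S)"
  proof (rule independent_if_scalars_zero)
    fix f x assume z: "(\<Sum>x\<in>v ` S. f x *\<^sub>R x) = 0" and x: "x \<in> v ` S"
    have "(\<Sum>c\<in>S. f (v c) *\<^sub>R v c) = 0" using z by (simp add: sum.reindex[OF inj])
    then show "f x = 0" using ind[OF S(2) subset_refl, of "\<lambda>c. f (v c)"] x by blast
  qed (use S(2) in simp)
  then have "card (v ` S) \<le> DIM('a)" using independent_bound by blast
  then show False using card_image[OF inj] S(3) by simp
qed

text \<open>By Fubini, the integral over \<open>t\<close> of the measure of \<open>{x. a + t x \<in> S}\<close> is the integral over \<open>x\<close> of the length of a finite set
  of parameters, hence zero. So some dilate of \<open>S\<close> about \<open>a\<close> is a null set.\<close>

lemma negligible_finite_on_rays: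
  fixes S :: "'a::euclidean_space set"
  assumes S: "S \<in> sets borel" and rays: "\<And>x. finite {t. 0 < t \<and> a + t *\<^sub>R x \<in> S}"
  shows "negligible S"
proof -
  define S' where "S' = (\<lambda>x. a + x) -` S"
  have S': "S' \<in> sets borel"
    unfolding S'_def using measurable_sets[of "\<lambda>x. a + x" borel borel S] S by simp
  define Q where "Q = {z :: real \<times> 'a. 1 < fst z \<and> fst z < 2 \<and> fst z *\<^sub>R snd z \<in> S'}"
  have "(\<lambda>z :: real \<times> 'a. fst z *\<^sub>R snd z) \<in> borel_measurable borel"
    by (intro borel_measurable_continuous_onI continuous_intros)
  from measurable_sets[OF this S'] have "(\<lambda>z :: real \<times> 'a. fst z *\<^sub>R snd z) -` S' \<in> sets borel" by simp
  moreover have "{1<..<2::real} \<times> (UNIV :: 'a set) \<in> sets borel" by (intro borel_open open_Times) auto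
  moreover have "Q = {1<..<2::real} \<times> UNIV \<inter> (\<lambda>z. fst z *\<^sub>R snd z) -` S'" by (auto simp: Q_def)
  ultimately have "Q \<in> sets borel" by simp
  moreover have "sets (lborel \<Otimes>\<^sub>M lborel) = sets (borel \<Otimes>\<^sub>M borel :: (real \<times> 'a) measure)"
    by (intro sets_pair_measure_cong) simp_all
  ultimately have Qm: "Q \<in> sets (lborel \<Otimes>\<^sub>M lborel)" by (simp only: borel_prod)
  have "emeasure (lborel \<Otimes>\<^sub>M lborel) Q = (\<integral>\<^sup>+ x. emeasure lborel ((\<lambda>t. (t, x)) -` Q) \<partial>(lborel :: 'a measure))"
    by (rule lborel_pair.emeasure_pair_measure_alt2[OF Qm])
  also have "\<dots> = (\<integral>\<^sup>+ x. 0 \<partial>(lborel :: 'a measure))"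
  proof (rule nn_integral_cong)
    fix x :: 'a
    have "(\<lambda>t. (t, x)) -` Q \<subseteq> {t. 0 < t \<and> a + t *\<^sub>R x \<in> S}" by (auto simp: Q_def S'_def)
    then have "finite ((\<lambda>t. (t, x)) -` Q)" using rays finite_subset by blast
    then show "emeasure lborel ((\<lambda>t. (t, x)) -` Q) = 0" by (rule emeasure_lborel_countable[OF countable_finite])
  qed
  finally have "(\<integral>\<^sup>+ t. emeasure (lborel :: 'a measure) (Pair t -` Q) \<partial>lborel) = 0"
    using lborel.emeasure_pair_measure_alt[OF Qm] by simp
  then have ae: "AE t in lborel. emeasure (lborel :: 'a measure) (Pair t -` Q) = 0"
    using lborel.measurable_emeasure_Pair[OF Qm] by (simp add: nn_integral_0_iff_AE)
  have "\<exists>t\<in>{1<..<2::real}. emeasure (lborel :: 'a measure) (Pair t -` Q) = 0"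
  proof (rule ccontr)
    assume "\<not> ?thesis"
    then have "AE t in lborel. t \<notin> {1<..<2::real}" using ae by (auto elim!: eventually_mono)
    then have "emeasure lborel {1<..<2::real} = 0" by (subst (asm) AE_iff_measurable[of "{1<..<2}"]) auto
    then show False by simp
  qed
  then obtain t where t: "1 < t" "t < 2" "emeasure (lborel :: 'a measure) (Pair t -` Q) = 0" by auto
  have sect: "Pair t -` Q = {x. t *\<^sub>R x \<in> S'}" using t(1,2) by (auto simp: Q_def)
  have "Pair t -` Q \<in> sets lborel" by (rule sets_Pair1[OF Qm])
  then have "{x. t *\<^sub>R x \<in> S'} \<in> null_sets lborel" using t(3) by (auto simp: sect)
  then have "negligible {x. t *\<^sub>R x \<in> S'}"
    by (auto simp: negligible_iff_null_sets null_sets_completionI)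
  then have "negligible ((\<lambda>x. t *\<^sub>R x) ` {x. t *\<^sub>R x \<in> S'})"
    by (intro negligible_differentiable_image_negligible) (auto intro!: linear_imp_differentiable_on linear_scaleR)
  moreover have "(\<lambda>x. t *\<^sub>R x) ` {x. t *\<^sub>R x \<in> S'} = S'"
  proof (intro equalityI subsetI)
    fix y assume "y \<in> S'"
    then show "y \<in> (\<lambda>x. t *\<^sub>R x) ` {x. t *\<^sub>R x \<in> S'}"
      using t(1) by (intro image_eqI[of _ _ "inverse t *\<^sub>R y"]) auto
  qed auto
  ultimately have "negligible S'" by simp
  then have "negligible ((\<lambda>x. a + x) ` S')" by (rule negligible_translation)
  moreover have "(\<lambda>x. a + x) ` S' = S"
  proof (intro equalityI subsetI)
    fix y assume "y \<in> S"
    then show "y \<in> (\<lambda>x. a + x) ` S'" by (intro image_eqI[of _ _ "y - a"]) (auto simp: S'_def)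
  qed (auto simp: S'_def)
  ultimately show ?thesis by simp
qed

text \<open>Start from a matrix that is injective on \<open>W\<close>, with left inverse \<open>g\<close>. Adding \<open>t X\<close> destroys the injectivity only if
  \<open>1 / t\<close> is an eigenvalue of \<open>- g \<circ> X\<close>, so this happens at finitely many points of each ray.\<close>

lemma negligible_not_inj_on:
  assumes W: "subspace W" and dW: "dim W \<le> CARD('d)"
  shows "negligible {B :: real^'n^'d. \<not> inj_on ((*v) B) W}"
proof -
  have "dim W \<le> dim (UNIV :: (real^'d) set)" using dW by simp
  then obtain f :: "real^'n \<Rightarrow> real^'d" where f: "linear f" "\<And>x. x \<in> W \<Longrightarrow> norm (f x) = norm x"
    using isometry_subset_subspace[OF W subspace_UNIV] by metis
  have "inj_on f W"
    by (rule linear_inj_on_iff_eq_0[OF f(1) W, THEN iffD2]) (metis f(2) norm_eq_zero)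
  then obtain g where g: "linear g" "\<And>v. v \<in> W \<Longrightarrow> g (f v) = v"
    using linear_exists_left_inverse_on[OF f(1) W] by blast
  show ?thesis
  proof (rule negligible_finite_on_rays[where a = "matrix f"])
    show "{B :: real^'n^'d. \<not> inj_on ((*v) B) W} \<in> sets borel"
      using borel_comp[OF borel_inj_on[OF W]] by (simp add: Collect_neg_eq)
    fix X :: "real^'n^'d"
    define h where "h v = - g (X *v v)" for v
    have h: "linear h" unfolding h_def
      by (intro linear_compose_neg linear_compose[OF _ g(1), unfolded o_def]) simp
    have "{t. 0 < t \<and> matrix f + t *\<^sub>R X \<in> {B. \<not> inj_on ((*v) B) W}} \<subseteq> inverse ` {c. \<exists>v. v \<noteq> 0 \<and> h v = c *\<^sub>R v}"
    proof
      fix t assume "t \<in> {t. 0 < t \<and> matrix f + t *\<^sub>R X \<in> {B. \<not> inj_on ((*v) B) W}}"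
      then have t: "0 < t" "\<not> inj_on ((*v) (matrix f + t *\<^sub>R X)) W" by auto
      then obtain v where v: "v \<in> W" "v \<noteq> 0" "(matrix f + t *\<^sub>R X) *v v = 0"
        using linear_inj_on_iff_eq_0[OF _ W, of "(*v) (matrix f + t *\<^sub>R X)"] by auto
      have "f v + t *\<^sub>R (X *v v) = 0"
        using v(3) fun_cong[OF matrix_vector_mul(2)[OF f(1)]] by (simp add: matrix_vector_mult_add_rdistrib scaleR_matrix_vector_assoc)
      then have "g (f v + t *\<^sub>R (X *v v)) = 0" by (simp add: linear_0[OF g(1)])
      then have "v = t *\<^sub>R h v"
        using g(2)[OF v(1)] by (simp add: linear_add[OF g(1)] linear_scale[OF g(1)] h_def add_eq_0_iff2)
      then have "h v = inverse t *\<^sub>R v" using t(1) by (metis less_irrefl real_vector.scale_left_imp_eq scaleR_scaleR left_inverse scaleR_one)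
      then show "t \<in> inverse ` {c. \<exists>v. v \<noteq> 0 \<and> h v = c *\<^sub>R v}"
        using v(2) by (intro image_eqI[of _ _ "inverse t"]) auto
    qed
    then show "finite {t. 0 < t \<and> matrix f + t *\<^sub>R X \<in> {B. \<not> inj_on ((*v) B) W}}"
      using finite_eigenvalues[OF h] finite_subset by blast
  qed
qed

section \<open>The law of a Gaussian matrix\<close>

definition matrix_gaussian_density :: "real^'n^'d \<Rightarrow> ennreal"
  where "matrix_gaussian_density B = (\<Prod>(i, l)\<in>UNIV. ennreal (std_normal_density (B $ i $ l)))"

definition matrix_gaussian :: "(real^'n^'d) measure"
  where "matrix_gaussian = density lborel matrix_gaussian_density"

text \<open>The density depends on the Euclidean norm of the matrix only; this is the source of all rotation
  invariance.\<close>

lemma matrix_gaussian_density_eq: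
  fixes B :: "real^'n^'d"
  shows "matrix_gaussian_density B =
    ennreal ((1 / sqrt (2 * pi)) ^ CARD('d \<times> 'n) * exp (- (norm B)\<^sup>2 / 2))"
proof -
  have "(\<Prod>p\<in>(UNIV :: ('d \<times> 'n) set). std_normal_density (B $ fst p $ snd p))
      = (1 / sqrt (2 * pi)) ^ CARD('d \<times> 'n) * (\<Prod>p\<in>(UNIV :: ('d \<times> 'n) set). exp (- (B $ fst p $ snd p)\<^sup>2 / 2))"
    by (simp only: std_normal_density_def prod.distrib prod_constant)
  also have "(\<Prod>p\<in>(UNIV :: ('d \<times> 'n) set). exp (- (B $ fst p $ snd p)\<^sup>2 / 2))
      = exp (\<Sum>p\<in>(UNIV :: ('d \<times> 'n) set). - (B $ fst p $ snd p)\<^sup>2 / 2)"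
    by (simp add: exp_sum)
  also have "(\<Sum>p\<in>(UNIV :: ('d \<times> 'n) set). - (B $ fst p $ snd p)\<^sup>2 / 2)
      = - (\<Sum>p\<in>(UNIV :: ('d \<times> 'n) set). (B $ fst p $ snd p)\<^sup>2) / 2"
    by (simp add: sum_negf flip: sum_divide_distrib)
  also have "(\<Sum>p\<in>(UNIV :: ('d \<times> 'n) set). (B $ fst p $ snd p)\<^sup>2) = (norm B)\<^sup>2"
  proof -
    have "(norm B)\<^sup>2 = (\<Sum>i\<in>UNIV. \<Sum>l\<in>UNIV. (B $ i $ l)\<^sup>2)"
      unfolding power2_norm_eq_inner inner_vec_def by (simp add: power2_eq_square)
    then show ?thesis by (simp add: sum.cartesian_product case_prod_beta)
  qed
  finally have "(\<Prod>p\<in>(UNIV :: ('d \<times> 'n) set). std_normal_density (B $ fst p $ snd p))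
     = (1 / sqrt (2 * pi)) ^ CARD('d \<times> 'n) * exp (- (norm B)\<^sup>2 / 2)" .
  moreover have "matrix_gaussian_density B = ennreal (\<Prod>p\<in>(UNIV :: ('d \<times> 'n) set). std_normal_density (B $ fst p $ snd p))"
    unfolding matrix_gaussian_density_def by (subst prod_ennreal[symmetric]) (auto simp: case_prod_beta)
  ultimately show ?thesis by simp
qed

lemma borel_measurable_matrix_gaussian_density [measurable]: "matrix_gaussian_density \<in> borel_measurable borel"
proof -
  have "(\<lambda>B :: real^'n^'d. (1 / sqrt (2 * pi)) ^ CARD('d \<times> 'n) * exp (- (norm B)\<^sup>2 / 2)) \<in> borel_measurable borel"
    by measurable
  then show ?thesis unfolding matrix_gaussian_density_eq[abs_def] by measurable
qed

lemma sets_matrix_gaussian [simp, measurable_cong]: "sets matrix_gaussian = sets borel"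
  and space_matrix_gaussian [simp]: "space matrix_gaussian = UNIV"
  by (auto simp: matrix_gaussian_def)

lemma distr_matrix_gaussian_orthogonal:
  fixes f :: "real^'n^'d \<Rightarrow> real^'n^'d"
  assumes f: "orthogonal_transformation f"
  shows "distr matrix_gaussian borel f = matrix_gaussian"
proof -
  have [measurable]: "f \<in> borel_measurable borel"
    by (rule borel_measurable_linear) (simp add: f orthogonal_transformation_linear)
  have nf: "norm (f x) = norm x" for x using f orthogonal_transformation by blast
  have "distr matrix_gaussian borel f = distr (density lborel (\<lambda>B. matrix_gaussian_density (f B))) borel f"
  proof -
    have "matrix_gaussian_density (f B) = matrix_gaussian_density B" for B
      by (simp only: matrix_gaussian_density_eq nf)
    then show ?thesis by (simp add: matrix_gaussian_def)
  qed
  also have "\<dots> = density (distr lborel borel f) matrix_gaussian_density"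
    by (rule density_distr[symmetric]) auto
  also have "\<dots> = matrix_gaussian" by (simp add: lborel_orthogonal_transformation[OF f] matrix_gaussian_def)
  finally show ?thesis .
qed

lemma AE_matrix_gaussian:
  assumes "negligible N"
  shows "AE B in matrix_gaussian. B \<notin> N"
proof -
  have "AE x in lebesgue. x \<notin> N"
    using assms by (simp add: negligible_iff_null_sets AE_not_in)
  then have "AE x in lborel. x \<notin> N" by (simp add: AE_completion_iff)
  then have "AE x in lborel. 0 < matrix_gaussian_density x \<longrightarrow> x \<notin> N"
    by (rule eventually_mono) blast
  then show ?thesis unfolding matrix_gaussian_def by (subst AE_density) auto
qed

lemma Basis_matrix: "(Basis :: (real^'n^'d) set) = range (\<lambda>(i, l). axis i (axis l 1))"
  by (auto simp: Basis_vec_def)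

lemma inj_matrix_axis: "inj (\<lambda>(i, l). axis i (axis l 1) :: real^'n^'d)"
  by (auto simp: inj_on_def axis_eq_axis)

lemma inner_matrix_axis: "(B :: real^'n^'d) \<bullet> axis i (axis l 1) = B $ i $ l"
  by (simp add: inner_axis)

lemma borel_measurable_matrix_of_entries:
  "(\<lambda>f. \<chi> i l. f (i, l)) \<in> borel_measurable (Pi\<^sub>M UNIV (\<lambda>_ :: ('d::finite) \<times> ('n::finite). lborel :: real measure))"
  (is "?f \<in> _")
  unfolding borel_measurable_euclidean_space[of ?f] Basis_matrix
  by (auto simp: inner_matrix_axis)

text \<open>Lebesgue measure on matrices is the product of the Lebesgue measures of the entries, up to the
  order in which the indices are read.\<close>

lemma distr_lborel_matrix:
  "distr (Pi\<^sub>M UNIV (\<lambda>_. lborel)) borel (\<lambda>f. \<chi> i l. f (i, l)) = (lborel :: (real^'n^'d) measure)"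
proof (rule lborel_eqI[symmetric])
  interpret product_sigma_finite "\<lambda>_ :: 'd \<times> 'n. lborel :: real measure" ..
  fix l u :: "real^'n^'d" assume lu: "\<And>b. b \<in> Basis \<Longrightarrow> l \<bullet> b \<le> u \<bullet> b"
  have lu': "l $ i $ k \<le> u $ i $ k" for i k
  proof -
    have "axis i (axis k 1) \<in> (Basis :: (real^'n^'d) set)" by (auto simp: Basis_matrix)
    from lu[OF this] show ?thesis by (simp add: inner_matrix_axis)
  qed
  let ?A = "\<lambda>p :: 'd \<times> 'n. {l $ fst p $ snd p <..< u $ fst p $ snd p}"
  have "(\<lambda>f. \<chi> i k. f (i, k)) -` box l u \<inter> space (Pi\<^sub>M UNIV (\<lambda>_ :: 'd \<times> 'n. lborel)) = Pi\<^sub>E UNIV ?A"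
    by (auto simp: mem_box Basis_matrix inner_matrix_axis space_PiM PiE_UNIV_domain Pi_iff split_paired_All)
  then have "emeasure (distr (Pi\<^sub>M UNIV (\<lambda>_. lborel)) borel (\<lambda>f. \<chi> i k. f (i, k))) (box l u)
      = emeasure (Pi\<^sub>M UNIV (\<lambda>_ :: 'd \<times> 'n. lborel)) (Pi\<^sub>E UNIV ?A)"
    by (subst emeasure_distr[OF borel_measurable_matrix_of_entries]) auto
  also have "\<dots> = (\<Prod>p\<in>UNIV. emeasure lborel (?A p))" by (rule emeasure_PiM) auto
  also have "\<dots> = ennreal (\<Prod>p\<in>UNIV. u $ fst p $ snd p - l $ fst p $ snd p)"
    using lu' by (simp add: prod_ennreal)
  also have "(\<Prod>p\<in>(UNIV :: ('d \<times> 'n) set). u $ fst p $ snd p - l $ fst p $ snd p) = (\<Prod>b\<in>Basis. (u - l) \<bullet> b)"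
    unfolding Basis_matrix by (subst prod.reindex[OF inj_matrix_axis]) (simp add: inner_matrix_axis case_prod_beta)
  finally show "emeasure (distr (Pi\<^sub>M UNIV (\<lambda>_. lborel)) borel (\<lambda>f. \<chi> i k. f (i, k))) (box l u) = (\<Prod>b\<in>Basis. (u - l) \<bullet> b)" .
qed simp

lemma PiM_std_normal:
  "Pi\<^sub>M UNIV (\<lambda>_ :: 'd::finite. density lborel (\<lambda>x. ennreal (std_normal_density x))) =
    density (Pi\<^sub>M UNIV (\<lambda>_. lborel)) (\<lambda>f. \<Prod>p\<in>UNIV. ennreal (std_normal_density (f p)))"
proof -
  let ?N = "density lborel (\<lambda>x. ennreal (std_normal_density x))"
  interpret L: product_sigma_finite "\<lambda>_ :: 'd. lborel :: real measure" ..
  interpret N: prob_space ?N by (rule prob_space_normal_density) simp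
  interpret NN: product_sigma_finite "\<lambda>_ :: 'd. ?N" ..
  have sets_eq: "sets (Pi\<^sub>M UNIV (\<lambda>_ :: 'd. lborel)) = sets (Pi\<^sub>M UNIV (\<lambda>_ :: 'd. ?N))"
    by (rule sets_PiM_cong) auto
  have "density (Pi\<^sub>M UNIV (\<lambda>_. lborel)) (\<lambda>f. \<Prod>p\<in>UNIV. ennreal (std_normal_density (f p))) = Pi\<^sub>M UNIV (\<lambda>_ :: 'd. ?N)"
  proof (rule NN.PiM_eqI)
    fix A :: "'d \<Rightarrow> real set" assume "\<And>i. i \<in> UNIV \<Longrightarrow> A i \<in> sets ?N"
    then have A [measurable]: "A i \<in> sets borel" for i by simp
    have PA: "Pi\<^sub>E UNIV A \<in> sets (Pi\<^sub>M UNIV (\<lambda>_ :: 'd. lborel))" by (intro sets_PiM_I_finite) auto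
    have "emeasure (density (Pi\<^sub>M UNIV (\<lambda>_. lborel)) (\<lambda>f. \<Prod>p\<in>UNIV. ennreal (std_normal_density (f p)))) (Pi\<^sub>E UNIV A)
       = (\<integral>\<^sup>+f. (\<Prod>p\<in>UNIV. ennreal (std_normal_density (f p))) * indicator (Pi\<^sub>E UNIV A) f \<partial>Pi\<^sub>M UNIV (\<lambda>_ :: 'd. lborel))"
      by (rule emeasure_density[OF _ PA]) measurable
    also have "\<dots> = (\<integral>\<^sup>+f. (\<Prod>p\<in>UNIV. ennreal (std_normal_density (f p)) * indicator (A p) (f p)) \<partial>Pi\<^sub>M UNIV (\<lambda>_ :: 'd. lborel))"
    proof (rule nn_integral_cong)
      fix f :: "'d \<Rightarrow> real"
      have "indicator (Pi\<^sub>E UNIV A) f = (\<Prod>p\<in>UNIV. indicator (A p) (f p) :: ennreal)"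
      proof (cases "f \<in> Pi\<^sub>E UNIV A")
        case True then show ?thesis by (simp add: indicator_def PiE_UNIV_domain Pi_iff)
      next
        case False
        then obtain p where "f p \<notin> A p" by auto
        then have "(\<Prod>p\<in>UNIV. indicator (A p) (f p) :: ennreal) = 0" by (intro prod_zero bexI[of _ p]) auto
        then show ?thesis using False by simp
      qed
      then show "(\<Prod>p\<in>UNIV. ennreal (std_normal_density (f p))) * indicator (Pi\<^sub>E UNIV A) f
         = (\<Prod>p\<in>UNIV. ennreal (std_normal_density (f p)) * indicator (A p) (f p))"
        by (simp add: prod.distrib)
    qed
    also have "\<dots> = (\<Prod>p\<in>UNIV. \<integral>\<^sup>+x. ennreal (std_normal_density x) * indicator (A p) x \<partial>lborel)"
      by (rule L.product_nn_integral_prod) auto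
    also have "\<dots> = (\<Prod>p\<in>UNIV. emeasure ?N (A p))"
      by (intro prod.cong refl) (simp add: emeasure_density)
    finally show "emeasure (density (Pi\<^sub>M UNIV (\<lambda>_. lborel)) (\<lambda>f. \<Prod>p\<in>UNIV. ennreal (std_normal_density (f p)))) (Pi\<^sub>E UNIV A)
       = (\<Prod>p\<in>UNIV. emeasure ?N (A p))" .
  qed (simp_all add: sets_eq)
  then show ?thesis ..
qed

lemma distr_PiM_std_normal:
  "distr (Pi\<^sub>M UNIV (\<lambda>_. density lborel (\<lambda>x. ennreal (std_normal_density x)))) borel (\<lambda>f. \<chi> i l. f (i, l))
    = (matrix_gaussian :: (real^'n^'d) measure)"
proof -
  have "distr (Pi\<^sub>M UNIV (\<lambda>_. density lborel (\<lambda>x. ennreal (std_normal_density x)))) borel (\<lambda>f. (\<chi> i l. f (i, l)) :: real^'n^'d)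
      = distr (density (Pi\<^sub>M UNIV (\<lambda>_. lborel)) (\<lambda>f. matrix_gaussian_density ((\<chi> i l. f (i, l)) :: real^'n^'d))) borel (\<lambda>f. \<chi> i l. f (i, l))"
    by (simp add: PiM_std_normal matrix_gaussian_density_def case_prod_beta)
  also have "\<dots> = density (distr (Pi\<^sub>M UNIV (\<lambda>_. lborel)) borel (\<lambda>f. \<chi> i l. f (i, l))) matrix_gaussian_density"
    by (rule density_distr[symmetric]) (use borel_measurable_matrix_of_entries in auto)
  also have "\<dots> = matrix_gaussian" by (simp add: distr_lborel_matrix matrix_gaussian_def)
  finally show ?thesis .
qed

lemma prob_space_matrix_gaussian: "prob_space (matrix_gaussian :: (real^'n^'d) measure)"
proof -
  have s: "sets (Pi\<^sub>M UNIV (\<lambda>_ :: 'd \<times> 'n. density lborel (\<lambda>x. ennreal (std_normal_density x)))) = sets (Pi\<^sub>M UNIV (\<lambda>_. lborel))"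
    by (rule sets_PiM_cong) auto
  have "(\<lambda>f. \<chi> i l. f (i, l)) \<in> measurable (Pi\<^sub>M UNIV (\<lambda>_ :: 'd \<times> 'n. density lborel (\<lambda>x. ennreal (std_normal_density x)))) borel"
    by (rule measurable_cong_sets[OF s refl, THEN equalityD2, THEN subsetD, OF borel_measurable_matrix_of_entries])
  then show ?thesis
    unfolding distr_PiM_std_normal[symmetric]
    by (intro prob_space.prob_space_distr prob_space_PiM prob_space_normal_density) simp_all
qed

lemma distr_gaussian_matrix:
  fixes A :: "'w \<Rightarrow> real^'n^'d"
  assumes M: "prob_space M" and A: "gaussian_matrix M A"
  shows "A \<in> borel_measurable M" "distr M borel A = matrix_gaussian"
proof -
  interpret prob_space M by fact
  define X where "X = (\<lambda>(i, l) \<omega>. A \<omega> $ i $ l)"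
  have ind: "indep_vars (\<lambda>_. borel) X UNIV"
    and dist: "distributed M lborel (\<lambda>\<omega>. A \<omega> $ i $ l) (\<lambda>x. ennreal (std_normal_density x))" for i l
    using A by (auto simp: gaussian_matrix_def X_def)
  have rv: "X p \<in> borel_measurable M" for p
    using distributed_measurable[OF dist] by (auto simp: X_def split: prod.split)
  have "A \<omega> \<bullet> axis i (axis l 1) = X (i, l) \<omega>" for \<omega> i l by (simp add: inner_matrix_axis X_def)
  then show Am: "A \<in> borel_measurable M"
    unfolding borel_measurable_euclidean_space[of A] Basis_matrix using rv by auto
  have Xd: "distr M borel (X p) = density lborel (\<lambda>x. ennreal (std_normal_density x))" for p
  proof -
    have "distr M borel (X p) = distr M lborel (X p)" by (rule distr_cong) auto
    also have "\<dots> = density lborel (\<lambda>x. ennreal (std_normal_density x))"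
      using distributed_distr_eq_density[OF dist] by (cases p) (simp add: X_def)
    finally show ?thesis .
  qed
  have "distr M (Pi\<^sub>M UNIV (\<lambda>_. borel)) (\<lambda>x. \<lambda>p\<in>UNIV. X p x) = Pi\<^sub>M UNIV (\<lambda>p. distr M borel (X p))"
    using ind by (subst (asm) indep_vars_iff_distr_eq_PiM) (use rv in auto)
  moreover have restr: "(\<lambda>p\<in>UNIV. X p \<omega>) = (\<lambda>p. X p \<omega>)" for \<omega> by (simp add: restrict_def)
  ultimately have XP: "distr M (Pi\<^sub>M UNIV (\<lambda>_. borel)) (\<lambda>\<omega> p. X p \<omega>) =
      Pi\<^sub>M UNIV (\<lambda>_. density lborel (\<lambda>x. ennreal (std_normal_density x)))"
    by (simp only: Xd)
  have s: "sets (Pi\<^sub>M UNIV (\<lambda>_ :: 'd \<times> 'n. lborel :: real measure)) = sets (Pi\<^sub>M UNIV (\<lambda>_. borel))"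
    by (rule sets_PiM_cong) auto
  have mf: "(\<lambda>f. \<chi> i l. f (i, l)) \<in> measurable (Pi\<^sub>M UNIV (\<lambda>_ :: 'd \<times> 'n. borel :: real measure)) (borel :: (real^'n^'d) measure)"
    by (rule measurable_cong_sets[OF s refl, THEN equalityD1, THEN subsetD, OF borel_measurable_matrix_of_entries])
  have "distr M borel A = distr M borel ((\<lambda>f. \<chi> i l. f (i, l)) \<circ> (\<lambda>\<omega> p. X p \<omega>))"
    by (simp add: X_def o_def vec_lambda_eta)
  also have "\<dots> = distr (distr M (Pi\<^sub>M UNIV (\<lambda>_. borel)) (\<lambda>\<omega> p. X p \<omega>)) borel (\<lambda>f. \<chi> i l. f (i, l))"
  proof (rule distr_distr[symmetric, OF mf])
    have "(\<lambda>\<omega>. \<lambda>p\<in>UNIV. X p \<omega>) \<in> measurable M (Pi\<^sub>M UNIV (\<lambda>_. borel))"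
      by (rule measurable_restrict) (rule rv)
    then show "(\<lambda>\<omega> p. X p \<omega>) \<in> measurable M (Pi\<^sub>M UNIV (\<lambda>_. borel))" by (simp only: restr)
  qed
  also have "\<dots> = matrix_gaussian" by (simp only: XP distr_PiM_std_normal)
  finally show "distr M borel A = matrix_gaussian" .
qed

section \<open>Pulling a random point back through the matrix\<close>

lemma AE_inj_on:
  assumes "subspace W" "dim W \<le> CARD('d)"
  shows "AE B in (matrix_gaussian :: (real^'n^'d) measure). inj_on ((*v) B) W"
  using AE_matrix_gaussian[OF negligible_not_inj_on[OF assms]] by simp

text \<open>A part of a basis that spans a subspace of the expected dimension is enough, since the matrix is almost surely injective
  on it.\<close>

lemma AE_dim_image:
  assumes W: "subspace W"
  shows "AE B in (matrix_gaussian :: (real^'n^'d) measure). dim ((*v) B ` W) = min (dim W) CARD('d)"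
proof -
  obtain V where V: "V \<subseteq> W" "independent V" "W \<subseteq> span V" "card V = dim W" using basis_exists[of W] by metis
  have "min (dim W) CARD('d) \<le> card V" using V(4) by simp
  then obtain S where S: "S \<subseteq> V" "card S = min (dim W) CARD('d)"
    by (meson obtain_subset_with_card_n)
  have dS: "dim S = min (dim W) CARD('d)"
    using independent_mono[OF V(2) S(1)] S(2) by (simp add: dim_eq_card_independent)
  have SW: "span S \<subseteq> W" using S(1) V(1) by (intro span_minimal W) auto
  have "AE B in (matrix_gaussian :: (real^'n^'d) measure). inj_on ((*v) B) (span S)"
    by (rule AE_inj_on) (auto simp: dS)
  then show ?thesis
  proof (rule eventually_mono)
    fix B :: "real^'n^'d" assume inj: "inj_on ((*v) B) (span S)"
    have lin: "linear ((*v) B)" by simp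
    have "min (dim W) CARD('d) = dim ((*v) B ` S)" using dim_image_eq[OF lin inj] dS by simp
    also have "\<dots> \<le> dim ((*v) B ` W)" using SW span_superset by (intro dim_subset image_mono) blast
    finally have "min (dim W) CARD('d) \<le> dim ((*v) B ` W)" .
    moreover have "dim ((*v) B ` W) \<le> dim W" by (rule dim_image_le[OF lin])
    moreover have "dim ((*v) B ` W) \<le> CARD('d)" using dim_subset_UNIV[of "(*v) B ` W"] by simp
    ultimately show "dim ((*v) B ` W) = min (dim W) CARD('d)" by simp
  qed
qed

text \<open>Multiplication from the right by the transpose of the matrix of \<open>f\<close>.\<close>

definition rotate_rows :: "(real^'n \<Rightarrow> real^'n) \<Rightarrow> real^'n^'d \<Rightarrow> real^'n^'d"
  where "rotate_rows f B = (\<chi> i. f (B $ i))"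

lemma rotate_rows:
  assumes f: "orthogonal_transformation f"
  shows "orthogonal_transformation (rotate_rows f :: real^'n^'d \<Rightarrow> real^'n^'d)"
    and "rotate_rows f B *v f x = B *v x"
    and "adjoint ((*v) (rotate_rows f B)) w = f (adjoint ((*v) B) w)"
proof -
  have lin: "linear f" using f by (simp add: orthogonal_transformation_linear)
  have inn: "f x \<bullet> f y = x \<bullet> y" for x y using f by (simp add: orthogonal_transformation_def)
  show "orthogonal_transformation (rotate_rows f :: real^'n^'d \<Rightarrow> real^'n^'d)"
    unfolding orthogonal_transformation_def
  proof (intro conjI allI linearI)
    have rows: "a \<bullet> b = (\<Sum>i\<in>UNIV. a $ i \<bullet> b $ i)" for a b :: "real^'n^'d" by (rule inner_vec_def)
    show "rotate_rows f v \<bullet> rotate_rows f w = v \<bullet> w" for v w :: "real^'n^'d"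
      unfolding rows by (simp add: rotate_rows_def inn)
  qed (simp_all add: rotate_rows_def vec_eq_iff linear_add[OF lin] linear_scale[OF lin])
  have mv: "rotate_rows f B *v f x = B *v x" for x
    by (simp add: vec_eq_iff matrix_vector_mul_component rotate_rows_def inn)
  then show "rotate_rows f B *v f x = B *v x" .
  have eq: "adjoint ((*v) (rotate_rows f B)) w \<bullet> f x = f (adjoint ((*v) B) w) \<bullet> f x" for x
  proof -
    have "f x \<bullet> adjoint ((*v) (rotate_rows f B)) w = (rotate_rows f B *v f x) \<bullet> w"
      by (rule adjoint_works) simp
    also have "\<dots> = (B *v x) \<bullet> w" by (simp add: mv)
    also have "\<dots> = x \<bullet> adjoint ((*v) B) w" by (rule adjoint_works[symmetric]) simp
    also have "\<dots> = f x \<bullet> f (adjoint ((*v) B) w)" by (simp add: inn)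
    finally show ?thesis by (simp add: inner_commute)
  qed
  obtain x where x: "f x = adjoint ((*v) (rotate_rows f B)) w - f (adjoint ((*v) B) w)"
    using orthogonal_transformation_surj[OF f] by (metis surjD)
  have "f x \<bullet> f x = (adjoint ((*v) (rotate_rows f B)) w - f (adjoint ((*v) B) w)) \<bullet> f x"
    by (simp only: x)
  also have "\<dots> = 0" unfolding inner_diff_left eq by (rule diff_self)
  finally have "f x \<bullet> f x = 0" .
  then show "adjoint ((*v) (rotate_rows f B)) w = f (adjoint ((*v) B) w)" using x by simp
qed

text \<open>The coefficient \<open>x \<in> L\<close> for which \<open>B x\<close> is the orthogonal projection of \<open>y\<close> onto \<open>B L\<close>.\<close>

definition least_squares :: "(real^'n) set \<Rightarrow> real^'n^'d \<Rightarrow> real^'d \<Rightarrow> real^'n"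
  where "least_squares L B y = (THE x. x \<in> L \<and> adjoint ((*v) B) (y - B *v x) \<in> L\<^sup>\<bottom>)"

lemma adjoint_matrix_inner: "x \<bullet> adjoint ((*v) B) w = (B *v x) \<bullet> w" for B :: "real^'n^'d"
  by (rule adjoint_works) simp

lemma least_squares_unique:
  fixes B :: "real^'n^'d"
  assumes L: "subspace L" and inj: "inj_on ((*v) B) L"
    and x: "x \<in> L" "adjoint ((*v) B) (y - B *v x) \<in> L\<^sup>\<bottom>"
  shows "least_squares L B y = x"
  unfolding least_squares_def
proof (rule the_equality)
  fix x' assume x': "x' \<in> L \<and> adjoint ((*v) B) (y - B *v x') \<in> L\<^sup>\<bottom>"
  have d: "x' - x \<in> L" using x x' L by (intro subspace_diff) auto
  have "(x' - x) \<bullet> adjoint ((*v) B) (y - B *v x) = 0" "(x' - x) \<bullet> adjoint ((*v) B) (y - B *v x') = 0"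
    using orthogonal_comp_inner[OF d] x x' by auto
  then have "(B *v (x' - x)) \<bullet> (y - B *v x) = 0" "(B *v (x' - x)) \<bullet> (y - B *v x') = 0"
    by (simp_all only: adjoint_matrix_inner)
  then have "(B *v (x' - x)) \<bullet> (B *v (x' - x)) = 0"
    by (simp add: matrix_vector_mult_diff_distrib inner_diff_right)
  then have "B *v x' = B *v x" by (simp add: matrix_vector_mult_diff_distrib)
  then show "x' = x" using inj x x' by (auto dest: inj_onD)
qed (use x in blast)

lemma least_squares:
  fixes B :: "real^'n^'d"
  assumes L: "subspace L" and inj: "inj_on ((*v) B) L"
  shows "least_squares L B y \<in> L" "adjoint ((*v) B) (y - B *v least_squares L B y) \<in> L\<^sup>\<bottom>"
proof -
  have sub: "subspace ((*v) B ` L)" by (rule linear_subspace_image[OF _ L]) simp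
  obtain x where x: "x \<in> L" "orth_proj ((*v) B ` L) y = B *v x" using orth_proj(1)[OF sub, of y] by auto
  have "adjoint ((*v) B) (y - B *v x) \<in> L\<^sup>\<bottom>"
    unfolding orthogonal_comp_iff adjoint_matrix_inner
    using orth_proj(2)[OF sub, of y] by (auto simp: x(2) orthogonal_comp_iff)
  then show "least_squares L B y \<in> L" "adjoint ((*v) B) (y - B *v least_squares L B y) \<in> L\<^sup>\<bottom>"
    using least_squares_unique[OF L inj x(1)] x(1) by auto
qed

text \<open>With \<open>y = B x + w\<close>, where \<open>x \<in> L\<close> and \<open>w\<close> is orthogonal to \<open>B L\<close>, this is the point \<open>x + B\<^sup>T w\<close>. Its components in \<open>L\<close> and \<open>L\<^sup>\<bottom>\<close>
  are \<open>x\<close> and \<open>B\<^sup>T w\<close>. The value on the null set of the matrices that are not injective on \<open>L\<close> is arbitrary.\<close>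

definition pullback_point :: "(real^'n) set \<Rightarrow> (real^'n^'d) \<times> (real^'d) \<Rightarrow> real^'n"
  where "pullback_point L z = (if inj_on ((*v) (fst z)) L
    then least_squares L (fst z) (snd z) + adjoint ((*v) (fst z)) (snd z - fst z *v least_squares L (fst z) (snd z))
    else 0)"

lemma pullback_point_decomposition:
  assumes L: "subspace L" and inj: "inj_on ((*v) B) L"
  shows "orth_proj L (pullback_point L (B, y)) = least_squares L B y"
    "pullback_point L (B, y) - orth_proj L (pullback_point L (B, y)) = adjoint ((*v) B) (y - B *v least_squares L B y)"
proof -
  show p: "orth_proj L (pullback_point L (B, y)) = least_squares L B y"
    using inj least_squares[OF L inj] by (simp add: pullback_point_def orth_proj_add[OF L])
  show "pullback_point L (B, y) - orth_proj L (pullback_point L (B, y)) = adjoint ((*v) B) (y - B *v least_squares L B y)"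
    unfolding p using inj by (simp add: pullback_point_def)
qed

text \<open>On the set \<open>I\<close> of matrices that are injective on \<open>L\<close> the preimage of an open set is a projection, since the coefficient
  \<open>x\<close> is the only solution of the two conditions that define it.\<close>

lemma borel_measurable_pullback_point:
  assumes L: "subspace L"
  shows "(pullback_point L :: (real^'n^'d) \<times> (real^'d) \<Rightarrow> real^'n) \<in> borel_measurable borel"
proof (rule borel_measurableI)
  fix S :: "(real^'n) set" assume S: "open S"
  let ?w = "\<lambda>u :: ((real^'n^'d) \<times> (real^'d)) \<times> (real^'n). transpose (fst (fst u)) *v (snd (fst u) - fst (fst u) *v snd u)"
  have cw: "continuous_on UNIV ?w"
    by (intro continuous_on_matrix_mult continuous_on_transpose continuous_intros)
  have "closed (snd -` L \<inter> ?w -` (L\<^sup>\<bottom>))"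
    by (intro closed_Int closed_vimage closed_subspace[OF L] closed_subspace[OF subspace_orthogonal_comp] cw continuous_intros)
  moreover have "fsigma ((\<lambda>u. snd u + ?w u) -` S)"
    by (intro fsigma_vimage open_imp_fsigma S continuous_on_add cw continuous_intros)
  ultimately have "fsigma ((snd -` L \<inter> ?w -` (L\<^sup>\<bottom>)) \<inter> (\<lambda>u. snd u + ?w u) -` S)"
    by (intro fsigma_Int_closed)
  then have m1: "fst ` ((snd -` L \<inter> ?w -` (L\<^sup>\<bottom>)) \<inter> (\<lambda>u. snd u + ?w u) -` S) \<in> sets borel"
    by (rule fsigma_continuous_image_borel) (intro continuous_intros)
  define I where "I = {z :: (real^'n^'d) \<times> (real^'d). inj_on ((*v) (fst z)) L}"
  have "fst -` {B :: real^'n^'d. inj_on ((*v) B) L} \<inter> space (borel :: ((real^'n^'d) \<times> (real^'d)) measure) \<in> sets borel"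
    by (rule measurable_sets[OF _ borel_inj_on[OF L]]) (intro borel_measurable_continuous_onI continuous_intros)
  then have mI: "I \<in> sets borel" by (simp add: I_def vimage_def)
  have eq: "pullback_point L -` S = I \<inter> fst ` ((snd -` L \<inter> ?w -` (L\<^sup>\<bottom>)) \<inter> (\<lambda>u. snd u + ?w u) -` S) \<union> (if 0 \<in> S then - I else {})"
  proof (intro set_eqI)
    fix z :: "(real^'n^'d) \<times> (real^'d)"
    obtain B y where z: "z = (B, y)" by force
    show "z \<in> pullback_point L -` S \<longleftrightarrow> z \<in> I \<inter> fst ` ((snd -` L \<inter> ?w -` (L\<^sup>\<bottom>)) \<inter> (\<lambda>u. snd u + ?w u) -` S) \<union> (if 0 \<in> S then - I else {})"
    proof (cases "inj_on ((*v) B) L")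
      case True
      have adj: "transpose B *v w = adjoint ((*v) B) w" for w by (simp add: adjoint_matrix)
      have "z \<in> pullback_point L -` S \<longleftrightarrow> (\<exists>x. x \<in> L \<and> adjoint ((*v) B) (y - B *v x) \<in> L\<^sup>\<bottom> \<and> x + adjoint ((*v) B) (y - B *v x) \<in> S)"
      proof -
        have pp: "pullback_point L z = least_squares L B y + adjoint ((*v) B) (y - B *v least_squares L B y)"
          using True by (simp add: z pullback_point_def)
        show ?thesis
          unfolding vimage_eq pp using least_squares[OF L True, of y] least_squares_unique[OF L True] by metis
      qed
      then show ?thesis using True
        by (simp add: I_def z fst_image_eq adj del: transpose_matrix_vector)
    next
      case False
      then show ?thesis by (simp add: I_def z pullback_point_def)
    qed
  qed
  have m2: "(if 0 \<in> S then - I else {}) \<in> sets borel" using borel_comp[OF mI] by simp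
  show "(pullback_point L :: (real^'n^'d) \<times> (real^'d) \<Rightarrow> real^'n) -` S \<inter> space borel \<in> sets borel"
    unfolding eq space_borel Int_UNIV_right by (rule sets.Un[OF sets.Int[OF mI m1] m2])
qed

text \<open>A rotation of the rows by \<open>f\<close> turns the decomposition \<open>y = B x + w\<close> into the one with \<open>f x\<close> in place of \<open>x\<close> and the same
  \<open>w\<close>.\<close>

lemma pullback_point_rotate:
  assumes f: "orthogonal_transformation f" and L: "subspace L" and fL: "f ` L = L"
  shows "pullback_point L (rotate_rows f B, y) = f (pullback_point L (B, y))"
proof -
  have lin: "linear f" using f by (simp add: orthogonal_transformation_linear)
  have inn: "f x \<bullet> f y = x \<bullet> y" for x y using f by (simp add: orthogonal_transformation_def)
  note rr = rotate_rows(2,3)[OF f]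
  have finj: "inj f" by (rule orthogonal_transformation_inj[OF f])
  have inj: "inj_on ((*v) (rotate_rows f B)) L \<longleftrightarrow> inj_on ((*v) B) L"
  proof -
    have "inj_on ((*v) (rotate_rows f B)) (f ` L) \<longleftrightarrow> inj_on ((*v) (rotate_rows f B) \<circ> f) L"
      using comp_inj_on_iff[of f L "(*v) (rotate_rows f B)"] inj_on_subset[OF finj] by blast
    also have "(*v) (rotate_rows f B) \<circ> f = (*v) B" by (auto simp: rr)
    finally show ?thesis by (simp add: fL)
  qed
  have fLc: "f v \<in> L\<^sup>\<bottom>" if "v \<in> L\<^sup>\<bottom>" for v
    unfolding orthogonal_comp_iff
  proof
    fix l assume "l \<in> L"
    then obtain l' where "l' \<in> L" "l = f l'" using fL by blast
    then show "l \<bullet> f v = 0" using that by (simp add: inn orthogonal_comp_iff)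
  qed
  show ?thesis
  proof (cases "inj_on ((*v) B) L")
    case True
    let ?x = "least_squares L B y"
    note ls = least_squares[OF L True, of y]
    have "least_squares L (rotate_rows f B) y = f ?x"
    proof (rule least_squares_unique[OF L])
      show "inj_on ((*v) (rotate_rows f B)) L" using True inj by simp
      show "f ?x \<in> L" using ls(1) fL by blast
      show "adjoint ((*v) (rotate_rows f B)) (y - rotate_rows f B *v f ?x) \<in> L\<^sup>\<bottom>"
        using fLc[OF ls(2)] by (simp add: rr)
    qed
    then show ?thesis using True inj by (simp add: pullback_point_def rr linear_add[OF lin])
  next
    case False
    then show ?thesis using inj by (simp add: pullback_point_def linear_0[OF lin])
  qed
qed

text \<open>The event in \<open>projected_angle\<close> says that the components of the pullback point lie in the tangent cone of \<open>H\<close> at \<open>F\<close> and in the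
  normal cone of \<open>P\<close> at \<open>H\<close>. The law of the pullback point is invariant under the rotations that preserve \<open>L\<close>, so the expectation is
  the product of the two angles.\<close>

theorem expected_projected_angle:
  fixes P :: "(real^'n) set"
  assumes P: "polyhedron P" and F: "F \<in> nonempty_faces P" and H: "H \<in> nonempty_faces P" and FH: "F \<subseteq> H"
    and dims: "dim (direction_space H) < CARD('d)" "CARD('d) \<le> CARD('n)"
  shows "(\<integral>B. projected_angle ((*v) B) F H P \<partial>(matrix_gaussian :: (real^'n^'d) measure)) =
    solid_angle (tangent_cone F H) * solid_angle (normal_cone H P)"
proof -
  define L where "L = direction_space H"
  define T where "T = tangent_cone F H"
  define U where "U = exposing_functionals H P"
  have L: "subspace L" by (simp add: L_def)
  note Tp = tangent_cone_properties[OF P F H FH, folded L_def T_def]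
  note Up = exposing_functionals_properties[OF P H, folded L_def U_def]
  have Tb: "T \<in> sets borel" using Tp(1) by (rule borel_closed)
  have Th: "pos_homogeneous T" unfolding T_def by (rule pos_homogeneous_tangent_cone)
  interpret G: prob_space "matrix_gaussian :: (real^'n^'d) measure" by (rule prob_space_matrix_gaussian)
  interpret b: prob_space "ball_uniform :: (real^'d) measure" by (rule prob_space_ball_uniform)
  interpret pp: pair_prob_space "matrix_gaussian :: (real^'n^'d) measure" "ball_uniform :: (real^'d) measure" ..
  let ?G = "matrix_gaussian :: (real^'n^'d) measure" and ?b = "ball_uniform :: (real^'d) measure"
  define PR where "PR = ?G \<Otimes>\<^sub>M ?b"
  have "sets PR = sets (borel \<Otimes>\<^sub>M borel :: ((real^'n^'d) \<times> (real^'d)) measure)"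
    unfolding PR_def by (intro sets_pair_measure_cong) auto
  then have sP: "sets PR = sets borel" by (simp only: borel_prod)
  then have spP: "space PR = UNIV" using sets_eq_imp_space_eq[OF sP] by simp
  interpret R: prob_space PR unfolding PR_def by unfold_locales
  define X where "X = (pullback_point L :: (real^'n^'d) \<times> (real^'d) \<Rightarrow> real^'n)"
  have Xb: "X \<in> borel_measurable borel" unfolding X_def by (rule borel_measurable_pullback_point[OF L])
  have XP: "X \<in> borel_measurable PR" using Xb sP by (simp cong: measurable_cong_sets)
  define \<nu> where "\<nu> = distr PR borel X"
  have \<nu>p: "prob_space \<nu>" unfolding \<nu>_def by (rule R.prob_space_distr[OF XP])
  have rot: "distr \<nu> borel f = \<nu>" if f: "orthogonal_transformation f" and fL: "f ` L = L" for f
  proof -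
    have fb: "f \<in> borel_measurable borel"
      by (rule borel_measurable_linear) (simp add: f orthogonal_transformation_linear)
    have ro: "orthogonal_transformation (rotate_rows f :: real^'n^'d \<Rightarrow> real^'n^'d)" by (rule rotate_rows(1)[OF f])
    have rb: "rotate_rows f \<in> measurable ?G borel"
      using borel_measurable_linear[OF orthogonal_transformation_linear[OF ro]] by (simp cong: measurable_cong_sets)
    have idb: "(\<lambda>y. y) \<in> measurable ?b borel" by (simp cong: measurable_cong_sets)
    have idd: "distr ?b borel (\<lambda>y. y) = ?b"
      by (rule distr_ball_uniform) (simp add: orthogonal_transformation_def linear_ident)
    have sf: "sigma_finite_measure (distr ?b borel (\<lambda>y. y))" unfolding idd ..
    let ?\<Phi> = "\<lambda>(B, y). (rotate_rows f B, y)"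
    \<comment> \<open>The pair of the rotated matrix and the same point \<open>y\<close> has the same joint law.\<close>
    have PP: "distr PR (borel \<Otimes>\<^sub>M borel) ?\<Phi> = PR"
      using pair_measure_distr[OF rb idb sf] unfolding idd distr_matrix_gaussian_orthogonal[OF ro] PR_def by simp
    have Fm: "?\<Phi> \<in> measurable PR (borel \<Otimes>\<^sub>M borel)"
      unfolding PR_def using rb idb by measurable
    have Xm: "X \<in> borel_measurable (borel \<Otimes>\<^sub>M borel)" using Xb by (simp only: borel_prod)
    have "distr \<nu> borel f = distr PR borel (f \<circ> X)"
      unfolding \<nu>_def by (rule distr_distr[OF fb XP])
    also have "f \<circ> X = X \<circ> ?\<Phi>"
      by (auto simp: X_def fun_eq_iff pullback_point_rotate[OF f L fL])
    also have "distr PR borel (X \<circ> ?\<Phi>) = distr (distr PR (borel \<Otimes>\<^sub>M borel) ?\<Phi>) borel X"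
      by (rule distr_distr[OF Xm Fm, symmetric])
    finally show ?thesis by (simp add: PP \<nu>_def)
  qed
  have dimL: "dim L < CARD('d)" using dims(1) by (simp add: L_def)
  have inj: "AE B in ?G. inj_on ((*v) B) L" by (rule AE_inj_on[OF L]) (use dimL in simp)
  have "AE B in ?G. dim ((*v) B ` UNIV) = min (dim (UNIV :: (real^'n) set)) CARD('d)"
    by (rule AE_dim_image) simp
  then have surj: "AE B in ?G. surj ((*v) B)"
  proof (rule eventually_mono)
    fix B :: "real^'n^'d" assume "dim ((*v) B ` UNIV) = min (dim (UNIV :: (real^'n) set)) CARD('d)"
    then have "dim ((*v) B ` UNIV) = DIM(real^'d)" using dims(2) by simp
    moreover have "subspace ((*v) B ` UNIV)" by (rule linear_subspace_image) auto
    ultimately show "surj ((*v) B)" by (metis dim_eq_full span_eq_iff)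
  qed
  have AE_pair: "AE z in PR. X z \<notin> V" if V: "closed V" and ae: "AE B in ?G. AE y in ?b. X (B, y) \<notin> V" for V
    unfolding PR_def
  proof (rule pp.AE_pair_measure[OF _ ae])
    have "{z. X z \<notin> V} = X -` (- V) \<inter> space borel" by auto
    then have "{z. X z \<notin> V} \<in> sets borel" using measurable_sets[OF Xb, of "- V"] borel_comp[OF borel_closed[OF V]] by simp
    then show "{z \<in> space (?G \<Otimes>\<^sub>M ?b). X z \<notin> V} \<in> sets (?G \<Otimes>\<^sub>M ?b)"
      using sP spP by (simp add: PR_def)
  qed
  have AE_nu: "AE x in \<nu>. x \<notin> V" if V: "closed V" and ae: "AE B in ?G. AE y in ?b. X (B, y) \<notin> V" for V
    unfolding \<nu>_def
    by (subst AE_distr_iff[OF XP]) (use AE_pair[OF V ae] borel_comp[OF borel_closed[OF V]] in \<open>auto simp: Collect_neg_eq\<close>)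
  \<comment> \<open>The component in \<open>L\<close> vanishes only if \<open>y\<close> is orthogonal to \<open>B L\<close>, which is not the zero subspace.\<close>
  have nz1: "AE x in \<nu>. x \<notin> L\<^sup>\<bottom>" if Lne: "L \<noteq> {0}"
  proof (rule AE_nu[OF closed_subspace[OF subspace_orthogonal_comp]])
    show "AE B in ?G. AE y in ?b. X (B, y) \<notin> L\<^sup>\<bottom>"
      using inj
    proof (rule eventually_mono)
      fix B :: "real^'n^'d" assume inj: "inj_on ((*v) B) L"
      have linB: "linear ((*v) B)" by simp
      obtain l where l: "l \<in> L" "l \<noteq> 0" using Lne subspace_0[OF L] by blast
      have "B *v l \<noteq> 0" using linear_inj_on_iff_eq_0[OF linB L] inj l by blast
      then have "B *v l \<notin> ((*v) B ` L)\<^sup>\<bottom>" using l(1) by (auto simp: orthogonal_comp_iff intro!: bexI[of _ l])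
      then have "AE y in ?b. y \<notin> ((*v) B ` L)\<^sup>\<bottom>"
        by (intro AE_ball_uniform_not_in_subspace subspace_orthogonal_comp) blast
      then show "AE y in ?b. X (B, y) \<notin> L\<^sup>\<bottom>"
      proof (rule eventually_mono)
        fix y assume y: "y \<notin> ((*v) B ` L)\<^sup>\<bottom>"
        show "X (B, y) \<notin> L\<^sup>\<bottom>"
        proof
          assume "X (B, y) \<in> L\<^sup>\<bottom>"
          then have "least_squares L B y = 0"
            using pullback_point_decomposition(1)[OF L inj] orth_proj_eq_0_iff[OF L] by (metis X_def)
          then have "adjoint ((*v) B) y \<in> L\<^sup>\<bottom>" using least_squares(2)[OF L inj, of y] by simp
          then have "y \<in> ((*v) B ` L)\<^sup>\<bottom>" by (auto simp: orthogonal_comp_iff adjoint_matrix_inner)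
          then show False using y by simp
        qed
      qed
    qed
  qed
  \<comment> \<open>The component in \<open>L\<^sup>\<bottom>\<close> vanishes only if \<open>y\<close> lies in \<open>B L\<close>, which is a proper subspace as \<open>dim L < d\<close>.\<close>
  have nz2: "AE x in \<nu>. x \<notin> L"
  proof (rule AE_nu[OF closed_subspace[OF L]])
    show "AE B in ?G. AE y in ?b. X (B, y) \<notin> L"
      using inj surj
    proof eventually_elim
      case (elim B)
      have linB: "linear ((*v) B)" by simp
      have sub: "subspace ((*v) B ` L)" by (rule linear_subspace_image[OF linB L])
      have "dim ((*v) B ` L) < CARD('d)" using dim_image_le[OF linB, of L] dimL by simp
      then have "(*v) B ` L \<noteq> UNIV" by auto
      then have "AE y in ?b. y \<notin> (*v) B ` L" by (intro AE_ball_uniform_not_in_subspace sub)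
      then show ?case
      proof (rule eventually_mono)
        fix y assume y: "y \<notin> (*v) B ` L"
        let ?x = "least_squares L B y"
        show "X (B, y) \<notin> L"
        proof
          assume XL: "X (B, y) \<in> L"
          have "orth_proj L (X (B, y)) = X (B, y)"
            using XL L by (intro orth_proj_unique) (auto simp: subspace_0 subspace_orthogonal_comp)
          then have z: "adjoint ((*v) B) (y - B *v ?x) = 0"
            using pullback_point_decomposition(2)[OF L elim(1), of y] by (simp add: X_def)
          obtain v where v: "y - B *v ?x = B *v v" using elim(2) by (metis surjD)
          have "(B *v v) \<bullet> (y - B *v ?x) = 0" by (metis z adjoint_matrix_inner inner_zero_right)
          then have "(y - B *v ?x) \<bullet> (y - B *v ?x) = 0" by (simp only: v)
          then have "y = B *v ?x" by simp
          then show False using y least_squares(1)[OF L elim(1), of y] by blast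
        qed
      qed
    qed
  qed
  define E where "E = {x. orth_proj L x \<in> T \<and> x - orth_proj L x \<in> U}"
  have pL: "orth_proj L \<in> borel_measurable borel" by (rule borel_measurable_linear[OF linear_orth_proj[OF L]])
  have Eb: "E \<in> sets borel"
  proof -
    have "E = (orth_proj L -` T \<inter> space borel) \<inter> ((\<lambda>x. x - orth_proj L x) -` U \<inter> space borel)"
      by (auto simp: E_def)
    moreover have "(\<lambda>x. x - orth_proj L x) \<in> borel_measurable borel" using pL by measurable
    ultimately show ?thesis using measurable_sets[OF pL Tb] measurable_sets[OF _ Up(1)] by (metis sets.Int)
  qed
  have "measure \<nu> E = cone_angle L T * cone_angle (L\<^sup>\<bottom>) U"
    unfolding E_def
    by (rule measure_proj_in_cones[OF \<nu>p _ L rot _ _ Tb Th Up(1,2)]) (use nz1 nz2 in \<open>auto simp: \<nu>_def\<close>)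
  then have main: "measure \<nu> E = solid_angle T * solid_angle (normal_cone H P)" by (simp add: Tp(3) Up(4))
  define Q where "Q = {z :: (real^'n^'d) \<times> (real^'d). \<exists>x\<in>T. adjoint ((*v) (fst z)) (snd z - fst z *v x) \<in> U}"
  have Qb: "Q \<in> sets PR"
    unfolding sP Q_def T_def U_def by (rule borel_measurable_projected_angle(1)[OF P F H FH])
  have "measure \<nu> E = measure PR (X -` E \<inter> space PR)" unfolding \<nu>_def by (rule measure_distr[OF XP Eb])
  also have "\<dots> = measure PR Q"
  proof (rule R.finite_measure_eq_AE)
    have "{z :: (real^'n^'d) \<times> (real^'d). inj_on ((*v) (fst z)) L} = fst -` {B. inj_on ((*v) B) L} \<inter> space borel" by auto
    moreover have "fst -` {B :: real^'n^'d. inj_on ((*v) B) L} \<inter> space (borel :: ((real^'n^'d) \<times> (real^'d)) measure) \<in> sets borel"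
      by (rule measurable_sets[OF _ borel_inj_on[OF L]]) (intro borel_measurable_continuous_onI continuous_intros)
    ultimately have Ib: "{z :: (real^'n^'d) \<times> (real^'d). inj_on ((*v) (fst z)) L} \<in> sets borel" by simp
    have "AE z in PR. inj_on ((*v) (fst z)) L"
      unfolding PR_def
      by (rule pp.AE_pair_measure) (use Ib sP spP inj in \<open>auto simp: PR_def\<close>)
    then show "AE z in PR. (z \<in> X -` E \<inter> space PR) = (z \<in> Q)"
    proof (rule eventually_mono)
      fix z :: "(real^'n^'d) \<times> (real^'d)" assume inj: "inj_on ((*v) (fst z)) L"
      obtain B y where z: "z = (B, y)" by force
      have inj: "inj_on ((*v) B) L" using inj by (simp add: z)
      have "X (B, y) \<in> E \<longleftrightarrow> least_squares L B y \<in> T \<and> adjoint ((*v) B) (y - B *v least_squares L B y) \<in> U"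
        unfolding E_def mem_Collect_eq X_def pullback_point_decomposition(2)[OF L inj]
        unfolding pullback_point_decomposition(1)[OF L inj] ..
      also have "\<dots> \<longleftrightarrow> (\<exists>x\<in>T. adjoint ((*v) B) (y - B *v x) \<in> U)"
        using least_squares_unique[OF L inj] Tp(2) Up(3) by (metis subsetD)
      finally show "(z \<in> X -` E \<inter> space PR) = (z \<in> Q)" by (simp add: z Q_def spP)
    qed
    show "X -` E \<inter> space PR \<in> sets PR" by (rule measurable_sets[OF XP Eb])
  qed (rule Qb)
  also have "measure PR Q = (\<integral>z. indicator Q z \<partial>PR)" using Qb by simp
  also have "\<dots> = (\<integral>B. \<integral>y. indicator Q (B, y) \<partial>?b \<partial>?G)"
    unfolding PR_def
    by (rule pp.integral_fst'[symmetric]) (use Qb in \<open>auto simp: PR_def intro!: integrable_real_indicator simp: less_top[symmetric]\<close>)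
  also have "\<dots> = (\<integral>B. projected_angle ((*v) B) F H P \<partial>?G)"
  proof (rule Bochner_Integration.integral_cong[OF refl])
    fix B :: "real^'n^'d"
    have "Pair B -` Q \<in> sets ?b" using sets_Pair1[of Q ?G ?b B] Qb by (simp add: PR_def)
    moreover have "(\<lambda>y. indicator Q (B, y) :: real) = indicator (Pair B -` Q)" by (auto simp: indicator_def)
    ultimately have "(\<integral>y. indicator Q (B, y) \<partial>?b) = measure ?b (Pair B -` Q)" by simp
    then show "(\<integral>y. indicator Q (B, y) \<partial>?b) = projected_angle ((*v) B) F H P"
      by (simp add: projected_angle_def Q_def T_def U_def vimage_def)
  qed
  finally show ?thesis using main by (simp add: T_def)
qed

section \<open>Expected face sums\<close>

lemma face_of_linear_image_inj_on:
  assumes A: "linear A" and F: "F face_of H" and H: "convex H" "inj_on A H"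
  shows "A ` F face_of A ` H"
  unfolding face_of_def
proof (intro conjI ballI impI)
  show "A ` F \<subseteq> A ` H" using face_of_imp_subset[OF F] by blast
  show "convex (A ` F)" by (rule convex_linear_image[OF A face_of_imp_convex[OF F]])
  fix a b x assume "a \<in> A ` H" "b \<in> A ` H" "x \<in> A ` F" and seg: "x \<in> open_segment a b"
  then obtain a' b' x' where ab: "a' \<in> H" "b' \<in> H" "a = A a'" "b = A b'" and x: "x' \<in> F" "x = A x'" by blast
  obtain u where u: "a \<noteq> b" "0 < u" "u < 1" "x = (1 - u) *\<^sub>R a + u *\<^sub>R b" using seg by (auto simp: in_segment)
  have "A x' = A ((1 - u) *\<^sub>R a' + u *\<^sub>R b')"
    using u(4) by (simp add: ab x linear_add[OF A] linear_scale[OF A])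
  moreover have "(1 - u) *\<^sub>R a' + u *\<^sub>R b' \<in> H" using u ab by (intro convexD[OF H(1)]) auto
  ultimately have "x' = (1 - u) *\<^sub>R a' + u *\<^sub>R b'"
    using H(2) x(1) face_of_imp_subset[OF F] by (auto dest: inj_onD)
  then have "x' \<in> open_segment a' b'" using u ab by (auto simp: in_segment)
  then have "a' \<in> F \<and> b' \<in> F" using face_ofD[OF F] ab x by blast
  then show "a \<in> A ` F" "b \<in> A ` F" using ab by auto
qed

text \<open>If \<open>A\<close> is injective on the directions of a surviving face, then it maps the faces of this face to faces.\<close>

lemma surviving_subface:
  fixes A :: "'a::euclidean_space \<Rightarrow> 'b::euclidean_space"
  assumes A: "linear A" and P: "polyhedron P" and F: "F \<in> nonempty_faces P"
    and H: "H \<in> nonempty_faces P" "surviving A H P" and FH: "F \<subseteq> H" and inj: "inj_on A (direction_space H)"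
  shows "surviving A F P"
proof -
  note cP = polyhedron_imp_convex[OF P]
  note HP = nonempty_facesD[OF H(1)]
  note FP = nonempty_facesD[OF F]
  note sH = surviving_image[OF A cP H]
  have injH: "inj_on A H"
  proof (rule inj_onI)
    fix x y assume xy: "x \<in> H" "y \<in> H" "A x = A y"
    then have "A (x - y) = 0" by (simp add: linear_diff[OF A])
    then have "x - y = 0"
      using linear_inj_on_iff_eq_0[OF A subspace_direction_space] inj diff_in_direction_space[OF xy(1,2)] by blast
    then show "x = y" by simp
  qed
  have "F face_of H" by (rule face_of_subset[OF FP(1) FH HP(3)])
  then have "A ` F face_of A ` H" by (rule face_of_linear_image_inj_on[OF A _ HP(4) injH])
  moreover have "A ` H face_of A ` P" using sH(1) by (rule nonempty_facesD)
  ultimately have "A ` F face_of A ` P" by (rule face_of_trans)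
  moreover have "A ` F \<noteq> {}" using FP(2) by simp
  ultimately obtain w where w: "w \<in> exposing_functionals (A ` F) (A ` P)"
    using exposing_functional_exists[OF polyhedron_linear_image[OF A P]] by blast
  have "p \<in> F" if p: "p \<in> P" "A p \<in> A ` F" for p
  proof -
    have "p \<in> H" using p FH by (subst sH(2)) auto
    then show ?thesis using p(2) injH FH by (auto dest: inj_onD)
  qed
  then have "F = {p \<in> P. A p \<in> A ` F}" using FP(3) by blast
  then show ?thesis
    using w exposing_functionals_linear_image[OF A FP(3), of w] by (auto simp: surviving_def)
qed

definition face_volume_sum :: "nat \<Rightarrow> nat \<Rightarrow> 'a::euclidean_space set \<Rightarrow> real"
  where "face_volume_sum j k Q = (\<Sum>F\<in>faces_of_dim j Q. conic_intrinsic_volume k (tangent_cone F Q))"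

lemma projected_angle_bounds: "0 \<le> projected_angle A F H P" "projected_angle A F H P \<le> 1"
proof -
  interpret prob_space "ball_uniform :: 'b measure" by (rule prob_space_ball_uniform)
  show "0 \<le> projected_angle A F H P" "projected_angle A F H P \<le> 1" by (auto simp: projected_angle_def)
qed

text \<open>Almost surely the image of a face has dimension \<open>min (dim F) d\<close>, so that the dimension conditions \<open>j\<close>, \<open>k < d\<close> can be read
  off from \<open>P\<close>, and all faces of a surviving face of dimension \<open>k\<close> survive. The rest is the expectation of
  \<open>projected_angle\<close>, pair by pair.\<close>

lemma has_bochner_integral_face_volume_sum:
  fixes P :: "(real^'n) set"
  assumes P: "polyhedron P" and dn: "CARD('d) \<le> CARD('n)" and jk: "j < CARD('d)" "k < CARD('d)"
  shows "has_bochner_integral (matrix_gaussian :: (real^'n^'d) measure)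
    (\<lambda>B. face_volume_sum j k ((*v) B ` P)) (face_volume_sum j k P)"
proof -
  let ?G = "matrix_gaussian :: (real^'n^'d) measure"
  interpret G: prob_space ?G by (rule prob_space_matrix_gaussian)
  note fin = finite_nonempty_faces[OF P]
  have pair_term: "has_bochner_integral ?G
      (\<lambda>B. of_bool (surviving ((*v) B) F P \<and> aff_dim ((*v) B ` F) = int j \<and> aff_dim ((*v) B ` H) = int k) * projected_angle ((*v) B) F H P)
      (of_bool (aff_dim F = int j \<and> aff_dim H = int k) * (solid_angle (tangent_cone F H) * solid_angle (normal_cone H P)))"
    (is "has_bochner_integral _ ?t ?v")
    if F: "F \<in> nonempty_faces P" and H: "H \<in> nonempty_faces P" and FH: "F \<subseteq> H" for F H
  proof -
    note ne = nonempty_facesD(2)[OF F] nonempty_facesD(2)[OF H]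
    have pm: "(\<lambda>B :: real^'n^'d. projected_angle ((*v) B) F H P) \<in> borel_measurable borel"
      by (rule borel_measurable_projected_angle(2)[OF P F H FH])
    have cm: "{B :: real^'n^'d. surviving ((*v) B) F P \<and> aff_dim ((*v) B ` F) = int j \<and> aff_dim ((*v) B ` H) = int k} \<in> sets borel"
      using sets.Int[OF borel_surviving[OF P F] sets.Int[OF borel_aff_dim_image[OF ne(1)] borel_aff_dim_image[OF ne(2)]]]
      by (simp add: Int_def)
    have tm: "?t \<in> borel_measurable ?G"
    proof -
      have "(\<lambda>B :: real^'n^'d. indicator {B :: real^'n^'d. surviving ((*v) B) F P \<and> aff_dim ((*v) B ` F) = int j \<and> aff_dim ((*v) B ` H) = int k} B
          * projected_angle ((*v) B) F H P) \<in> borel_measurable borel"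
        by (intro borel_measurable_times borel_measurable_indicator cm pm)
      then show ?thesis by (simp add: indicator_def of_bool_def cong: measurable_cong_sets)
    qed
    have ti: "integrable ?G ?t"
      by (rule G.integrable_const_bound[where B = 1, OF _ tm])
         (auto intro!: AE_I2 simp: abs_of_nonneg[OF projected_angle_bounds(1)] projected_angle_bounds(2))
    have adim: "aff_dim ((*v) B ` K) = int (dim ((*v) B ` direction_space K))" if "K \<noteq> {}" for B :: "real^'n^'d" and K
      using that aff_dim_direction_space[of "(*v) B ` K"] direction_space_linear_image[of "(*v) B" K] by simp
    have ad: "AE B in ?G. aff_dim ((*v) B ` K) = int m \<longleftrightarrow> aff_dim K = int m" if "K \<noteq> {}" "m < CARD('d)" for K m
      using AE_dim_image[OF subspace_direction_space, of K]
    proof (rule eventually_mono)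
      fix B :: "real^'n^'d" assume "dim ((*v) B ` direction_space K) = min (dim (direction_space K)) CARD('d)"
      then show "aff_dim ((*v) B ` K) = int m \<longleftrightarrow> aff_dim K = int m"
        using that(2) unfolding adim[OF that(1)] aff_dim_direction_space[OF that(1)] by auto
    qed
    have "integral\<^sup>L ?G ?t = ?v"
    proof (cases "aff_dim F = int j \<and> aff_dim H = int k")
      case True
      then have dH: "dim (direction_space H) = k" using aff_dim_direction_space[OF ne(2)] by simp
      have "AE B in ?G. inj_on ((*v) B) (direction_space H)"
        by (rule AE_inj_on) (use dH jk in auto)
      then have "AE B in ?G. ?t B = projected_angle ((*v) B) F H P"
        using ad[OF ne(1) jk(1)] ad[OF ne(2) jk(2)]
      proof eventually_elim
        case (elim B)
        show ?case
        proof (cases "surviving ((*v) B) H P")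
          case True
          then have "surviving ((*v) B) F P"
            by (intro surviving_subface[OF _ P F H _ FH elim(1)]) auto
          then show ?thesis using elim \<open>aff_dim F = int j \<and> aff_dim H = int k\<close> by simp
        qed (simp add: projected_angle_not_surviving)
      qed
      then have "integral\<^sup>L ?G ?t = (\<integral>B. projected_angle ((*v) B) F H P \<partial>?G)"
        by (intro integral_cong_AE tm) (use pm in \<open>auto cong: measurable_cong_sets\<close>)
      also have "\<dots> = solid_angle (tangent_cone F H) * solid_angle (normal_cone H P)"
        by (rule expected_projected_angle[OF P F H FH]) (use dH jk dn in auto)
      finally show ?thesis using True by simp
    next
      case False
      have "AE B in ?G. ?t B = 0"
        using ad[OF ne(1) jk(1)] ad[OF ne(2) jk(2)] by eventually_elim (use False in auto)
      then have "integral\<^sup>L ?G ?t = (\<integral>B. 0 \<partial>?G)" by (intro integral_cong_AE tm) auto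
      then show ?thesis using False by auto
    qed
    then show ?thesis using ti by (simp add: has_bochner_integral_iff)
  qed
  have lhs: "face_volume_sum j k ((*v) B ` P) = (\<Sum>F\<in>nonempty_faces P. \<Sum>H\<in>{H \<in> nonempty_faces P. F \<subseteq> H}.
       of_bool (surviving ((*v) B) F P \<and> aff_dim ((*v) B ` F) = int j \<and> aff_dim ((*v) B ` H) = int k) * projected_angle ((*v) B) F H P)"
    for B :: "real^'n^'d"
    unfolding face_volume_sum_def by (rule sum_conic_intrinsic_volume_linear_image[OF _ P]) simp
  show ?thesis
    unfolding lhs unfolding face_volume_sum_def sum_conic_intrinsic_volume_pairs[OF P]
    by (intro has_bochner_integral_sum pair_term) auto
qed

text \<open>A linear subspace has no proper faces, but the tangent cone of \<open>F\<close> at \<open>F\<close> is a proper face of the tangent cone of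
  \<open>Q\<close>.\<close>

lemma proper_face_tangent_cone_not_subspace:
  fixes Q :: "'a::euclidean_space set"
  assumes Q: "convex Q" and F: "F face_of Q" "F \<noteq> {}" "F \<noteq> Q"
  shows "\<not> subspace (tangent_cone F Q)"
proof
  assume sub: "subspace (tangent_cone F Q)"
  obtain f where f: "f \<in> rel_interior F" by (rule face_nonempty_rel_interior[OF F(1,2)])
  have cF: "convex F" by (rule face_of_imp_convex[OF F(1)])
  have K: "tangent_cone F F face_of tangent_cone F Q"
    by (rule tangent_cone_face_of[OF Q F(1,2) F(1) subset_refl])
  have K0: "0 \<in> tangent_cone F F" by (rule zero_in_tangent_cone[OF face_of_refl[OF cF] F(2)])
  have "v \<in> tangent_cone F F" if v: "v \<in> tangent_cone F Q" for v
  proof (cases "v = 0")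
    case False
    have "0 \<in> open_segment v (- v)"
      unfolding in_segment using False by (auto intro!: exI[of _ "1/2"] simp: algebra_simps eq_neg_iff_add_eq_0 simp flip: scaleR_2)
    moreover have "- v \<in> tangent_cone F Q" by (rule subspace_neg[OF sub v])
    ultimately show ?thesis using face_ofD[OF K _ v _ K0] by blast
  qed (use K0 in simp)
  then have "tangent_cone F F = tangent_cone F Q" using face_of_imp_subset[OF K] by blast
  then have "F = Q"
    using face_from_tangent_cone[OF Q F(1,2) F(1) subset_refl f]
      face_from_tangent_cone[OF Q F(1,2) face_of_refl[OF Q] face_of_imp_subset[OF F(1)] f] by simp
  then show False using F(3) by simp
qed

lemma gauss_bonnet_tangent_cone:
  fixes Q :: "'a::euclidean_space set"
  assumes Q: "polyhedron Q" and F: "F \<in> faces_of_dim j Q" and j: "j < DIM('a)" and full: "direction_space Q = UNIV"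
  shows "(\<Sum>k\<le>DIM('a). (-1) ^ k * conic_intrinsic_volume k (tangent_cone F Q)) = 0"
proof (rule conic_gauss_bonnet)
  have F': "F face_of Q" "F \<noteq> {}" and aF: "aff_dim F = int j" using F by (auto simp: faces_of_dim_def)
  have "Q \<noteq> {}" using F' face_of_imp_subset by blast
  then have "aff_dim Q = int DIM('a)" using aff_dim_direction_space[of Q] by (simp add: full)
  then have "F \<noteq> Q" using aF j by auto
  then show "\<not> subspace (tangent_cone F Q)"
    by (rule proper_face_tangent_cone_not_subspace[OF polyhedron_imp_convex[OF Q] F'])
  show "polyhedron (tangent_cone F Q)" by (rule polyhedron_tangent_cone[OF Q F'])
  show "0 \<in> tangent_cone F Q" by (rule zero_in_tangent_cone[OF F'])
  show "pos_homogeneous (tangent_cone F Q)" by (rule pos_homogeneous_tangent_cone)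
qed

lemma alternating_face_volume_sum:
  fixes Q :: "'a::euclidean_space set"
  assumes Q: "polyhedron Q" and j: "j < DIM('a)" and full: "direction_space Q = UNIV"
  shows "(\<Sum>k\<le>DIM('a). (-1) ^ k * face_volume_sum j k Q) = 0"
proof -
  have "(\<Sum>k\<le>DIM('a). (-1) ^ k * face_volume_sum j k Q)
     = (\<Sum>F\<in>faces_of_dim j Q. \<Sum>k\<le>DIM('a). (-1) ^ k * conic_intrinsic_volume k (tangent_cone F Q))"
    unfolding face_volume_sum_def sum_distrib_left by (rule sum.swap)
  also have "\<dots> = 0" by (intro sum.neutral ballI gauss_bonnet_tangent_cone[OF Q _ j full])
  finally show ?thesis .
qed

lemma face_volume_sum_top:
  fixes Q :: "'a::euclidean_space set"
  assumes Q: "polyhedron Q" and j: "j < DIM('a)" and full: "direction_space Q = UNIV"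
  shows "face_volume_sum j DIM('a) Q = (\<Sum>k<DIM('a). - ((-1) ^ (DIM('a) + k)) * face_volume_sum j k Q)"
proof -
  let ?d = "DIM('a)"
  have "(\<Sum>k<?d. (-1) ^ k * face_volume_sum j k Q) + (-1) ^ ?d * face_volume_sum j ?d Q = 0"
    using alternating_face_volume_sum[OF Q j full] by (simp add: lessThan_Suc_atMost[symmetric])
  then have "(-1) ^ ?d * ((\<Sum>k<?d. (-1) ^ k * face_volume_sum j k Q) + (-1) ^ ?d * face_volume_sum j ?d Q) = 0"
    by simp
  moreover have "(-1) ^ ?d * ((-1) ^ ?d * face_volume_sum j ?d Q) = face_volume_sum j ?d Q"
    by (simp add: mult.assoc[symmetric] power_add[symmetric])
  ultimately have "face_volume_sum j ?d Q = - ((-1) ^ ?d * (\<Sum>k<?d. (-1) ^ k * face_volume_sum j k Q))"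
    by (simp add: distrib_left)
  also have "\<dots> = (\<Sum>k<?d. - ((-1) ^ (?d + k)) * face_volume_sum j k Q)"
    by (simp add: sum_distrib_left sum_negf power_add mult.assoc)
  finally show ?thesis .
qed

lemma face_volume_sum_degenerate:
  fixes Q :: "'a::euclidean_space set"
  assumes Q: "polyhedron Q" and deg: "direction_space Q \<noteq> UNIV"
  shows "face_volume_sum j DIM('a) Q = 0"
  unfolding face_volume_sum_def
proof (rule sum.neutral, intro ballI)
  fix F assume "F \<in> faces_of_dim j Q"
  then have F: "F face_of Q" "F \<noteq> {}" by (auto simp: faces_of_dim_def)
  have "faces_of_dim DIM('a) (tangent_cone F Q) = {}"
  proof (rule ccontr)
    assume "faces_of_dim DIM('a) (tangent_cone F Q) \<noteq> {}"
    then obtain K where K: "K face_of tangent_cone F Q" "aff_dim K = int DIM('a)" by (auto simp: faces_of_dim_def)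
    have "K \<noteq> {}" using K(2) by auto
    then have "dim (direction_space K) = DIM('a)" using K(2) aff_dim_direction_space[of K] by simp
    then have "direction_space K = UNIV" by (metis dim_eq_full span_eq_iff subspace_direction_space)
    moreover have "direction_space K \<subseteq> direction_space Q"
      using direction_space_mono[OF face_of_imp_subset[OF K(1)]]
        direction_space_tangent_cone[OF polyhedron_imp_convex[OF Q] F] by simp
    ultimately show False using deg by blast
  qed
  then show "conic_intrinsic_volume DIM('a) (tangent_cone F Q) = 0" by (simp add: conic_intrinsic_volume_def)
qed

lemma direction_space_of_interior:
  fixes P :: "'a::euclidean_space set"
  assumes "interior P \<noteq> {}"
  shows "direction_space P = UNIV"
proof -
  have ne: "P \<noteq> {}" using assms interior_subset by blast
  have "aff_dim P = int DIM('a)" using aff_dim_nonempty_interior[OF assms] by simp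
  then have "dim (direction_space P) = DIM('a)" using aff_dim_direction_space[OF ne] by simp
  then show ?thesis by (metis dim_eq_full span_eq_iff subspace_direction_space)
qed

text \<open>For a matrix of full rank, Gauss-Bonnet expresses the sum by those with \<open>k < d\<close>; for any other matrix the
  image has no interior, and the sum is zero. The resulting case distinction is Borel, and the second case has
  probability zero.\<close>

lemma has_bochner_integral_face_volume_sum_top:
  fixes P :: "(real^'n) set"
  assumes P: "polyhedron P" "interior P \<noteq> {}" and dn: "CARD('d) \<le> CARD('n)" and j: "j < CARD('d)"
  shows "has_bochner_integral (matrix_gaussian :: (real^'n^'d) measure)
    (\<lambda>B. face_volume_sum j CARD('d) ((*v) B ` P))
    (\<Sum>s = 0..CARD('n) - CARD('d). (-1) ^ s * face_volume_sum j (CARD('d) + s) P)"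
proof -
  let ?G = "matrix_gaussian :: (real^'n^'d) measure"
  let ?d = "CARD('d)" and ?n = "CARD('n)"
  define g where "g B = (\<Sum>k<?d. - ((-1) ^ (?d + k)) * face_volume_sum j k ((*v) B ` P))" for B :: "real^'n^'d"
  define c where "c = (\<Sum>k<?d. - ((-1) ^ (?d + k)) * face_volume_sum j k P)"
  have g: "has_bochner_integral ?G g c"
    unfolding g_def c_def
    by (intro has_bochner_integral_sum has_bochner_integral_mult_right has_bochner_integral_face_volume_sum[OF P(1) dn j]) auto
  have full: "direction_space P = UNIV" by (rule direction_space_of_interior[OF P(2)])
  define S where "S = {B :: real^'n^'d. dim ((*v) B ` UNIV) = ?d}"
  have Sb: "S \<in> sets borel" unfolding S_def by (rule borel_dim_image) simp
  have eq: "face_volume_sum j ?d ((*v) B ` P) = indicator S B * g B" for B :: "real^'n^'d"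
  proof -
    have Q: "polyhedron ((*v) B ` P)" by (rule polyhedron_linear_image[OF _ P(1)]) simp
    have ds: "direction_space ((*v) B ` P) = (*v) B ` UNIV"
      using direction_space_linear_image[of "(*v) B" P] by (simp add: full)
    have sub: "subspace ((*v) B ` UNIV)" by (rule linear_subspace_image) auto
    show ?thesis
    proof (cases "B \<in> S")
      case True
      then have "(*v) B ` UNIV = UNIV" using sub dim_eq_full[of "(*v) B ` UNIV"] by (simp add: S_def) (metis span_eq_iff)
      then have "direction_space ((*v) B ` P) = UNIV" using ds by simp
      then show ?thesis using face_volume_sum_top[OF Q, of j] j True by (simp add: g_def)
    next
      case False
      then have "(*v) B ` UNIV \<noteq> UNIV" by (auto simp: S_def)
      then have "direction_space ((*v) B ` P) \<noteq> UNIV" using ds by simp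
      then show ?thesis using face_volume_sum_degenerate[OF Q, of j] False by simp
    qed
  qed
  have gm: "g \<in> borel_measurable ?G" using g by (rule borel_measurable_has_bochner_integral)
  have hm: "(\<lambda>B. face_volume_sum j ?d ((*v) B ` P)) \<in> borel_measurable ?G"
    unfolding eq by (intro borel_measurable_times gm borel_measurable_indicator) (use Sb in simp)
  have "AE B in ?G. dim ((*v) B ` UNIV) = min (dim (UNIV :: (real^'n) set)) ?d"
    by (rule AE_dim_image) simp
  then have "AE B in ?G. face_volume_sum j ?d ((*v) B ` P) = g B"
    by (rule eventually_mono) (use dn in \<open>simp add: eq S_def indicator_def\<close>)
  then have "has_bochner_integral ?G (\<lambda>B. face_volume_sum j ?d ((*v) B ` P)) c"
    using g has_bochner_integral_cong_AE[OF hm gm] by simp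
  moreover have "c = (\<Sum>s = 0..?n - ?d. (-1) ^ s * face_volume_sum j (?d + s) P)"
  proof -
    let ?v = "\<lambda>k. (-1) ^ (?d + k) * face_volume_sum j k P"
    have "(\<Sum>k\<le>?n. ?v k) = (-1) ^ ?d * (\<Sum>k\<le>?n. (-1) ^ k * face_volume_sum j k P)"
      by (simp add: sum_distrib_left power_add mult.assoc)
    also have "\<dots> = 0" using alternating_face_volume_sum[OF P(1) _ full, of j] j dn by simp
    finally have z: "(\<Sum>k\<le>?n. ?v k) = 0" .
    have "{..?n} = {..<?d} \<union> {?d..?n}" using dn by auto
    then have "(\<Sum>k\<le>?n. ?v k) = (\<Sum>k<?d. ?v k) + (\<Sum>k = ?d..?n. ?v k)"
      by (simp add: sum.union_disjoint ivl_disj_int)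
    moreover have "(\<Sum>k = ?d..?n. ?v k) = (\<Sum>s = 0..?n - ?d. ?v (?d + s))"
      by (rule sum.reindex_bij_witness[where i = "\<lambda>s. ?d + s" and j = "\<lambda>k. k - ?d"]) (use dn in auto)
    moreover have "?v (?d + s) = (-1) ^ s * face_volume_sum j (?d + s) P" for s
      by (simp add: power_add mult.assoc[symmetric])
    moreover have "c = - (\<Sum>k<?d. ?v k)" by (simp add: c_def sum_negf)
    ultimately show ?thesis using z by simp
  qed
  ultimately show ?thesis by simp
qed

lemma has_bochner_integral_gaussian_matrix:
  fixes A :: "'w \<Rightarrow> real^'n^'d" and h :: "real^'n^'d \<Rightarrow> real"
  assumes M: "prob_space M" and A: "gaussian_matrix M A" and h: "has_bochner_integral matrix_gaussian h x"
  shows "has_bochner_integral M (\<lambda>\<omega>. h (A \<omega>)) x"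
proof -
  note d = distr_gaussian_matrix[OF M A]
  have hb: "h \<in> borel_measurable borel"
    using borel_measurable_has_bochner_integral[OF h] by (simp cong: measurable_cong_sets)
  show ?thesis
    using h unfolding has_bochner_integral_iff d(2)[symmetric]
    by (simp add: integrable_distr_eq[OF d(1) hb] integral_distr[OF d(1) hb])
qed

theorem corollary4p18:
  fixes P :: "(real^'n) set"
    and M :: "'w measure"
    and A :: "'w \<Rightarrow> real^'n^'d"
  assumes "CARD('d) \<le> CARD('n)"
    and "polyhedron P"
    and "interior P \<noteq> {}"
    and "prob_space M"
    and "gaussian_matrix M A"
  shows
    "(\<forall>j k. j < CARD('d) \<longrightarrow> j \<le> k \<longrightarrow> k < CARD('d) \<longrightarrow>
        has_bochner_integral M
          (\<lambda>\<omega>. \<Sum>F\<in>faces_of_dim j ((\<lambda>x. A \<omega> *v x) ` P).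
             conic_intrinsic_volume k (tangent_cone F ((\<lambda>x. A \<omega> *v x) ` P)))
          (\<Sum>G\<in>faces_of_dim j P. conic_intrinsic_volume k (tangent_cone G P))) \<and>
     (\<forall>j. j < CARD('d) \<longrightarrow>
        has_bochner_integral M
          (\<lambda>\<omega>. \<Sum>F\<in>faces_of_dim j ((\<lambda>x. A \<omega> *v x) ` P).
             conic_intrinsic_volume CARD('d) (tangent_cone F ((\<lambda>x. A \<omega> *v x) ` P)))
          (\<Sum>G\<in>faces_of_dim j P. \<Sum>s = 0..CARD('n) - CARD('d).
             (-1) ^ s * conic_intrinsic_volume (CARD('d) + s) (tangent_cone G P)))"
proof (intro conjI allI impI)
  fix j k assume jk: "j < CARD('d)" "k < CARD('d)"
  have "has_bochner_integral M (\<lambda>\<omega>. face_volume_sum j k ((\<lambda>x. A \<omega> *v x) ` P)) (face_volume_sum j k P)"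
    by (rule has_bochner_integral_gaussian_matrix[OF assms(4,5)
          has_bochner_integral_face_volume_sum[OF assms(2,1) jk]])
  then show "has_bochner_integral M
      (\<lambda>\<omega>. \<Sum>F\<in>faces_of_dim j ((\<lambda>x. A \<omega> *v x) ` P).
         conic_intrinsic_volume k (tangent_cone F ((\<lambda>x. A \<omega> *v x) ` P)))
      (\<Sum>G\<in>faces_of_dim j P. conic_intrinsic_volume k (tangent_cone G P))"
    by (simp only: face_volume_sum_def)
next
  fix j assume j: "j < CARD('d)"
  have "has_bochner_integral M (\<lambda>\<omega>. face_volume_sum j CARD('d) ((\<lambda>x. A \<omega> *v x) ` P))
      (\<Sum>s = 0..CARD('n) - CARD('d). (-1) ^ s * face_volume_sum j (CARD('d) + s) P)"
    by (rule has_bochner_integral_gaussian_matrix[OF assms(4,5)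
          has_bochner_integral_face_volume_sum_top[OF assms(2,3,1) j]])
  also have "(\<Sum>s = 0..CARD('n) - CARD('d). (-1) ^ s * face_volume_sum j (CARD('d) + s) P)
      = (\<Sum>G\<in>faces_of_dim j P. \<Sum>s = 0..CARD('n) - CARD('d).
           (-1) ^ s * conic_intrinsic_volume (CARD('d) + s) (tangent_cone G P))"
    unfolding face_volume_sum_def sum_distrib_left by (rule sum.swap)
  finally show "has_bochner_integral M
      (\<lambda>\<omega>. \<Sum>F\<in>faces_of_dim j ((\<lambda>x. A \<omega> *v x) ` P).
         conic_intrinsic_volume CARD('d) (tangent_cone F ((\<lambda>x. A \<omega> *v x) ` P)))
      (\<Sum>G\<in>faces_of_dim j P. \<Sum>s = 0..CARD('n) - CARD('d).
         (-1) ^ s * conic_intrinsic_volume (CARD('d) + s) (tangent_cone G P))"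
    by (simp only: face_volume_sum_def)
qed

end
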